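(* Let $p$ be a prime, $C_p$ the cyclic group of order $p$ with generator $\alpha$, and $R=\mathbb{Z}C_p$. For every $R$-module $M$ there is a short exact sequence of $R$-modules $$0\to N_1\to N_2\to M\to 0,$$ where $N_1$ and $N_2$ are free abelian groups, and each of $N_1$, $N_2$ is the direct sum of a free $R$-module and a trivial $R$-module. Moreover, the modules may be chosen so that the following holds: $N_2$ may be written in the form $N_2=\bigl(\bigoplus_j R\cdot\xi_j\bigr)\oplus\bigl(\bigoplus_k\mathbb{Z}\cdot\eta_k\bigr)$ (with each $R\cdot\xi_j$ free of rank one on $\xi_j$, and each $\mathbb{Z}\cdot\eta_k$ infinite cyclic with trivial action) so that every element of $M$ is the image of a basis element of the form $\alpha^i\xi_j$ or $\eta_k$.
   Context: A module over $R$ is trivial if $\alpha$ acts on it as the identity. *)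

theory Defs
  imports "HOL-Algebra.Algebra" "HOL-Computational_Algebra.Primes"
begin

text \<open>
  The integral group ring \<open>\<int>G\<close>: finitely supported functions \<open>G \<rightarrow> \<int>\<close>, so that the additive group
  is \<^const>\<open>free_Abelian_group\<close> on \<open>carrier G\<close> and \<open>frag_of g\<close> is the group element \<open>g\<close>; the
  product is the bilinear extension of the product of \<open>G\<close>.
\<close>

definition group_ring :: "('g, 'c) monoid_scheme \<Rightarrow> ('g \<Rightarrow>\<^sub>0 int) ring" where
  "group_ring G =
    \<lparr>carrier = {a. Poly_Mapping.keys a \<subseteq> carrier G},
     monoid.mult = (\<lambda>a b. frag_extend (\<lambda>x. frag_extend (\<lambda>y. frag_of (x \<otimes>\<^bsub>G\<^esub> y)) b) a),
     one = frag_of \<one>\<^bsub>G\<^esub>,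
     ring.zero = 0,
     ring.add = (+)\<rparr>"

lemma cring_group_ring:
  assumes "comm_group G"
  shows "cring (group_ring G)"
proof -
  interpret comm_group G by fact
  define m where
    "m = (\<lambda>a b. frag_extend (\<lambda>x. frag_extend (\<lambda>y. frag_of (x \<otimes>\<^bsub>G\<^esub> y)) b) a)"
  have of_l: "m (frag_of x) b = frag_extend (\<lambda>y. frag_of (x \<otimes>\<^bsub>G\<^esub> y)) b" for x b
    by (simp add: m_def)
  have add_l: "m (a + b) c = m a c + m b c" and diff_l: "m (a - b) c = m a c - m b c"
    and zero_l: "m 0 c = 0" for a b c
    by (simp_all add: m_def frag_extend_add frag_extend_diff)
  have cmul_diff: "frag_cmul k (a - b) = frag_cmul k a - frag_cmul k b" for k and a b :: "'a \<Rightarrow>\<^sub>0 int"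
    by (auto simp: right_diff_distrib lookup_minus poly_mapping_eqI)
  have diff_r: "m c (a - b) = m c a - m c b" and zero_r: "m c 0 = 0" for a b c
    by (simp_all add: m_def frag_extend_def[of _ c] frag_extend_diff
        cmul_diff sum_subtractf)
  have closed: "Poly_Mapping.keys (m a b) \<subseteq> carrier G"
    if "Poly_Mapping.keys a \<subseteq> carrier G" "Poly_Mapping.keys b \<subseteq> carrier G" for a b
  proof -
    have *: "Poly_Mapping.keys (frag_extend (\<lambda>y. frag_of (x \<otimes>\<^bsub>G\<^esub> y)) b) \<subseteq> carrier G"
      if "x \<in> carrier G" for x
      using keys_frag_extend[of "\<lambda>y. frag_of (x \<otimes>\<^bsub>G\<^esub> y)" b] that
        \<open>Poly_Mapping.keys b \<subseteq> carrier G\<close> by (auto simp: keys_frag_of dest!: subsetD)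
    show ?thesis
      unfolding m_def
      using keys_frag_extend[of "\<lambda>x. frag_extend (\<lambda>y. frag_of (x \<otimes>\<^bsub>G\<^esub> y)) b" a] * that
      by blast
  qed
  have comm: "m a b = m b a"
    if a: "Poly_Mapping.keys a \<subseteq> carrier G" and b: "Poly_Mapping.keys b \<subseteq> carrier G" for a b
    using a
  proof (induction a rule: frag_induction)
    case (one x)
    from b show ?case
      by (induction b rule: frag_induction) (use one in \<open>auto simp: of_l zero_l zero_r diff_l diff_r frag_extend_diff m_comm\<close>)
  qed (auto simp: zero_l zero_r diff_l diff_r)
  have assoc: "m (m a b) c = m a (m b c)"
    if a: "Poly_Mapping.keys a \<subseteq> carrier G" and b: "Poly_Mapping.keys b \<subseteq> carrier G"
      and c: "Poly_Mapping.keys c \<subseteq> carrier G" for a b c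
    using a
  proof (induction a rule: frag_induction)
    case (one x)
    from b show ?case
    proof (induction b rule: frag_induction)
      case y: (one y)
      from c show ?case
        by (induction c rule: frag_induction)
          (use one y in \<open>auto simp: of_l zero_r diff_r frag_extend_diff m_assoc\<close>)
    qed (auto simp: zero_l zero_r diff_l diff_r)
  qed (auto simp: zero_l zero_r diff_l diff_r)
  have one_l: "m (frag_of \<one>\<^bsub>G\<^esub>) a = a" if "Poly_Mapping.keys a \<subseteq> carrier G" for a
    using that by (induction a rule: frag_induction) (auto simp: of_l zero_r diff_r)
  have R: "group_ring G = \<lparr>carrier = {a. Poly_Mapping.keys a \<subseteq> carrier G}, monoid.mult = m,
      one = frag_of \<one>\<^bsub>G\<^esub>, ring.zero = 0, ring.add = (+)\<rparr>"
    by (simp add: group_ring_def m_def)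
  show ?thesis
  proof (rule cringI)
    have "add_monoid (group_ring G) = free_Abelian_group (carrier G)"
      by (simp add: R free_Abelian_group_def)
    then show "abelian_group (group_ring G)"
      using abelian_free_Abelian_group[of "carrier G"]
      by (simp add: abelian_group_def abelian_group_axioms_def abelian_monoid_def
          comm_group_def)
    show "comm_monoid (group_ring G)"
      by (rule comm_monoidI) (simp_all add: R assoc one_l closed keys_frag_of, metis comm)
  qed (simp add: R add_l)
qed

definition module_hom ::
    "('r, 'b) ring_scheme \<Rightarrow> ('r, 'm, 'c) module_scheme \<Rightarrow> ('r, 'n, 'd) module_scheme \<Rightarrow> ('m \<Rightarrow> 'n) set"
  where
  "module_hom R M N =
    {f \<in> hom (add_monoid M) (add_monoid N).
       \<forall>r\<in>carrier R. \<forall>x\<in>carrier M. f (r \<odot>\<^bsub>M\<^esub> x) = r \<odot>\<^bsub>N\<^esub> f x}"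

text \<open>The library's \<^const>\<open>short_exact_sequence\<close> forces all groups to have the same element type.\<close>

definition module_short_exact ::
    "('r, 'b) ring_scheme \<Rightarrow> ('r, 'l, 'c) module_scheme \<Rightarrow> ('r, 'm, 'd) module_scheme \<Rightarrow>
     ('r, 'n, 'e) module_scheme \<Rightarrow> ('l \<Rightarrow> 'm) \<Rightarrow> ('m \<Rightarrow> 'n) \<Rightarrow> bool"
  where
  "module_short_exact R L M N f g \<longleftrightarrow>
     f \<in> module_hom R L M \<and> g \<in> module_hom R M N \<and>
     inj_on f (carrier L) \<and>
     f ` carrier L = kernel (add_monoid M) (add_monoid N) g \<and>
     g ` carrier M = carrier N"

text \<open>
  \<open>M\<close> is the internal direct sum of the submodules \<open>S i\<close>, \<open>i \<in> I\<close>: the sum map from the external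
  direct sum is bijective (it is automatically linear over \<open>R\<close>).
\<close>

definition internal_direct_sum ::
    "('r, 'b) ring_scheme \<Rightarrow> ('r, 'm, 'c) module_scheme \<Rightarrow> 'i set \<Rightarrow> ('i \<Rightarrow> 'm set) \<Rightarrow> bool"
  where
  "internal_direct_sum R M I S \<longleftrightarrow>
     (\<forall>i\<in>I. submodule (S i) R M) \<and>
     (\<lambda>s. gfinprod (add_monoid M) s I)
       \<in> iso (sum_group I (\<lambda>i. add_monoid (M\<lparr>carrier := S i\<rparr>))) (add_monoid M)"

definition cyclic_submodule ::
    "('r, 'b) ring_scheme \<Rightarrow> ('r, 'm, 'c) module_scheme \<Rightarrow> 'm \<Rightarrow> 'm set"
  where "cyclic_submodule R M x = (\<lambda>r. r \<odot>\<^bsub>M\<^esub> x) ` carrier R"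

text \<open>The cyclic submodule \<open>R x\<close> is free of rank one on \<open>x\<close>.\<close>

definition free_generator ::
    "('r, 'b) ring_scheme \<Rightarrow> ('r, 'm, 'c) module_scheme \<Rightarrow> 'm \<Rightarrow> bool"
  where
  "free_generator R M x \<longleftrightarrow> x \<in> carrier M \<and> inj_on (\<lambda>r. r \<odot>\<^bsub>M\<^esub> x) (carrier R)"

definition free_module :: "('r, 'b) ring_scheme \<Rightarrow> ('r, 'm, 'c) module_scheme \<Rightarrow> bool" where
  "free_module R M \<longleftrightarrow>
     (\<exists>B. (\<forall>b\<in>B. free_generator R M b) \<and> internal_direct_sum R M B (cyclic_submodule R M))"

definition int_multiples :: "('r, 'm, 'c) module_scheme \<Rightarrow> 'm \<Rightarrow> 'm set" where
  "int_multiples M x = range (\<lambda>n::int. [n] \<cdot>\<^bsub>M\<^esub> x)"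

text \<open>\<open>\<alpha>\<close> is the chosen generator of the group.\<close>

definition trivial_module :: "'g \<Rightarrow> ('g \<Rightarrow>\<^sub>0 int, 'm, 'c) module_scheme \<Rightarrow> bool" where
  "trivial_module \<alpha> M \<longleftrightarrow> (\<forall>x\<in>carrier M. frag_of \<alpha> \<odot>\<^bsub>M\<^esub> x = x)"

text \<open>
  A basis can always be chosen inside the group, so taking \<open>S\<close> in the element type of \<open>A\<close> is no
  restriction.
\<close>

definition free_abelian :: "('a, 'c) monoid_scheme \<Rightarrow> bool" where
  "free_abelian A \<longleftrightarrow> (\<exists>S :: 'a set. A \<cong> free_Abelian_group S)"

definition free_plus_trivial ::
    "('g, 'b) monoid_scheme \<Rightarrow> 'g \<Rightarrow> ('g \<Rightarrow>\<^sub>0 int, 'm, 'c) module_scheme \<Rightarrow> bool"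
  where
  "free_plus_trivial G \<alpha> N \<longleftrightarrow>
     (\<exists>F T. internal_direct_sum (group_ring G) N UNIV (\<lambda>b. if b then F else T) \<and>
        free_module (group_ring G) (N\<lparr>carrier := F\<rparr>) \<and>
        trivial_module \<alpha> (N\<lparr>carrier := T\<rparr>))"

text \<open>
  HOL cannot quantify existentially over types, so the elements of the modules asserted to exist
  need a fixed type.  This one contains a free module of rank \<open>|M| \<cdot> \<aleph>\<^sub>0\<close> plus a trivial
  module of that rank.
\<close>

type_synonym ('g, 'm) resolution_elem =
  "('m \<times> nat \<Rightarrow>\<^sub>0 ('g \<Rightarrow>\<^sub>0 int)) \<times> ('m \<times> nat \<Rightarrow>\<^sub>0 int)"

end

theory Submission
  imports Defs "HOL-Library.Product_Plus" "HOL-Library.Function_Algebras"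
begin

text \<open>
  Write \<open>R\<close> for the group ring of the cyclic group of prime order \<open>p\<close> and \<open>H\<^sup>i\<close> for Tate cohomology,
  so that \<open>H\<^sup>0\<close> is invariants modulo norms and \<open>H\<^sup>1\<close> is elements of norm zero modulo the image
  of \<open>\<alpha> - 1\<close>.  Call a direct sum of a free \<open>R\<close>-module and a free abelian group with trivial action
  a permutation module; its \<open>H\<^sup>1\<close> vanishes.

  Map the permutation module \<open>L\<close> with a free generator for each element of \<open>M\<close> and a fixed generator
  for each fixed element onto \<open>M\<close>.  Every fixed element of \<open>M\<close> is then the image of a fixed element
  of \<open>L\<close>, so that the kernel \<open>N\<close> has \<open>H\<^sup>1(N) = 0\<close>; as a subgroup of a free abelian group it is free
  abelian (\<open>subgroup_of_free_is_free\<close>).  It remains to make \<open>N\<close> a permutation module by adding the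
  same free module to \<open>N\<close> and to \<open>L\<close> (\<open>stably_permutation\<close>).

  To this end, choose an epimorphism \<open>E \<rightarrow> N\<close> from a permutation module whose trivial part maps to a
  basis of the vector space \<open>H\<^sup>0(N)\<close> over the field with \<open>p\<close> elements; it is here that a basis of the
  invariants of \<open>N\<close> must be thinned out to a basis of a quotient (\<open>basis_mod_subgroup\<close>).  By the long
  exact sequence its kernel \<open>K\<close> has vanishing Tate cohomology.  Such a \<open>K\<close>, being free
  abelian, has an additive endomorphism whose trace, the sum of its conjugates, is the identity
  (\<open>identity_is_trace\<close>): modulo \<open>p\<close> there is an endomorphism whose trace is the identity on
  invariants, hence differs from the identity by a nilpotent map because \<open>\<alpha> - 1\<close> is nilpotent
  modulo \<open>p\<close>; a geometric series makes the trace equal to the identity modulo \<open>p\<close>, and the remaining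
  error \<open>p \<psi>\<close> is the trace of the equivariant map \<open>\<psi>\<close>.  Averaging with this endomorphism turns
  additive sections and retractions into equivariant ones.  So \<open>K\<close> is a direct summand both of \<open>E\<close>
  and of the free module \<open>P\<close> induced from \<open>K\<close>.  With \<open>Q = P \<oplus> P \<oplus> \<dots>\<close>, Eilenberg's swindle gives
  \<open>K \<oplus> Q \<cong> Q\<close> and therefore \<open>N \<oplus> Q \<cong> N \<oplus> K \<oplus> Q \<cong> E \<oplus> Q\<close> (\<open>swindle\<close>), and
  \<open>0 \<rightarrow> N \<oplus> Q \<rightarrow> L \<oplus> Q \<rightarrow> M \<rightarrow> 0\<close> is the required sequence.

  All this is carried out for subgroups of types of class \<open>ab_group_add\<close> with the operator by which
  \<open>\<alpha>\<close> acts; modules over the group ring enter only at the end.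
\<close>

section \<open>Subgroups, additive maps and integer combinations\<close>

text \<open>Subgroups of the additive group of a type.\<close>

definition subgrp :: "'a::ab_group_add set \<Rightarrow> bool" where
  "subgrp H \<longleftrightarrow> 0 \<in> H \<and> (\<forall>x\<in>H. \<forall>y\<in>H. x - y \<in> H)"

lemma subgrpI: "0 \<in> H \<Longrightarrow> (\<And>x y. x \<in> H \<Longrightarrow> y \<in> H \<Longrightarrow> x - y \<in> H) \<Longrightarrow> subgrp H"
  by (auto simp: subgrp_def)

lemma subgrp_zero: "subgrp H \<Longrightarrow> 0 \<in> H"
  and subgrp_diff: "subgrp H \<Longrightarrow> x \<in> H \<Longrightarrow> y \<in> H \<Longrightarrow> x - y \<in> H"
  by (auto simp: subgrp_def)

lemma subgrp_minus: "subgrp H \<Longrightarrow> x \<in> H \<Longrightarrow> - x \<in> H"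
  using subgrp_diff[of H 0 x] by (simp add: subgrp_zero)

lemma subgrp_add: "subgrp H \<Longrightarrow> x \<in> H \<Longrightarrow> y \<in> H \<Longrightarrow> x + y \<in> H"
  using subgrp_diff[of H x "- y"] by (simp add: subgrp_minus)

lemma subgrp_sum: "subgrp H \<Longrightarrow> (\<And>i. i \<in> I \<Longrightarrow> f i \<in> H) \<Longrightarrow> sum f I \<in> H"
  by (induction I rule: infinite_finite_induct) (auto simp: subgrp_zero subgrp_add)

lemmas subgrp_intros = subgrp_zero subgrp_diff subgrp_minus subgrp_add subgrp_sum

lemma subgrp_UNIV: "subgrp UNIV"
  by (simp add: subgrp_def)

lemma subgrp_Times: "subgrp H \<Longrightarrow> subgrp K \<Longrightarrow> subgrp (H \<times> K)"
  by (auto simp: subgrp_def zero_prod_def)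

text \<open>Additivity is only required on \<open>H\<close>; the values elsewhere are irrelevant.\<close>

definition additive_on :: "'a::ab_group_add set \<Rightarrow> ('a \<Rightarrow> 'b::ab_group_add) \<Rightarrow> bool" where
  "additive_on H f \<longleftrightarrow> (\<forall>x\<in>H. \<forall>y\<in>H. f (x + y) = f x + f y)"

lemma additive_onI: "(\<And>x y. x \<in> H \<Longrightarrow> y \<in> H \<Longrightarrow> f (x + y) = f x + f y) \<Longrightarrow> additive_on H f"
  by (auto simp: additive_on_def)

lemma additive_on_add: "additive_on H f \<Longrightarrow> x \<in> H \<Longrightarrow> y \<in> H \<Longrightarrow> f (x + y) = f x + f y"
  by (auto simp: additive_on_def)

lemma additive_on_subset: "additive_on H f \<Longrightarrow> K \<subseteq> H \<Longrightarrow> additive_on K f"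
  by (auto simp: additive_on_def)

lemma additive_on_zero:
  assumes "additive_on H f" "subgrp H" shows "f 0 = 0"
  using additive_on_add[of H f 0 0] assms by (simp add: subgrp_zero)

lemma additive_on_minus:
  assumes "additive_on H f" "subgrp H" "x \<in> H" shows "f (- x) = - f x"
  using additive_on_add[of H f x "- x"] assms
  by (simp add: subgrp_minus additive_on_zero minus_unique)

lemma additive_on_diff:
  assumes "additive_on H f" "subgrp H" "x \<in> H" "y \<in> H" shows "f (x - y) = f x - f y"
  using additive_on_add[of H f x "- y"] assms
  by (simp add: subgrp_minus additive_on_minus)

lemma additive_on_sum:
  assumes "additive_on H f" "subgrp H" "\<And>i. i \<in> I \<Longrightarrow> g i \<in> H"
  shows "f (sum g I) = (\<Sum>i\<in>I. f (g i))"
  using assms(3)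
  by (induction I rule: infinite_finite_induct)
     (auto simp: additive_on_zero[OF assms(1,2)] additive_on_add[OF assms(1)] subgrp_sum[OF assms(2)])

lemma additive_on_comp:
  assumes "additive_on K f" "additive_on H g" "\<And>x. x \<in> H \<Longrightarrow> g x \<in> K"
  shows "additive_on H (\<lambda>x. f (g x))"
  using assms by (auto simp: additive_on_def)

lemma additive_on_plus:
  assumes "additive_on H f" "additive_on H g"
  shows "additive_on H (\<lambda>x. f x + g x)" "additive_on H (\<lambda>x. f x - g x)"
  using assms by (auto simp: additive_on_def algebra_simps)

lemma additive_on_SUM:
  assumes "\<And>i. i \<in> I \<Longrightarrow> additive_on H (f i)"
  shows "additive_on H (\<lambda>x. \<Sum>i\<in>I. f i x)"
  using assms by (auto simp: additive_on_def sum.distrib)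

lemma additive_on_inj_iff:
  assumes "additive_on H f" "subgrp H"
  shows "inj_on f H \<longleftrightarrow> (\<forall>x\<in>H. f x = 0 \<longrightarrow> x = 0)"
proof
  assume "inj_on f H" then show "\<forall>x\<in>H. f x = 0 \<longrightarrow> x = 0"
    using assms by (metis additive_on_zero inj_onD subgrp_zero)
next
  assume *: "\<forall>x\<in>H. f x = 0 \<longrightarrow> x = 0"
  show "inj_on f H"
  proof (rule inj_onI)
    fix x y assume "x \<in> H" "y \<in> H" "f x = f y"
    then have "f (x - y) = 0" "x - y \<in> H"
      using assms by (auto simp: additive_on_diff subgrp_diff)
    then show "x = y" using * by auto
  qed
qed

lemma subgrp_image:
  assumes "additive_on H f" "subgrp H" shows "subgrp (f ` H)"
proof (rule subgrpI)
  show "0 \<in> f ` H" using additive_on_zero[OF assms] assms(2) subgrp_zero by (metis image_eqI)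
  fix x y assume "x \<in> f ` H" "y \<in> f ` H"
  then obtain a b where "a \<in> H" "b \<in> H" "x = f a" "y = f b" by blast
  then have "x - y = f (a - b)" "a - b \<in> H"
    by (simp_all add: additive_on_diff[OF assms] subgrp_diff[OF assms(2)])
  then show "x - y \<in> f ` H" by blast
qed

lemma subgrp_preimage:
  assumes "additive_on H f" "subgrp H" "subgrp K" shows "subgrp {x \<in> H. f x \<in> K}"
  using assms
  by (intro subgrpI) (auto simp: subgrp_zero additive_on_zero additive_on_diff subgrp_diff)

lemma additive_on_inv_into:
  assumes "bij_betw f H K" "additive_on H f" "subgrp H"
  shows "additive_on K (inv_into H f)"
proof (rule additive_onI)
  fix x y assume "x \<in> K" "y \<in> K"
  then obtain a b where *: "a \<in> H" "b \<in> H" "x = f a" "y = f b"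
    using assms(1) by (auto simp: bij_betw_def)
  moreover have "a + b \<in> H" using * assms(3) by (simp add: subgrp_add)
  ultimately show "inv_into H f (x + y) = inv_into H f x + inv_into H f y"
    using * bij_betw_imp_inj_on[OF assms(1)] by (simp flip: additive_on_add[OF assms(2)])
qed

text \<open>
  Integer multiples in an additive abelian group, as powers in the corresponding multiplicatively
  written group.
\<close>

definition zmul :: "int \<Rightarrow> 'a::ab_group_add \<Rightarrow> 'a" (infixr \<open>*\<^sub>z\<close> 75) where
  "n *\<^sub>z x = x [^]\<^bsub>\<lparr>carrier = UNIV, monoid.mult = (+), one = 0\<rparr>\<^esub> n"

lemma comm_group_class:
  "comm_group \<lparr>carrier = UNIV, monoid.mult = (+), one = (0::'a::ab_group_add)\<rparr>"
proof (rule comm_groupI, simp_all add: algebra_simps)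
  show "\<exists>y. x + y = 0" for x :: 'a
    by (rule exI[of _ "- x"]) simp
qed

lemma zmul_add_left: "(m + n) *\<^sub>z x = m *\<^sub>z x + n *\<^sub>z (x :: 'a::ab_group_add)"
proof -
  interpret comm_group "\<lparr>carrier = UNIV, monoid.mult = (+), one = (0::'a::ab_group_add)\<rparr>"
    by (rule comm_group_class)
  show ?thesis using int_pow_mult[of x m n] by (simp add: zmul_def)
qed

lemma zmul_0_left [simp]: "0 *\<^sub>z x = 0"
  by (simp add: zmul_def)

lemma zmul_1_left [simp]: "1 *\<^sub>z x = (x :: 'a::ab_group_add)"
proof -
  interpret comm_group "\<lparr>carrier = UNIV, monoid.mult = (+), one = (0::'a::ab_group_add)\<rparr>"
    by (rule comm_group_class)
  show ?thesis using int_pow_1[of x] by (simp add: zmul_def)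
qed

lemma zmul_minus_left [simp]: "(- n) *\<^sub>z x = - (n *\<^sub>z x)"
  using zmul_add_left[of "-n" n x] by (simp add: eq_neg_iff_add_eq_0)

lemma zmul_diff_left: "(m - n) *\<^sub>z x = m *\<^sub>z x - n *\<^sub>z x"
  using zmul_add_left[of m "-n" x] by simp

lemma zmul_closed: "subgrp H \<Longrightarrow> x \<in> H \<Longrightarrow> n *\<^sub>z x \<in> H"
  by (induction n rule: int_induct[where k = 0])
     (auto simp: zmul_add_left zmul_diff_left subgrp_intros)

lemma subgrp_diff_zmul: "subgrp H \<Longrightarrow> x \<in> H \<Longrightarrow> y \<in> H \<Longrightarrow> x - n *\<^sub>z y \<in> H"
  and subgrp_add_zmul: "subgrp H \<Longrightarrow> x \<in> H \<Longrightarrow> y \<in> H \<Longrightarrow> x + n *\<^sub>z y \<in> H"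
  by (simp_all add: subgrp_diff subgrp_add zmul_closed)

lemma additive_on_zmul:
  assumes "additive_on H f" "subgrp H" "x \<in> H" shows "f (n *\<^sub>z x) = n *\<^sub>z f x"
  by (induction n rule: int_induct[where k = 0])
     (use assms in \<open>auto simp: zmul_add_left zmul_diff_left additive_on_zero additive_on_add
        additive_on_diff zmul_closed\<close>)

lemma zmul_add_right: "n *\<^sub>z (x + y) = n *\<^sub>z x + n *\<^sub>z y"
  by (induction n rule: int_induct[where k = 0])
     (auto simp: zmul_add_left zmul_diff_left)

lemma additive_zmul: "additive_on H (\<lambda>x. n *\<^sub>z x)"
  by (simp add: additive_on_def zmul_add_right)

lemma zmul_0_right [simp]: "n *\<^sub>z 0 = 0"
  using additive_on_zero[OF additive_zmul subgrp_UNIV] .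

lemma zmul_diff_right: "n *\<^sub>z (x - y) = n *\<^sub>z x - n *\<^sub>z y"
  using additive_on_diff[OF additive_zmul subgrp_UNIV] by simp

lemma zmul_zmul: "m *\<^sub>z n *\<^sub>z x = (m * n) *\<^sub>z x"
  by (induction m rule: int_induct[where k = 0])
     (auto simp: zmul_add_left zmul_diff_left distrib_right left_diff_distrib)

lemma zmul_int [simp]: "m *\<^sub>z n = m * (n::int)"
  by (induction m rule: int_induct[where k = 0])
     (auto simp: zmul_add_left zmul_diff_left distrib_right left_diff_distrib)

lemma sum_const_zmul: "(\<Sum>i\<in>I. x) = int (card I) *\<^sub>z x"
  by (induction I rule: infinite_finite_induct) (auto simp: zmul_add_left)

lemma lookup_zmul [simp]: "Poly_Mapping.lookup (n *\<^sub>z z) x = n * Poly_Mapping.lookup z x"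
proof -
  have "additive_on UNIV (\<lambda>z. Poly_Mapping.lookup z x)"
    by (simp add: additive_on_def lookup_add)
  from additive_on_zmul[OF this subgrp_UNIV, of z n] show ?thesis by simp
qed

text \<open>
  The free abelian group on a set \<open>S\<close>: the formal integer combinations with support in \<open>S\<close>.  A map
  from \<open>S\<close> to an abelian group extends to an additive map \<open>zlin\<close>.
\<close>

definition fsupp :: "'x set \<Rightarrow> ('x \<Rightarrow>\<^sub>0 int) set" where
  "fsupp S = {z. Poly_Mapping.keys z \<subseteq> S}"

definition zlin :: "('x \<Rightarrow> 'a::ab_group_add) \<Rightarrow> ('x \<Rightarrow>\<^sub>0 int) \<Rightarrow> 'a" where
  "zlin b z = (\<Sum>x\<in>Poly_Mapping.keys z. Poly_Mapping.lookup z x *\<^sub>z b x)"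

lemma fsupp_iff: "z \<in> fsupp S \<longleftrightarrow> (\<forall>x. x \<notin> S \<longrightarrow> Poly_Mapping.lookup z x = 0)"
  by (auto simp: fsupp_def in_keys_iff)

lemma subgrp_fsupp: "subgrp (fsupp S)"
  by (auto simp: subgrp_def fsupp_iff lookup_minus)

lemma frag_of_fsupp [simp]: "frag_of x \<in> fsupp S \<longleftrightarrow> x \<in> S"
  by (auto simp: fsupp_def keys_frag_of)

lemma fsupp_mono: "S \<subseteq> T \<Longrightarrow> fsupp S \<subseteq> fsupp T"
  by (auto simp: fsupp_def)

lemma fsupp_UNIV [simp]: "fsupp UNIV = UNIV"
  by (simp add: fsupp_def)

lemma zlin_superset:
  assumes "finite I" "Poly_Mapping.keys z \<subseteq> I"
  shows "zlin b z = (\<Sum>x\<in>I. Poly_Mapping.lookup z x *\<^sub>z b x)"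
  unfolding zlin_def using assms
  by (intro sum.mono_neutral_left) (auto simp: in_keys_iff)

lemma zlin_add: "zlin b (y + z) = zlin b y + zlin b z"
proof -
  let ?I = "Poly_Mapping.keys y \<union> Poly_Mapping.keys z"
  have "Poly_Mapping.keys (y + z) \<subseteq> ?I" by (rule Poly_Mapping.keys_add)
  then show ?thesis
    by (simp add: zlin_superset[of ?I] lookup_add zmul_add_left sum.distrib)
qed

lemma additive_zlin: "additive_on H (zlin b)"
  by (simp add: additive_on_def zlin_add)

lemma zlin_diff: "zlin b (y - z) = zlin b y - zlin b z"
  using additive_on_diff[OF additive_zlin subgrp_UNIV] by simp

lemma zlin_0 [simp]: "zlin b 0 = 0"
  by (simp add: zlin_def)

lemma zlin_frag_of [simp]: "zlin b (frag_of x) = b x"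
  by (simp add: zlin_def keys_frag_of)

lemma zlin_closed: "subgrp H \<Longrightarrow> (\<And>x. x \<in> S \<Longrightarrow> b x \<in> H) \<Longrightarrow> z \<in> fsupp S \<Longrightarrow> zlin b z \<in> H"
  unfolding zlin_def by (rule subgrp_sum) (auto simp: fsupp_def intro!: zmul_closed)

text \<open>Additive maps on a free abelian group that agree on the basis are equal.\<close>

lemma additive_on_fsupp_eqI:
  assumes "z \<in> fsupp S" "additive_on (fsupp S) f" "additive_on (fsupp S) g"
    and "\<And>x. x \<in> S \<Longrightarrow> f (frag_of x) = g (frag_of x)"
  shows "f z = g z"
proof -
  have "z \<in> fsupp S \<and> f z = g z"
  proof (rule frag_induction[of z S])
    show "Poly_Mapping.keys z \<subseteq> S" using assms(1) by (simp add: fsupp_def)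
    show "0 \<in> fsupp S \<and> f 0 = g 0"
      using assms(2,3)[THEN additive_on_zero] by (simp add: subgrp_fsupp subgrp_zero)
    fix a b assume "a \<in> fsupp S \<and> f a = g a" "b \<in> fsupp S \<and> f b = g b"
    then show "a - b \<in> fsupp S \<and> f (a - b) = g (a - b)"
      using assms(2,3)[THEN additive_on_diff] by (simp add: subgrp_fsupp subgrp_diff)
  qed (use assms(4) in auto)
  then show ?thesis by simp
qed

lemma fsupp_additive_closed:
  assumes "subgrp H" "additive_on (fsupp S) f" "\<And>x. x \<in> S \<Longrightarrow> f (frag_of x) \<in> H" "z \<in> fsupp S"
  shows "f z \<in> H"
  using zlin_closed[of H S "\<lambda>x. f (frag_of x)" z] assms
    additive_on_fsupp_eqI[of z S f "zlin (\<lambda>x. f (frag_of x))"] by (simp add: additive_zlin)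

section \<open>Subgroups of free abelian groups\<close>

text \<open>
  A fixed well-order of the index type; every non-zero combination then has a leading index.
  \<open>below i\<close> consists of the combinations whose indices are at most \<open>i\<close>.
\<close>

definition index_order :: "'x rel" where
  "index_order = (SOME r. Well_order r \<and> Field r = UNIV)"

definition below :: "'x \<Rightarrow> ('x \<Rightarrow>\<^sub>0 int) set" where
  "below i = fsupp {j. (j, i) \<in> index_order}"

lemma index_order: "Well_order (index_order :: 'x rel)" "Field (index_order :: 'x rel) = UNIV"
proof -
  have "\<exists>r :: 'x rel. Well_order r \<and> Field r = UNIV"
    using well_ordering by blast
  from someI_ex[OF this] show "Well_order (index_order :: 'x rel)" "Field (index_order :: 'x rel) = UNIV"
    unfolding index_order_def by auto
qed

lemma index_order_refl: "(i, i) \<in> index_order"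
  using index_order by (metis UNIV_I order_on_defs(1,2,3) partial_order_on_def refl_onD well_order_on_def preorder_on_def)

lemma index_order_total: "(i, j) \<in> index_order \<or> (j, i) \<in> index_order"
proof (cases "i = j")
  case False
  then show ?thesis
    using index_order by (metis UNIV_I linear_order_on_def total_on_def well_order_on_def)
qed (simp add: index_order_refl)

lemma index_order_trans: "(i, j) \<in> index_order \<Longrightarrow> (j, k) \<in> index_order \<Longrightarrow> (i, k) \<in> index_order"
  using index_order by (metis linear_order_on_def partial_order_on_def preorder_on_def transE well_order_on_def)

lemma index_order_antisym: "(i, j) \<in> index_order \<Longrightarrow> (j, i) \<in> index_order \<Longrightarrow> i = j"
  using index_order by (metis linear_order_on_def partial_order_on_def antisymD well_order_on_def)

lemma wf_index_order: "wf (index_order - Id)"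
  using index_order(1) by (auto simp: well_order_on_def)

lemma subgrp_below: "subgrp (below i)"
  by (simp add: below_def subgrp_fsupp)

lemma leading_index:
  assumes "z \<noteq> 0"
  obtains i where "z \<in> below i" "Poly_Mapping.lookup z i \<noteq> 0"
proof -
  have "\<exists>i\<in>K. \<forall>j\<in>K. (j, i) \<in> index_order" if "finite K" "K \<noteq> {}" for K :: "'a set"
    using that
  proof (induction rule: finite_ne_induct)
    case (singleton x) then show ?case by (simp add: index_order_refl)
  next
    case (insert x F)
    then obtain i where "i \<in> F" "\<forall>j\<in>F. (j, i) \<in> index_order" by blast
    then show ?case
      using index_order_total[of x i] index_order_refl[of x] index_order_trans[of _ i x] by blast
  qed
  from this[of "Poly_Mapping.keys z"] assms obtain i
    where "i \<in> Poly_Mapping.keys z" "\<forall>j\<in>Poly_Mapping.keys z. (j, i) \<in> index_order" by auto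
  then show ?thesis using that[of i] by (auto simp: below_def fsupp_def in_keys_iff)
qed

lemma leading_index_induct:
  assumes zero: "P 0"
    and step: "\<And>i z. z \<in> below i \<Longrightarrow> Poly_Mapping.lookup z i \<noteq> 0 \<Longrightarrow>
        (\<And>y. y \<in> below i \<Longrightarrow> Poly_Mapping.lookup y i = 0 \<Longrightarrow> P y) \<Longrightarrow> P z"
  shows "P z"
proof -
  have main: "\<forall>z\<in>below i. P z" for i
  proof (induction i rule: wf_induct_rule[OF wf_index_order])
    case (1 i)
    have *: "P y" if y: "y \<in> below i" "Poly_Mapping.lookup y i = 0" for y
    proof (cases "y = 0")
      case False
      then obtain j where j: "y \<in> below j" "Poly_Mapping.lookup y j \<noteq> 0"
        by (rule leading_index)
      then have "(j, i) \<in> index_order - Id"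
        using y by (auto simp: below_def fsupp_iff)
      then show ?thesis using 1 j by blast
    qed (simp add: zero)
    then show ?case using step[of _ i] by blast
  qed
  show ?thesis
  proof (cases "z = 0")
    case False
    then show ?thesis using main leading_index by blast
  qed (simp add: zero)
qed

text \<open>
  Leading terms of a subgroup: \<open>h i\<close> is an element with leading index \<open>i\<close> whose leading coefficient
  generates the ideal of all coefficients at \<open>i\<close> of elements of \<open>H\<close> lying in \<open>below i\<close>.
\<close>

lemma leading_terms:
  assumes H: "subgrp H"
  obtains S h where
    "\<And>i. i \<in> S \<Longrightarrow> h i \<in> H \<and> h i \<in> below i \<and> Poly_Mapping.lookup (h i) i \<noteq> 0"
    "\<And>z i. z \<in> H \<Longrightarrow> z \<in> below i \<Longrightarrow> Poly_Mapping.lookup z i \<noteq> 0 \<Longrightarrow>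
        i \<in> S \<and> Poly_Mapping.lookup (h i) i dvd Poly_Mapping.lookup z i"
proof -
  define Q where "Q i z \<longleftrightarrow> z \<in> H \<and> z \<in> below i \<and> Poly_Mapping.lookup z i \<noteq> 0" for i z
  define S where "S = {i. \<exists>z. Q i z}"
  have "\<exists>z. Q i z \<and> (\<forall>y. Q i y \<longrightarrow>
      nat \<bar>Poly_Mapping.lookup z i\<bar> \<le> nat \<bar>Poly_Mapping.lookup y i\<bar>)" if "i \<in> S" for i
    using that ex_has_least_nat[of "Q i" _ "\<lambda>z. nat \<bar>Poly_Mapping.lookup z i\<bar>"]
    unfolding S_def by blast
  then obtain h where h: "\<And>i. i \<in> S \<Longrightarrow> Q i (h i)"
    "\<And>i y. i \<in> S \<Longrightarrow> Q i y \<Longrightarrow>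
       nat \<bar>Poly_Mapping.lookup (h i) i\<bar> \<le> nat \<bar>Poly_Mapping.lookup y i\<bar>"
    by metis
  show thesis
  proof (rule that)
    fix z i assume z: "z \<in> H" "z \<in> below i" "Poly_Mapping.lookup z i \<noteq> 0"
    then have i: "i \<in> S" by (auto simp: S_def Q_def)
    let ?a = "Poly_Mapping.lookup (h i) i" and ?c = "Poly_Mapping.lookup z i"
    have a: "?a \<noteq> 0" "h i \<in> H" "h i \<in> below i" using h(1)[OF i] by (auto simp: Q_def)
    let ?y = "z - (?c div ?a) *\<^sub>z h i"
    have "Poly_Mapping.lookup ?y i = ?c mod ?a"
      by (simp add: lookup_minus minus_div_mult_eq_mod)
    moreover have "?y \<in> H" "?y \<in> below i"
      using z a H by (simp_all add: subgrp_diff_zmul subgrp_below)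
    moreover have "\<bar>?c mod ?a\<bar> < \<bar>?a\<bar>" using a abs_mod_less by blast
    ultimately have "?c mod ?a = 0"
      using h(2)[OF i, of ?y] unfolding Q_def by (metis abs_ge_zero nat_less_eq_zless not_le)
    then show "i \<in> S \<and> ?a dvd ?c" using i by auto
  qed (use h in \<open>auto simp: Q_def\<close>)
qed

text \<open>\<open>b\<close> is a basis, indexed by \<open>S\<close>, of the abelian group \<open>H\<close>.\<close>

definition zbasis :: "'x set \<Rightarrow> ('x \<Rightarrow> 'a::ab_group_add) \<Rightarrow> 'a set \<Rightarrow> bool" where
  "zbasis S b H \<longleftrightarrow> bij_betw (zlin b) (fsupp S) H"

lemma zbasisI:
  assumes "\<And>z. z \<in> fsupp S \<Longrightarrow> zlin b z = 0 \<Longrightarrow> z = 0"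
    and "\<And>x. x \<in> S \<Longrightarrow> b x \<in> H" and "subgrp H"
    and "\<And>y. y \<in> H \<Longrightarrow> y \<in> zlin b ` fsupp S"
  shows "zbasis S b H"
  unfolding zbasis_def bij_betw_def
  using assms by (auto simp: additive_on_inj_iff[OF additive_zlin subgrp_fsupp] intro: zlin_closed)

lemma subgroup_of_free_is_free:
  fixes H :: "('x \<Rightarrow>\<^sub>0 int) set"
  assumes H: "subgrp H"
  obtains S :: "'x set" and b where "zbasis S b H"
proof -
  obtain S h where h: "\<And>i. i \<in> S \<Longrightarrow> h i \<in> H \<and> h i \<in> below i \<and> Poly_Mapping.lookup (h i) i \<noteq> 0"
    and dvd: "\<And>z i. z \<in> H \<Longrightarrow> z \<in> below i \<Longrightarrow> Poly_Mapping.lookup z i \<noteq> 0 \<Longrightarrow>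
        i \<in> S \<and> Poly_Mapping.lookup (h i) i dvd Poly_Mapping.lookup z i"
    using leading_terms[OF H] by metis
  have "zbasis S h H"
  proof (rule zbasisI)
    fix z assume z: "z \<in> fsupp S" "zlin h z = 0"
    show "z = 0"
    proof (rule ccontr)
      assume "z \<noteq> 0"
      then obtain i where i: "z \<in> below i" "Poly_Mapping.lookup z i \<noteq> 0"
        by (rule leading_index)
      let ?T = "{j \<in> S. (j, i) \<in> index_order}"
      have iS: "i \<in> S" using i z by (auto simp: fsupp_iff)
      \<comment> \<open>the coefficient at \<open>i\<close> comes from \<open>h i\<close> alone\<close>
      have "zlin (\<lambda>j. Poly_Mapping.lookup (h j) i) z
          = zlin (\<lambda>j. if j = i then Poly_Mapping.lookup (h i) i else 0) z"
      proof (rule additive_on_fsupp_eqI[of z ?T])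
        show "z \<in> fsupp ?T" using z i by (auto simp: below_def fsupp_def)
        fix j assume "j \<in> ?T"
        then show "zlin (\<lambda>j. Poly_Mapping.lookup (h j) i) (frag_of j)
          = zlin (\<lambda>j. if j = i then Poly_Mapping.lookup (h i) i else 0) (frag_of j)"
          using h[of j] index_order_antisym[of i j] by (auto simp: below_def fsupp_iff)
      qed (rule additive_zlin)+
      also have "\<dots> = Poly_Mapping.lookup z i * Poly_Mapping.lookup (h i) i"
        using i by (simp add: zlin_def sum.delta in_keys_iff if_distrib cong: if_cong)
      also have "\<dots> \<noteq> 0" using i h[OF iS] by simp
      finally show False
        using z(2) additive_on_fsupp_eqI[of z S "\<lambda>z. Poly_Mapping.lookup (zlin h z) i"
            "zlin (\<lambda>j. Poly_Mapping.lookup (h j) i)"] z(1)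
        by (simp add: additive_zlin additive_on_def zlin_add lookup_add)
    qed
  next
    fix z assume "z \<in> H" then show "z \<in> zlin h ` fsupp S"
    proof (induction z rule: leading_index_induct)
      case 1 then show ?case using subgrp_zero[OF subgrp_fsupp, of S] zlin_0 by (metis image_eqI)
    next
      case (2 i z)
      let ?a = "Poly_Mapping.lookup (h i) i" and ?c = "Poly_Mapping.lookup z i"
      have i: "i \<in> S" "?a dvd ?c" using dvd[OF 2(4,1,2)] by auto
      let ?y = "z - (?c div ?a) *\<^sub>z h i"
      have "?y \<in> H" "?y \<in> below i"
        using 2(1,4) h[OF i(1)] H by (simp_all add: subgrp_diff_zmul subgrp_below)
      moreover have "Poly_Mapping.lookup ?y i = 0" using i by (simp add: lookup_minus)
      ultimately obtain u where u: "u \<in> fsupp S" "?y = zlin h u" using 2(3) by blast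
      have "z = zlin h (u + (?c div ?a) *\<^sub>z frag_of i)"
        by (simp add: zlin_add additive_on_zmul[OF additive_zlin[of UNIV h] subgrp_UNIV] flip: u(2))
      moreover have "u + (?c div ?a) *\<^sub>z frag_of i \<in> fsupp S"
        using u i by (simp add: subgrp_add_zmul subgrp_fsupp)
      ultimately show ?case by blast
    qed
  qed (use h H in auto)
  then show thesis by (rule that)
qed

text \<open>An abelian group that embeds into a free abelian group is free.\<close>

lemma embedded_in_free_is_free:
  fixes \<iota> :: "'a::ab_group_add \<Rightarrow> ('x \<Rightarrow>\<^sub>0 int)"
  assumes H: "subgrp H" and \<iota>: "additive_on H \<iota>" "inj_on \<iota> H"
  obtains S :: "'x set" and b where "zbasis S b H"
proof -
  obtain S :: "'x set" and b where b: "zbasis S b (\<iota> ` H)"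
    using subgroup_of_free_is_free[OF subgrp_image[OF \<iota>(1) H]] by metis
  have bij: "bij_betw \<iota> H (\<iota> ` H)" using \<iota>(2) by (simp add: bij_betw_def)
  define b' where "b' x = inv_into H \<iota> (b x)" for x
  have inH: "zlin b z \<in> \<iota> ` H" if "z \<in> fsupp S" for z
    using b that by (auto simp: zbasis_def bij_betw_def)
  have eq: "zlin b' z = inv_into H \<iota> (zlin b z)" if "z \<in> fsupp S" for z
  proof (rule additive_on_fsupp_eqI[OF that])
    show "additive_on (fsupp S) (\<lambda>z. inv_into H \<iota> (zlin b z))"
      by (rule additive_on_comp[OF additive_on_inv_into[OF bij \<iota>(1) H] additive_zlin inH])
  qed (auto simp: b'_def additive_zlin)
  have "bij_betw (inv_into H \<iota> \<circ> zlin b) (fsupp S) H"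
    using b bij by (auto simp: zbasis_def intro: bij_betw_trans bij_betw_inv_into)
  then have "zbasis S b' H"
    unfolding zbasis_def using eq by (subst bij_betw_cong[where g = "inv_into H \<iota> \<circ> zlin b"]) auto
  then show thesis by (rule that)
qed

text \<open>
  If \<open>p F \<subseteq> H \<subseteq> F\<close> with \<open>F\<close> free on \<open>S\<close>, then \<open>F/H\<close> is a vector space over the field with \<open>p\<close>
  elements, and some subset \<open>V\<close> of the basis maps to a basis of it: take for \<open>V\<close> the indices at which
  no element of \<open>H\<close> has leading coefficient prime to \<open>p\<close>.
\<close>

lemma basis_mod_subgroup:
  assumes p: "Factorial_Ring.prime (p::nat)" and H: "subgrp H"
    and pH: "\<And>z. z \<in> fsupp S \<Longrightarrow> int p *\<^sub>z z \<in> H" and HS: "H \<subseteq> fsupp S"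
  obtains V where "V \<subseteq> S"
    "\<And>z. z \<in> fsupp S \<Longrightarrow> \<exists>v\<in>fsupp V. z - v \<in> H"
    "\<And>v. v \<in> fsupp V \<Longrightarrow> v \<in> H \<Longrightarrow> \<exists>u\<in>fsupp V. v = int p *\<^sub>z u"
proof -
  obtain I h where h: "\<And>i. i \<in> I \<Longrightarrow> h i \<in> H \<and> h i \<in> below i \<and> Poly_Mapping.lookup (h i) i \<noteq> 0"
    and dvd: "\<And>z i. z \<in> H \<Longrightarrow> z \<in> below i \<Longrightarrow> Poly_Mapping.lookup z i \<noteq> 0 \<Longrightarrow>
        i \<in> I \<and> Poly_Mapping.lookup (h i) i dvd Poly_Mapping.lookup z i"
    using leading_terms[OF H] by metis
  have p0: "p \<noteq> 0" using p by auto
  have below: "frag_of i \<in> below i" for i by (auto simp: below_def index_order_refl)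
  have IS: "i \<in> I \<and> Poly_Mapping.lookup (h i) i dvd int p" if "i \<in> S" for i
    using dvd[of "int p *\<^sub>z frag_of i" i] pH[of "frag_of i"] that
      zmul_closed[OF subgrp_below below, of "int p" i] p0 by auto
  define V where "V = {i \<in> S. int p dvd Poly_Mapping.lookup (h i) i}"
  show thesis
  proof (rule that[of V])
    show "V \<subseteq> S" by (auto simp: V_def)
  next
    fix z assume "z \<in> fsupp S" then show "\<exists>v\<in>fsupp V. z - v \<in> H"
    proof (induction z rule: leading_index_induct)
      case 1 show ?case using subgrp_zero[OF H] subgrp_zero[OF subgrp_fsupp, of V]
        by (intro bexI[of _ 0]) simp_all
    next
      case (2 i z)
      let ?a = "Poly_Mapping.lookup (h i) i" and ?c = "Poly_Mapping.lookup z i"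
      have i: "i \<in> S" using 2 by (auto simp: fsupp_iff)
      show ?case
      proof (cases "i \<in> V")
        case True
        let ?y = "z - ?c *\<^sub>z frag_of i"
        have "?y \<in> below i" "?y \<in> fsupp S" "Poly_Mapping.lookup ?y i = 0"
          using 2(1,4) below[of i] i
          by (simp_all add: subgrp_diff_zmul subgrp_below subgrp_fsupp lookup_minus)
        then obtain v where v: "v \<in> fsupp V" "?y - v \<in> H" using 2(3) by blast
        then show ?thesis using True
          by (intro bexI[of _ "v + ?c *\<^sub>z frag_of i"])
             (simp_all add: algebra_simps subgrp_add_zmul subgrp_fsupp)
      next
        case False
        \<comment> \<open>the leading coefficient divides the prime \<open>p\<close> and is not divisible by it\<close>
        have "?a dvd int p" "\<not> int p dvd ?a" using IS[OF i] False i by (auto simp: V_def)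
        then have "is_unit ?a"
          using p by (metis irreducible_altdef prime_elem_imp_irreducible prime_imp_prime_elem prime_nat_int_transfer)
        then have "?a dvd ?c" by (rule unit_imp_dvd)
        let ?y = "z - (?c div ?a) *\<^sub>z h i"
        have hi: "h i \<in> H" "h i \<in> below i" "h i \<in> fsupp S" using h IS[OF i] HS by auto
        then have "?y \<in> below i" "?y \<in> fsupp S" "Poly_Mapping.lookup ?y i = 0"
          using 2(1,4) \<open>?a dvd ?c\<close>
          by (simp_all add: subgrp_diff_zmul subgrp_below subgrp_fsupp lookup_minus)
        then obtain v where v: "v \<in> fsupp V" "?y - v \<in> H" using 2(3) by blast
        have "z - v = (?y - v) + (?c div ?a) *\<^sub>z h i" by simp
        then have "z - v \<in> H" using v(2) hi(1) H by (metis subgrp_add zmul_closed)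
        then show ?thesis using v(1) by blast
      qed
    qed
  next
    fix v assume "v \<in> fsupp V" "v \<in> H" then show "\<exists>u\<in>fsupp V. v = int p *\<^sub>z u"
    proof (induction v rule: leading_index_induct)
      case 1 show ?case using subgrp_zero[OF subgrp_fsupp, of V]
        by (intro bexI[of _ 0]) simp_all
    next
      case (2 i v)
      let ?a = "Poly_Mapping.lookup (h i) i" and ?c = "Poly_Mapping.lookup v i"
      have i: "i \<in> V" "i \<in> S" using 2 by (auto simp: fsupp_iff V_def)
      have "int p dvd ?c" using dvd[OF 2(5,1,2)] i by (auto simp: V_def)
      then obtain k where k: "?c = int p * k" by blast
      let ?y = "v - ?c *\<^sub>z frag_of i"
      have "?c *\<^sub>z frag_of i = int p *\<^sub>z (k *\<^sub>z frag_of i)" by (simp add: zmul_zmul k)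
      moreover have "k *\<^sub>z frag_of i \<in> fsupp S" using i by (auto intro!: zmul_closed subgrp_fsupp)
      ultimately have "?c *\<^sub>z frag_of i \<in> H" using pH by simp
      then have "?y \<in> H" using 2(5) H by (simp add: subgrp_diff)
      moreover have "?y \<in> below i" "?y \<in> fsupp V" "Poly_Mapping.lookup ?y i = 0"
        using 2(1,4) below[of i] i
        by (simp_all add: subgrp_diff_zmul subgrp_below subgrp_fsupp lookup_minus)
      ultimately obtain u where u: "u \<in> fsupp V" "?y = int p *\<^sub>z u" using 2(3) by blast
      have "v = int p *\<^sub>z (u + k *\<^sub>z frag_of i)"
        using u(2) by (simp add: zmul_add_right zmul_zmul k algebra_simps)
      moreover have "u + k *\<^sub>z frag_of i \<in> fsupp V"
        using u i by (simp add: subgrp_add_zmul subgrp_fsupp)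
      ultimately show ?case by blast
    qed
  qed
qed

section \<open>Norms and traces of operators of order dividing \<open>p\<close>\<close>

lemma zbasis_torsion_free:
  assumes "zbasis S b H" "x \<in> H" "n *\<^sub>z x = 0" "n \<noteq> 0"
  shows "x = 0"
proof -
  obtain z where z: "z \<in> fsupp S" "x = zlin b z"
    using assms(1,2) by (auto simp: zbasis_def bij_betw_def)
  have "zlin b (n *\<^sub>z z) = 0"
    using assms(3) z by (simp add: additive_on_zmul[OF additive_zlin[of UNIV] subgrp_UNIV])
  moreover have "n *\<^sub>z z \<in> fsupp S" using z by (simp add: zmul_closed subgrp_fsupp)
  ultimately have "n *\<^sub>z z = 0"
    using assms(1) by (auto simp: zbasis_def bij_betw_def additive_on_inj_iff[OF additive_zlin subgrp_fsupp])
  then have "Poly_Mapping.lookup (n *\<^sub>z z) i = 0" for i by simp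
  then have "z = 0" using assms(4) by (intro poly_mapping_eqI) simp
  then show ?thesis using z by simp
qed

lemma zbasis_mem: "zbasis S b H \<Longrightarrow> x \<in> S \<Longrightarrow> b x \<in> H"
  unfolding zbasis_def bij_betw_def
  by (metis frag_of_fsupp image_eqI zlin_frag_of)

lemma zbasis_subgrp: "zbasis S b H \<Longrightarrow> subgrp H"
  using subgrp_image[OF additive_zlin subgrp_fsupp, of b S] by (simp add: zbasis_def bij_betw_def)

text \<open>Additive maps out of a free abelian group may be prescribed on a basis.\<close>

lemma zbasis_extend:
  fixes c :: "'x \<Rightarrow> 'c::ab_group_add"
  assumes b: "zbasis S b H" and K: "subgrp K" "\<And>x. x \<in> S \<Longrightarrow> c x \<in> K"
  obtains f where "additive_on H f" "\<And>x. x \<in> S \<Longrightarrow> f (b x) = c x" "\<And>x. x \<in> H \<Longrightarrow> f x \<in> K"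
proof (rule that[of "\<lambda>x. zlin c (inv_into (fsupp S) (zlin b) x)"])
  have bij: "bij_betw (zlin b) (fsupp S) H" using b by (simp add: zbasis_def)
  have mem: "inv_into (fsupp S) (zlin b) x \<in> fsupp S" if "x \<in> H" for x
    using bij that by (metis bij_betw_def inv_into_into)
  show "additive_on H (\<lambda>x. zlin c (inv_into (fsupp S) (zlin b) x))"
    by (rule additive_on_comp[OF additive_zlin additive_on_inv_into[OF bij additive_zlin subgrp_fsupp] mem])
  show "zlin c (inv_into (fsupp S) (zlin b) (b x)) = c x" if "x \<in> S" for x
    using inv_into_f_f[OF bij_betw_imp_inj_on[OF bij], of "frag_of x"] that by simp
  show "zlin c (inv_into (fsupp S) (zlin b) x) \<in> K" if "x \<in> H" for x
    using zlin_closed[OF K mem[OF that]] .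
qed

lemma zbasis_eqI:
  assumes "zbasis S b H" "additive_on H f" "additive_on H g" "\<And>x. x \<in> S \<Longrightarrow> f (b x) = g (b x)" "x \<in> H"
  shows "f x = g x"
proof -
  have img: "zlin b z \<in> H" if "z \<in> fsupp S" for z
    using assms(1) that by (auto simp: zbasis_def bij_betw_def)
  obtain z where z: "z \<in> fsupp S" "x = zlin b z"
    using assms(1,5) by (auto simp: zbasis_def bij_betw_def)
  have "f (zlin b z) = g (zlin b z)"
    by (rule additive_on_fsupp_eqI[OF z(1) additive_on_comp[OF assms(2) additive_zlin img]
          additive_on_comp[OF assms(3) additive_zlin img]]) (use assms(4) in auto)
  then show ?thesis using z by simp
qed

text \<open>
  A module over the group ring of a cyclic group of order \<open>p\<close>: an abelian group \<open>H\<close> together with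
  the additive operator \<open>A\<close> by which a generator acts.  Nothing is assumed of \<open>A\<close> outside \<open>H\<close>.
\<close>

locale cyc_module =
  fixes p :: nat and A :: "'a::ab_group_add \<Rightarrow> 'a" and H :: "'a set"
  assumes p_pos: "0 < p" and subgrp: "subgrp H" and add: "additive_on H A"
    and closed: "\<And>x. x \<in> H \<Longrightarrow> A x \<in> H" and order: "\<And>x. x \<in> H \<Longrightarrow> (A ^^ p) x = x"

text \<open>The norm map, the action of the sum of all group elements.\<close>

definition Nm :: "nat \<Rightarrow> ('a \<Rightarrow> 'a) \<Rightarrow> 'a \<Rightarrow> 'a::ab_group_add" where
  "Nm p A x = (\<Sum>i<p. (A ^^ i) x)"

text \<open>
  The trace of an additive map from a module with operator \<open>B\<close> to one with operator \<open>A\<close>, that is the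
  sum of its conjugates; \<open>B ^^ (p - i)\<close> acts as the inverse of \<open>B ^^ i\<close>.
\<close>

definition Tr :: "nat \<Rightarrow> ('a \<Rightarrow> 'a) \<Rightarrow> ('b \<Rightarrow> 'b) \<Rightarrow> ('b \<Rightarrow> 'a) \<Rightarrow> 'b \<Rightarrow> 'a::ab_group_add" where
  "Tr p A B \<phi> x = (\<Sum>i<p. (A ^^ i) (\<phi> ((B ^^ (p - i)) x)))"

text \<open>Module homomorphisms on \<open>K\<close>, from the operator \<open>B\<close> to the operator \<open>A\<close>; additivity is stated separately.\<close>

definition equivariant_on :: "'b set \<Rightarrow> ('a \<Rightarrow> 'a) \<Rightarrow> ('b \<Rightarrow> 'b) \<Rightarrow> ('b \<Rightarrow> 'a) \<Rightarrow> bool" where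
  "equivariant_on K A B f \<longleftrightarrow> (\<forall>x\<in>K. f (B x) = A (f x))"

lemma equivariant_onD: "equivariant_on K A B f \<Longrightarrow> x \<in> K \<Longrightarrow> f (B x) = A (f x)"
  by (simp add: equivariant_on_def)

context cyc_module
begin

lemma pow_closed: "x \<in> H \<Longrightarrow> (A ^^ i) x \<in> H"
  by (induction i) (auto simp: closed)

lemma pow_add: "additive_on H (A ^^ i)"
  by (induction i) (auto simp: additive_on_def additive_on_add[OF add] pow_closed)

lemma pow_mod: "x \<in> H \<Longrightarrow> (A ^^ (i mod p)) x = (A ^^ i) x"
proof (induction i rule: less_induct)
  case (less i)
  show ?case
  proof (cases "i < p")
    case False
    then have "i = p + (i - p)" by simp
    then have "(A ^^ i) x = (A ^^ p) ((A ^^ (i - p)) x)" by (metis comp_apply funpow_add)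
    also have "\<dots> = (A ^^ (i - p)) x" by (simp add: order pow_closed less)
    also have "\<dots> = (A ^^ ((i - p) mod p)) x" using less False p_pos by simp
    finally show ?thesis using False by (simp add: le_mod_geq)
  qed simp
qed

lemma pow_inverse: "x \<in> H \<Longrightarrow> i \<le> p \<Longrightarrow> (A ^^ i) ((A ^^ (p - i)) x) = x"
  using order[of x] by (metis comp_apply funpow_add le_add_diff_inverse)

lemma pow_fixed: "A x = x \<Longrightarrow> (A ^^ i) x = x"
  by (induction i) auto

lemma Nm_closed: "x \<in> H \<Longrightarrow> Nm p A x \<in> H"
  unfolding Nm_def by (intro subgrp_sum subgrp pow_closed)

lemma Nm_add: "additive_on H (Nm p A)"
  unfolding Nm_def by (intro additive_on_SUM pow_add)

lemma Nm_fixed: "A x = x \<Longrightarrow> Nm p A x = int p *\<^sub>z x"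
  by (simp add: Nm_def pow_fixed sum_const_zmul)

text \<open>Reindexing of sums over the cyclic group.\<close>

lemma sum_rotate:
  assumes "\<And>i. i \<le> p \<Longrightarrow> f i \<in> H" "f p = f 0"
  shows "(\<Sum>i<p. f (Suc i)) = (\<Sum>i<p. f i)"
proof -
  have "f 0 + (\<Sum>i<p. f (Suc i)) = (\<Sum>i<p. f i) + f p"
    using sum.lessThan_Suc_shift[of f p] by simp
  then show ?thesis using assms(2) by simp
qed

lemma A_Nm: "x \<in> H \<Longrightarrow> A (Nm p A x) = Nm p A x"
  using sum_rotate[of "\<lambda>i. (A ^^ i) x"] unfolding Nm_def
  by (subst additive_on_sum[OF add subgrp]) (auto simp: pow_closed order)

lemma Nm_A: "x \<in> H \<Longrightarrow> Nm p A (A x) = Nm p A x"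
  using A_Nm[of x] unfolding Nm_def
  by (simp add: additive_on_sum[OF add subgrp] pow_closed funpow_swap1)

lemma Nm_inverse:
  assumes "x \<in> H" shows "Nm p A x = (\<Sum>i<p. (A ^^ (p - i)) x)"
proof -
  have "Nm p A x = (\<Sum>i<p. (A ^^ Suc i) x)"
    unfolding Nm_def using assms
    by (intro sum_rotate[of "\<lambda>i. (A ^^ i) x", symmetric]) (simp_all only: pow_closed order funpow.simps id_apply)
  also have "\<dots> = (\<Sum>i<p. (A ^^ Suc (p - Suc i)) x)"
    by (rule sum.nat_diff_reindex[symmetric])
  also have "\<dots> = (\<Sum>i<p. (A ^^ (p - i)) x)"
    by (intro sum.cong refl) (simp only: Suc_diff_Suc lessThan_iff)
  finally show ?thesis .
qed

lemma Nm_boundary: "x \<in> H \<Longrightarrow> Nm p A (A x - x) = 0"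
  by (simp add: additive_on_diff[OF Nm_add subgrp] closed Nm_A)

lemma boundary_add: "additive_on H (\<lambda>x. A x - x)"
  by (intro additive_on_plus add) (simp add: additive_on_def)

lemma subgrp_boundaries: "subgrp ((\<lambda>x. A x - x) ` H)"
  by (rule subgrp_image[OF boundary_add subgrp])

lemma pow_boundary: "x \<in> H \<Longrightarrow> (A ^^ i) x - x \<in> (\<lambda>x. A x - x) ` H"
proof (induction i)
  case 0 then show ?case using subgrp_zero[OF subgrp_boundaries] by simp
next
  case (Suc i)
  have "(A ^^ Suc i) x - x = (A ((A ^^ i) x) - (A ^^ i) x) + ((A ^^ i) x - x)" by simp
  also have "\<dots> \<in> (\<lambda>x. A x - x) ` H"
    using Suc by (intro subgrp_add[OF subgrp_boundaries]) (auto simp: pow_closed)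
  finally show ?case .
qed

lemma cyc_module_subset:
  "K \<subseteq> H \<Longrightarrow> subgrp K \<Longrightarrow> (\<And>x. x \<in> K \<Longrightarrow> A x \<in> K) \<Longrightarrow> cyc_module p A K"
  by (unfold_locales) (use p_pos order add in \<open>auto intro: additive_on_subset\<close>)

end

locale cyc_module_pair = cyc_module p A H + K: cyc_module p B K
  for p and A :: "'a::ab_group_add \<Rightarrow> 'a" and H and B :: "'b::ab_group_add \<Rightarrow> 'b" and K
begin

context
  fixes \<phi> :: "'b \<Rightarrow> 'a"
  assumes \<phi>: "additive_on K \<phi>" "\<And>x. x \<in> K \<Longrightarrow> \<phi> x \<in> H"
begin

lemma Tr_closed: "x \<in> K \<Longrightarrow> Tr p A B \<phi> x \<in> H"
  unfolding Tr_def by (intro subgrp_sum subgrp pow_closed \<phi>(2) K.pow_closed)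

lemma Tr_add: "additive_on K (Tr p A B \<phi>)"
  unfolding Tr_def
  by (intro additive_on_SUM additive_on_comp[OF pow_add] additive_on_comp[OF \<phi>(1)] K.pow_add
        \<phi>(2) K.pow_closed)

text \<open>Averaging: the trace of an additive map is equivariant.\<close>

lemma Tr_equivariant: "equivariant_on K A B (Tr p A B \<phi>)"
  unfolding equivariant_on_def
proof
  fix x assume x: "x \<in> K"
  let ?f = "\<lambda>i. (A ^^ i) (\<phi> ((B ^^ (Suc p - i)) x))"
  have mem: "?f i \<in> H" for i using x by (simp add: pow_closed \<phi> K.pow_closed)
  have "A (Tr p A B \<phi> x) = (\<Sum>i<p. ?f (Suc i))"
    unfolding Tr_def using x
    by (subst additive_on_sum[OF add subgrp]) (auto simp: pow_closed \<phi> K.pow_closed)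
  also have "\<dots> = (\<Sum>i<p. ?f i)"
    by (rule sum_rotate[OF mem]) (use x in \<open>simp add: order \<phi> K.closed K.order\<close>)
  also have "\<dots> = Tr p A B \<phi> (B x)"
    unfolding Tr_def
    by (intro sum.cong refl) (auto simp: Suc_diff_le funpow_swap1)
  finally show "Tr p A B \<phi> (B x) = A (Tr p A B \<phi> x)" by simp
qed

end

lemma equivariant_pow:
  assumes "equivariant_on K A B f" "x \<in> K"
  shows "f ((B ^^ i) x) = (A ^^ i) (f x)"
  using assms by (induction i) (auto simp: equivariant_onD K.pow_closed)

lemma equivariant_Nm:
  assumes "equivariant_on K A B f" "additive_on K f" "x \<in> K"
  shows "f (Nm p B x) = Nm p A (f x)"
  unfolding Nm_def
  by (subst additive_on_sum[OF assms(2) K.subgrp])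
     (use assms in \<open>auto simp: K.pow_closed equivariant_pow\<close>)

text \<open>Equivariant maps may be moved into the trace.\<close>

lemma Tr_equivariant_left:
  assumes "equivariant_on K A B f" "additive_on K f" "\<And>i. \<phi> ((C ^^ i) x) \<in> K"
  shows "f (Tr p B C \<phi> x) = Tr p A C (\<lambda>x. f (\<phi> x)) x"
  unfolding Tr_def
  by (subst additive_on_sum[OF assms(2) K.subgrp])
     (use assms in \<open>auto simp: K.pow_closed equivariant_pow\<close>)

end

context cyc_module
begin

lemma self_pair: "cyc_module_pair p A H A H"
  by (intro cyc_module_pair.intro cyc_module_axioms)

lemma Tr_cong: "(\<And>x. x \<in> H \<Longrightarrow> f x = g x) \<Longrightarrow> x \<in> H \<Longrightarrow> Tr p B A f x = Tr p B A g x"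
  unfolding Tr_def by (simp add: pow_closed)

lemma boundary_pow_closed: "x \<in> H \<Longrightarrow> ((\<lambda>x. A x - x) ^^ k) x \<in> H"
  by (induction k) (auto simp: closed subgrp_diff[OF subgrp])

lemma boundary_pow_add: "additive_on H ((\<lambda>x. A x - x) ^^ k)"
  by (induction k) (auto simp: additive_on_def additive_on_add[OF boundary_add] boundary_pow_closed
      additive_on_add[OF add] algebra_simps)

text \<open>The binomial theorem for \<open>A = 1 + (A - 1)\<close>.\<close>

lemma binomial_expansion:
  "x \<in> H \<Longrightarrow> (A ^^ n) x = (\<Sum>k\<le>n. int (n choose k) *\<^sub>z ((\<lambda>x. A x - x) ^^ k) x)"
proof (induction n)
  case (Suc n)
  let ?a = "\<lambda>k. ((\<lambda>x. A x - x) ^^ k) x"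
  have a: "?a k \<in> H" for k using boundary_pow_closed[OF Suc.prems] .
  have A_a: "A (?a k) = ?a k + ?a (Suc k)" for k by simp
  have "(A ^^ Suc n) x = (\<Sum>k\<le>n. int (n choose k) *\<^sub>z A (?a k))"
    using Suc by (simp add: additive_on_sum[OF add subgrp] zmul_closed[OF subgrp] a
        additive_on_zmul[OF add subgrp])
  also have "\<dots> = (\<Sum>k\<le>n. int (n choose k) *\<^sub>z ?a k) + (\<Sum>k\<le>n. int (n choose k) *\<^sub>z ?a (Suc k))"
    unfolding A_a zmul_add_right sum.distrib ..
  also have "(\<Sum>k\<le>n. int (n choose k) *\<^sub>z ?a k) = (\<Sum>k\<le>Suc n. int (n choose k) *\<^sub>z ?a k)"
    by (simp add: binomial_eq_0)
  also have "\<dots> = ?a 0 + (\<Sum>k\<le>n. int (n choose Suc k) *\<^sub>z ?a (Suc k))"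
    by (subst sum.atMost_Suc_shift) simp
  also have "?a 0 + (\<Sum>k\<le>n. int (n choose Suc k) *\<^sub>z ?a (Suc k)) + (\<Sum>k\<le>n. int (n choose k) *\<^sub>z ?a (Suc k))
      = ?a 0 + (\<Sum>k\<le>n. int (Suc n choose Suc k) *\<^sub>z ?a (Suc k))"
    by (simp add: zmul_add_left sum.distrib del: funpow.simps)
  also have "\<dots> = (\<Sum>k\<le>Suc n. int (Suc n choose k) *\<^sub>z ?a k)"
    by (subst sum.atMost_Suc_shift[where n = n]) simp
  finally show ?case .
qed simp

text \<open>For prime \<open>p\<close> the operator \<open>A - 1\<close> is nilpotent modulo \<open>p\<close>.\<close>

lemma boundary_pow_p:
  assumes p: "Factorial_Ring.prime p" and x: "x \<in> H"
  shows "((\<lambda>x. A x - x) ^^ p) x \<in> (\<lambda>x. int p *\<^sub>z x) ` H"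
proof -
  let ?a = "\<lambda>k. ((\<lambda>x. A x - x) ^^ k) x" and ?pH = "(\<lambda>x. int p *\<^sub>z x) ` H"
  have pH: "subgrp ?pH" by (rule subgrp_image[OF additive_zmul subgrp])
  have "int (p choose k) *\<^sub>z ?a k \<in> ?pH" if k: "k \<in> {0<..<p}" for k
  proof -
    obtain m where "p choose k = p * m"
      using dvd_choose_prime[of k p] k p by (auto elim!: dvdE)
    then have "int (p choose k) *\<^sub>z ?a k = int p *\<^sub>z (int m *\<^sub>z ?a k)" by (simp add: zmul_zmul)
    then show ?thesis using boundary_pow_closed[OF x] zmul_closed[OF subgrp] by blast
  qed
  then have sum: "(\<Sum>k\<in>{0<..<p}. int (p choose k) *\<^sub>z ?a k) \<in> ?pH"
    by (intro subgrp_sum pH)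
  have "{..p} = insert 0 (insert p {0<..<p})" using p_pos by auto
  then have "x = ?a 0 + (?a p + (\<Sum>k\<in>{0<..<p}. int (p choose k) *\<^sub>z ?a k))"
    using binomial_expansion[OF x, of p] order[OF x] p_pos by simp
  then have "?a p = - (\<Sum>k\<in>{0<..<p}. int (p choose k) *\<^sub>z ?a k)"
    by (simp add: eq_neg_iff_add_eq_0)
  then show ?thesis using subgrp_minus[OF pH sum] by simp
qed

end

section \<open>Relative projectivity\<close>

text \<open>
  If \<open>H\<close> is free abelian and every invariant of \<open>H/pH\<close> is a norm, then \<open>H\<close> is projective relative to
  the trivial subgroup: the identity is the trace of an additive map.
\<close>

lemma (in cyc_module) identity_is_trace:
  assumes p: "Factorial_Ring.prime p" and basis: "zbasis S b H"
    and inv: "\<And>x z. x \<in> H \<Longrightarrow> z \<in> H \<Longrightarrow> A x - x = int p *\<^sub>z z \<Longrightarrow>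
        \<exists>y\<in>H. \<exists>z\<in>H. x - Nm p A y = int p *\<^sub>z z"
  obtains \<phi> where "additive_on H \<phi>" "\<And>x. x \<in> H \<Longrightarrow> \<phi> x \<in> H" "\<And>x. x \<in> H \<Longrightarrow> Tr p A A \<phi> x = x"
proof -
  interpret self: cyc_module_pair p A H A H by (rule self_pair)
  define pH where "pH = (\<lambda>x. int p *\<^sub>z x) ` H"
  have pH: "subgrp pH" unfolding pH_def by (rule subgrp_image[OF additive_zmul subgrp])
  have pHI: "int p *\<^sub>z x \<in> pH" if "x \<in> H" for x using that by (auto simp: pH_def)
  have pHH: "pH \<subseteq> H" unfolding pH_def using zmul_closed[OF subgrp] by auto
  have pH_map: "f x \<in> pH" if "additive_on H f" "\<And>x. x \<in> H \<Longrightarrow> f x \<in> H" "x \<in> pH" for f x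
    using that by (auto simp: pH_def additive_on_zmul[OF that(1) subgrp])
  let ?t = "\<lambda>x. A x - x"
  have t_pow: "additive_on H (?t ^^ k)" "\<And>x. x \<in> H \<Longrightarrow> (?t ^^ k) x \<in> H" for k
    by (fact boundary_pow_add, fact boundary_pow_closed)
  \<comment> \<open>\<open>W k\<close> is the preimage of the kernel of the \<open>k\<close>-th power of \<open>A - 1\<close> on \<open>H/pH\<close>; in particular
    \<open>W 0 = pH\<close>, the elements of \<open>W 1\<close> are the invariants modulo \<open>p\<close>, and \<open>W p = H\<close>.\<close>
  define W where "W k = {x \<in> H. (?t ^^ k) x \<in> pH}" for k
  have W: "subgrp (W k)" for k
    unfolding W_def by (rule subgrp_preimage[OF t_pow(1) subgrp pH])
  have WH: "W k \<subseteq> H" for k by (auto simp: W_def)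
  have pW: "pH \<subseteq> W 1" using pHH pH_map[OF t_pow, of _ 1] by (auto simp: W_def)

  \<comment> \<open>An additive map \<open>\<pi>\<close> from \<open>H\<close> to \<open>W 1\<close> that is the identity on \<open>W 1\<close> modulo \<open>p\<close>: on the
    basis, subtract a combination of those basis elements that form a basis of \<open>H / W 1\<close>.\<close>
  have bij: "bij_betw (zlin b) (fsupp S) H" using basis by (simp add: zbasis_def)
  have zlin_H: "zlin b z \<in> H" if "z \<in> fsupp S" for z using bij that by (auto simp: bij_betw_def)
  define L where "L = {z \<in> fsupp S. zlin b z \<in> W 1}"
  have "subgrp L" unfolding L_def by (rule subgrp_preimage[OF additive_zlin subgrp_fsupp W])
  moreover have "int p *\<^sub>z z \<in> L" if "z \<in> fsupp S" for z
    using that pHI[OF zlin_H[OF that]] pW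
    by (auto simp: L_def additive_on_zmul[OF additive_zlin subgrp_UNIV] intro: zmul_closed[OF subgrp_fsupp])
  ultimately obtain V where V: "V \<subseteq> S" "\<And>z. z \<in> fsupp S \<Longrightarrow> \<exists>v\<in>fsupp V. z - v \<in> L"
    "\<And>v. v \<in> fsupp V \<Longrightarrow> v \<in> L \<Longrightarrow> \<exists>u\<in>fsupp V. v = int p *\<^sub>z u"
    using basis_mod_subgroup[OF p, of L S] unfolding L_def by blast
  have "\<forall>i\<in>S. \<exists>v. v \<in> fsupp V \<and> frag_of i - v \<in> L" using V(2) by (meson frag_of_fsupp)
  then obtain v where v: "\<And>i. i \<in> S \<Longrightarrow> v i \<in> fsupp V \<and> frag_of i - v i \<in> L" by metis
  define w where "w i = b i - zlin b (v i)" for i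
  have w: "w i \<in> W 1" if "i \<in> S" for i
    using v[OF that] by (auto simp: w_def L_def zlin_diff)
  obtain \<pi> where \<pi>: "additive_on H \<pi>" "\<And>i. i \<in> S \<Longrightarrow> \<pi> (b i) = w i" "\<And>x. x \<in> H \<Longrightarrow> \<pi> x \<in> W 1"
    using zbasis_extend[where c = w, OF basis W w] by metis
  have \<pi>_W: "x - \<pi> x \<in> pH" if x: "x \<in> W 1" for x
  proof -
    have xH: "x \<in> H" using x WH by auto
    obtain z where z: "z \<in> fsupp S" "x = zlin b z" using bij xH by (auto simp: bij_betw_def)
    have zv: "zlin v z \<in> fsupp V" by (rule zlin_closed[OF subgrp_fsupp _ z(1)]) (use v in auto)
    have "x - \<pi> x = zlin b (zlin v z)" unfolding z(2)
    proof (rule additive_on_fsupp_eqI[OF z(1)])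
      show "additive_on (fsupp S) (\<lambda>z. zlin b z - \<pi> (zlin b z))"
        by (intro additive_on_plus additive_zlin additive_on_comp[OF \<pi>(1)] zlin_H)
      show "additive_on (fsupp S) (\<lambda>z. zlin b (zlin v z))"
        by (auto simp: additive_on_def zlin_add)
    qed (auto simp: \<pi>(2) w_def)
    moreover have "x - \<pi> x \<in> W 1" using x \<pi>(3)[OF xH] by (simp add: subgrp_diff[OF W])
    ultimately have "zlin v z \<in> L" using zv fsupp_mono[OF V(1)] by (auto simp: L_def)
    then obtain u where u: "u \<in> fsupp V" "zlin v z = int p *\<^sub>z u" using V(3)[OF zv] by blast
    then have "zlin b (zlin v z) = int p *\<^sub>z zlin b u"
      by (simp add: additive_on_zmul[OF additive_zlin subgrp_UNIV])
    then show ?thesis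
      using \<open>x - \<pi> x = _\<close> pHI[OF zlin_H] u(1) fsupp_mono[OF V(1)] by auto
  qed

  \<comment> \<open>Lift \<open>\<pi>\<close> along the norm.\<close>
  have "\<exists>y\<in>H. w i - Nm p A y \<in> pH" if i: "i \<in> S" for i
  proof -
    have "w i \<in> H" "?t (w i) \<in> pH" using w[OF i] by (auto simp: W_def)
    then show ?thesis using inv[of "w i"] unfolding pH_def by blast
  qed
  then obtain y where y: "\<And>i. i \<in> S \<Longrightarrow> y i \<in> H" "\<And>i. i \<in> S \<Longrightarrow> w i - Nm p A (y i) \<in> pH" by metis
  obtain \<phi> where \<phi>: "additive_on H \<phi>" "\<And>i. i \<in> S \<Longrightarrow> \<phi> (b i) = y i" "\<And>x. x \<in> H \<Longrightarrow> \<phi> x \<in> H"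
    using zbasis_extend[where c = y, OF basis subgrp y(1)] by metis
  have \<pi>_\<phi>: "\<pi> x - Nm p A (\<phi> x) \<in> pH" if x: "x \<in> H" for x
  proof -
    obtain z where z: "z \<in> fsupp S" "x = zlin b z" using bij x by (auto simp: bij_betw_def)
    show ?thesis unfolding z(2)
    proof (rule fsupp_additive_closed[OF pH _ _ z(1)])
      show "additive_on (fsupp S) (\<lambda>z. \<pi> (zlin b z) - Nm p A (\<phi> (zlin b z)))"
        by (intro additive_on_plus additive_on_comp[OF \<pi>(1)] additive_on_comp[OF Nm_add]
              additive_on_comp[OF \<phi>(1)] additive_zlin zlin_H \<phi>(3))
    qed (simp add: \<pi>(2) \<phi>(2) y)
  qed

  \<comment> \<open>The trace of \<open>\<phi>\<close> is the identity modulo \<open>p\<close> on \<open>W 1\<close>, so that \<open>\<nu>\<close> is nilpotent modulo \<open>p\<close>.\<close>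
  define \<nu> where "\<nu> x = x - Tr p A A \<phi> x" for x
  have Tr: "additive_on H (Tr p A A \<phi>)" "\<And>x. x \<in> H \<Longrightarrow> Tr p A A \<phi> x \<in> H"
    "equivariant_on H A A (Tr p A A \<phi>)"
    using self.Tr_add[OF \<phi>(1,3)] self.Tr_closed[OF \<phi>(1,3)] self.Tr_equivariant[OF \<phi>(1,3)] by auto
  have \<nu>: "additive_on H \<nu>" "\<And>x. x \<in> H \<Longrightarrow> \<nu> x \<in> H" "\<And>x. x \<in> H \<Longrightarrow> \<nu> (A x) = A (\<nu> x)"
    unfolding \<nu>_def
    by (intro additive_on_plus Tr) (auto simp: additive_on_def Tr closed subgrp_diff[OF subgrp]
        equivariant_onD[OF Tr(3)] additive_on_diff[OF add subgrp])
  have \<nu>_W1: "\<nu> x \<in> pH" if x: "x \<in> W 1" for x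
  proof -
    have xH: "x \<in> H" using x WH by auto
    have tx: "?t x \<in> pH" using x by (simp add: W_def)
    have pow: "(A ^^ i) x - x \<in> pH" for i
    proof (induction i)
      case (Suc i)
      have "?t ((A ^^ i) x) = (A ^^ i) (?t x)"
        using xH by (simp add: additive_on_diff[OF pow_add subgrp] closed funpow_swap1)
      also have "\<dots> \<in> pH" by (rule pH_map[OF pow_add pow_closed tx])
      finally show ?case using subgrp_add[OF pH _ Suc] by fastforce
    qed (simp add: subgrp_zero[OF pH])
    have "Tr p A A \<phi> x - Nm p A (\<phi> x) = (\<Sum>i<p. (A ^^ i) (\<phi> ((A ^^ (p - i)) x - x)))"
      unfolding Tr_def Nm_def using xH
      by (simp add: sum_subtractf additive_on_diff[OF pow_add subgrp] additive_on_diff[OF \<phi>(1) subgrp]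
          pow_closed \<phi>(3))
    also have "\<dots> \<in> pH"
      by (intro subgrp_sum[OF pH] pH_map[OF pow_add pow_closed] pH_map[OF \<phi>(1,3)] pow)
    finally have "Tr p A A \<phi> x - Nm p A (\<phi> x) \<in> pH" .
    moreover have "\<nu> x = (x - \<pi> x) + (\<pi> x - Nm p A (\<phi> x)) - (Tr p A A \<phi> x - Nm p A (\<phi> x))"
      by (simp add: \<nu>_def)
    ultimately show ?thesis
      using \<pi>_W[OF x] \<pi>_\<phi>[OF xH] by (metis subgrp_diff[OF pH] subgrp_add[OF pH])
  qed
  have \<nu>_t: "\<nu> ((?t ^^ k) x) = (?t ^^ k) (\<nu> x)" if "x \<in> H" for x k
    using that
    by (induction k) (auto simp: additive_on_diff[OF \<nu>(1) subgrp] closed boundary_pow_closed \<nu>(3))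
  have \<nu>_W: "\<nu> x \<in> W k" if "x \<in> W (Suc k)" for x k
  proof -
    have "x \<in> H" "(?t ^^ k) x \<in> W 1"
      using that boundary_pow_closed by (auto simp: W_def)
    then show ?thesis using \<nu>_W1[of "(?t ^^ k) x"] by (simp add: W_def \<nu>_t \<nu>)
  qed
  have "(\<nu> ^^ k) x \<in> W (p - k)" if "x \<in> H" "k \<le> p" for x k
    using that(2)
  proof (induction k)
    case 0 then show ?case
      using boundary_pow_p[OF p] that(1) by (auto simp: W_def pH_def)
  next
    case (Suc k)
    then show ?case using \<nu>_W[of "(\<nu> ^^ k) x" "p - Suc k"] by (simp add: Suc_diff_Suc)
  qed
  from this[of _ p] have \<nu>_p: "(\<nu> ^^ p) x \<in> pH" if "x \<in> H" for x using that by (simp add: W_def)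

  \<comment> \<open>Correct \<open>\<phi>\<close> by a geometric series in \<open>\<nu>\<close>, and the remainder, a multiple of \<open>p\<close>, by an
    equivariant map, whose trace is multiplication by \<open>p\<close>.\<close>
  have \<nu>_pow: "additive_on H (\<nu> ^^ k)" "\<And>x. x \<in> H \<Longrightarrow> (\<nu> ^^ k) x \<in> H"
    "\<And>x. x \<in> H \<Longrightarrow> (\<nu> ^^ k) (A x) = A ((\<nu> ^^ k) x)" for k
  proof -
    show c: "\<And>x. x \<in> H \<Longrightarrow> (\<nu> ^^ k) x \<in> H" for k by (induction k) (auto simp: \<nu>)
    show "additive_on H (\<nu> ^^ k)"
      by (induction k) (auto simp: additive_on_def additive_on_add[OF \<nu>(1)] c)
    show "\<And>x. x \<in> H \<Longrightarrow> (\<nu> ^^ k) (A x) = A ((\<nu> ^^ k) x)"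
      by (induction k) (auto simp: \<nu> c)
  qed
  define \<sigma> where "\<sigma> x = (\<Sum>i<p. (\<nu> ^^ i) x)" for x
  have \<sigma>: "additive_on H \<sigma>" "\<And>x. x \<in> H \<Longrightarrow> \<sigma> x \<in> H" "equivariant_on H A A \<sigma>"
    unfolding \<sigma>_def equivariant_on_def
    by (intro additive_on_SUM \<nu>_pow) (auto intro!: subgrp_sum[OF subgrp] \<nu>_pow
        simp: \<nu>_pow additive_on_sum[OF add subgrp])
  have "\<exists>z. z \<in> H \<and> (\<nu> ^^ p) x = int p *\<^sub>z z" if "x \<in> H" for x
    using \<nu>_p[OF that] by (auto simp: pH_def)
  then obtain \<psi> where \<psi>: "\<And>x. x \<in> H \<Longrightarrow> \<psi> x \<in> H" "\<And>x. x \<in> H \<Longrightarrow> (\<nu> ^^ p) x = int p *\<^sub>z \<psi> x"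
    by metis
  have cancel: "x = y" if "int p *\<^sub>z x = int p *\<^sub>z y" "x \<in> H" "y \<in> H" for x y
    using zbasis_torsion_free[OF basis subgrp_diff[OF subgrp that(2,3)], of "int p"] that p_pos
    by (simp add: zmul_diff_right)
  have \<psi>_add: "additive_on H \<psi>"
  proof (rule additive_onI)
    fix x y assume xy: "x \<in> H" "y \<in> H"
    then have "int p *\<^sub>z \<psi> (x + y) = int p *\<^sub>z (\<psi> x + \<psi> y)"
      by (simp add: zmul_add_right \<psi>(2)[symmetric] subgrp_add[OF subgrp] additive_on_add[OF \<nu>_pow(1)])
    then show "\<psi> (x + y) = \<psi> x + \<psi> y" by (rule cancel) (use xy in \<open>simp_all add: \<psi> subgrp_add[OF subgrp]\<close>)
  qed
  have \<psi>_equiv: "equivariant_on H A A \<psi>" unfolding equivariant_on_def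
  proof
    fix x assume x: "x \<in> H"
    then have "int p *\<^sub>z \<psi> (A x) = int p *\<^sub>z A (\<psi> x)"
      by (simp add: \<psi>(1) \<psi>(2)[symmetric] closed \<nu>_pow(3) additive_on_zmul[OF add subgrp, symmetric])
    then show "\<psi> (A x) = A (\<psi> x)" by (rule cancel) (use x in \<open>simp_all add: \<psi> closed\<close>)
  qed
  show thesis
  proof (rule that[of "\<lambda>x. \<phi> (\<sigma> x) + \<psi> x"])
    show "additive_on H (\<lambda>x. \<phi> (\<sigma> x) + \<psi> x)"
      by (intro additive_on_plus additive_on_comp[OF \<phi>(1)] \<sigma> \<psi>_add)
    show "\<phi> (\<sigma> x) + \<psi> x \<in> H" if "x \<in> H" for x
      using that by (intro subgrp_add[OF subgrp] \<phi> \<sigma> \<psi>)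
    fix x assume x: "x \<in> H"
    have "Tr p A A (\<lambda>x. \<phi> (\<sigma> x) + \<psi> x) x
        = (\<Sum>i<p. (A ^^ i) (\<phi> ((A ^^ (p - i)) (\<sigma> x))) + (A ^^ i) ((A ^^ (p - i)) (\<psi> x)))"
      unfolding Tr_def using x
      by (intro sum.cong refl)
         (simp add: additive_on_add[OF pow_add] pow_closed \<phi> \<sigma> \<psi> self.equivariant_pow[OF \<sigma>(3)]
           self.equivariant_pow[OF \<psi>_equiv])
    also have "\<dots> = Tr p A A \<phi> (\<sigma> x) + int p *\<^sub>z \<psi> x"
      unfolding Tr_def using x by (simp add: sum.distrib pow_inverse \<psi>(1) sum_const_zmul)
    also have "Tr p A A \<phi> (\<sigma> x) = \<sigma> x - \<nu> (\<sigma> x)" by (simp add: \<nu>_def)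
    also have "\<nu> (\<sigma> x) = (\<Sum>i<p. (\<nu> ^^ Suc i) x)"
      unfolding \<sigma>_def using x by (simp add: additive_on_sum[OF \<nu>(1) subgrp] \<nu>_pow)
    also have "\<sigma> x - (\<Sum>i<p. (\<nu> ^^ Suc i) x) = x - (\<nu> ^^ p) x"
      unfolding \<sigma>_def sum_subtractf[symmetric]
      using sum_lessThan_telescope'[of "\<lambda>i. (\<nu> ^^ i) x" p] by simp
    finally show "Tr p A A (\<lambda>x. \<phi> (\<sigma> x) + \<psi> x) x = x" by (simp add: \<psi>(2)[OF x])
  qed
qed

section \<open>Permutation modules\<close>

text \<open>
  The direct sum of a free module on \<open>J\<close> and a trivial module that is free abelian on \<open>V\<close>.  The basis
  element \<open>Inl (j, i)\<close> with \<open>i < p\<close> is the \<open>i\<close>-th translate of the \<open>j\<close>-th generator, and the basis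
  element \<open>Inr v\<close> is fixed; \<open>rot p\<close> is the permutation of the basis.
\<close>

definition rot :: "nat \<Rightarrow> ('j \<times> nat) + 'v \<Rightarrow> ('j \<times> nat) + 'v" where
  "rot p = case_sum (\<lambda>(j, i). Inl (j, Suc i mod p)) Inr"

text \<open>The action of the generator, extended linearly from the rotation of the basis.\<close>

definition perm_act :: "nat \<Rightarrow> (('j \<times> nat) + 'v \<Rightarrow>\<^sub>0 int) \<Rightarrow> (('j \<times> nat) + 'v \<Rightarrow>\<^sub>0 int)" where
  "perm_act p = zlin (\<lambda>y. frag_of (rot p y))"

definition perm_module :: "nat \<Rightarrow> 'j set \<Rightarrow> 'v set \<Rightarrow> (('j \<times> nat) + 'v \<Rightarrow>\<^sub>0 int) set" where
  "perm_module p J V = fsupp ((J \<times> {..<p}) <+> V)"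

lemma perm_act_pow_Inl: "i < p \<Longrightarrow> (perm_act p ^^ n) (frag_of (Inl (j, i))) = frag_of (Inl (j, (i + n) mod p))"
  by (induction n) (auto simp: perm_act_def rot_def mod_Suc_eq)

lemma perm_act_pow_Inr: "(perm_act p ^^ n) (frag_of (Inr v)) = frag_of (Inr v)"
  by (induction n) (auto simp: perm_act_def rot_def)

lemma cyc_module_perm_module: "0 < p \<Longrightarrow> cyc_module p (perm_act p) (perm_module p J V)"
proof
  assume p: "0 < p"
  show "subgrp (perm_module p J V)" by (simp add: perm_module_def subgrp_fsupp)
  show add: "additive_on (perm_module p J V) (perm_act p)" by (simp add: perm_act_def additive_zlin)
  show closed: "perm_act p x \<in> perm_module p J V" if "x \<in> perm_module p J V" for x
    unfolding perm_act_def perm_module_def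
    by (rule zlin_closed[OF subgrp_fsupp _ that[unfolded perm_module_def]]) (use p in \<open>auto simp: rot_def\<close>)
  have "(perm_act p ^^ n) x \<in> perm_module p J V" if "x \<in> perm_module p J V" for x n
    using that by (induction n) (auto simp: closed)
  then have "additive_on (perm_module p J V) (perm_act p ^^ n)" for n
    by (induction n) (auto simp: additive_on_def additive_on_add[OF add])
  then show "(perm_act p ^^ p) x = x" if "x \<in> perm_module p J V" for x
    using that unfolding perm_module_def
    by (elim additive_on_fsupp_eqI) (auto simp: perm_act_pow_Inl perm_act_pow_Inr additive_on_def)
qed

text \<open>The equivariant map with prescribed values on the free generators and on the fixed basis elements.\<close>

definition perm_lift :: "('a::ab_group_add \<Rightarrow> 'a) \<Rightarrow> ('j \<Rightarrow> 'a) \<Rightarrow> ('v \<Rightarrow> 'a) \<Rightarrow> (('j \<times> nat) + 'v \<Rightarrow>\<^sub>0 int) \<Rightarrow> 'a" where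
  "perm_lift A u t = zlin (case_sum (\<lambda>(j, i). (A ^^ i) (u j)) t)"

lemma perm_lift_frag [simp]:
  "perm_lift A u t (frag_of (Inl (j, i))) = (A ^^ i) (u j)" "perm_lift A u t (frag_of (Inr v)) = t v"
  by (simp_all add: perm_lift_def)

lemma perm_lift_additive: "additive_on Y (perm_lift A u t)"
  by (simp add: perm_lift_def additive_zlin)

context cyc_module
begin

context
  fixes u :: "'j \<Rightarrow> 'a" and t :: "'v \<Rightarrow> 'a" and J V
  assumes u: "\<And>j. j \<in> J \<Longrightarrow> u j \<in> H" and t: "\<And>v. v \<in> V \<Longrightarrow> t v \<in> H" "\<And>v. v \<in> V \<Longrightarrow> A (t v) = t v"
begin

lemma perm_lift_closed: "x \<in> perm_module p J V \<Longrightarrow> perm_lift A u t x \<in> H"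
  unfolding perm_lift_def perm_module_def by (erule zlin_closed[OF subgrp, rotated]) (auto simp: u t pow_closed)

lemma perm_lift_equivariant: "equivariant_on (perm_module p J V) A (perm_act p) (perm_lift A u t)"
  unfolding equivariant_on_def
proof
  interpret P: cyc_module p "perm_act p" "perm_module p J V" by (rule cyc_module_perm_module[OF p_pos])
  fix x assume x: "x \<in> perm_module p J V"
  show "perm_lift A u t (perm_act p x) = A (perm_lift A u t x)"
  proof (rule additive_on_fsupp_eqI[OF x[unfolded perm_module_def]], fold perm_module_def)
    show "additive_on (perm_module p J V) (\<lambda>x. perm_lift A u t (perm_act p x))"
      by (rule additive_on_comp[OF perm_lift_additive P.add P.closed])
    show "additive_on (perm_module p J V) (\<lambda>x. A (perm_lift A u t x))"
      by (rule additive_on_comp[OF add perm_lift_additive perm_lift_closed])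
    fix y assume "y \<in> (J \<times> {..<p}) <+> V"
    then show "perm_lift A u t (perm_act p (frag_of y)) = A (perm_lift A u t (frag_of y))"
    proof (rule PlusE)
      fix ji assume "ji \<in> J \<times> {..<p}" "y = Inl ji"
      then obtain j i where y: "j \<in> J" "i < p" "y = Inl (j, i)" by auto
      then show ?thesis
        using pow_mod[OF u[OF y(1)], of "Suc i"] by (simp add: perm_act_def rot_def)
    qed (simp add: perm_act_def rot_def t)
  qed
qed

end

end

text \<open>
  The projection \<open>\<phi>\<close> to the zeroth translates has as trace the projection to the free part; \<open>\<tau>\<close> is the
  projection to the trivial part.
\<close>

lemma perm_module_projections:
  assumes p: "0 < p"
  obtains \<phi> :: "(('j \<times> nat) + 'v \<Rightarrow>\<^sub>0 int) \<Rightarrow> (('j \<times> nat) + 'v \<Rightarrow>\<^sub>0 int)" and \<tau> :: "(('j \<times> nat) + 'v \<Rightarrow>\<^sub>0 int) \<Rightarrow> ('v \<Rightarrow>\<^sub>0 int)" where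
    "additive_on (perm_module p J V) \<phi>" "\<And>x. x \<in> perm_module p J V \<Longrightarrow> \<phi> x \<in> perm_module p J V"
    "additive_on (perm_module p J V) \<tau>" "\<And>x. x \<in> perm_module p J V \<Longrightarrow> \<tau> x \<in> fsupp V"
    "\<And>x. x \<in> perm_module p J V \<Longrightarrow> \<tau> (perm_act p x) = \<tau> x"
    "\<And>x. x \<in> perm_module p J V \<Longrightarrow> x = Tr p (perm_act p) (perm_act p) \<phi> x + zlin (\<lambda>v. frag_of (Inr v)) (\<tau> x)"
proof -
  interpret P: cyc_module p "perm_act p" "perm_module p J V" by (rule cyc_module_perm_module[OF p])
  interpret self: cyc_module_pair p "perm_act p" "perm_module p J V" "perm_act p" "perm_module p J V" by (rule P.self_pair)
  define \<phi> :: "(('j \<times> nat) + 'v \<Rightarrow>\<^sub>0 int) \<Rightarrow> (('j \<times> nat) + 'v \<Rightarrow>\<^sub>0 int)" where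
    "\<phi> = zlin (case_sum (\<lambda>(j, i). if i = 0 then frag_of (Inl (j, 0)) else 0) (\<lambda>_. 0))"
  define \<tau> :: "(('j \<times> nat) + 'v \<Rightarrow>\<^sub>0 int) \<Rightarrow> _" where "\<tau> = zlin (case_sum (\<lambda>_. 0) frag_of)"
  have \<phi>: "additive_on Y \<phi>" for Y by (simp add: \<phi>_def additive_zlin)
  have \<tau>: "additive_on Y \<tau>" for Y by (simp add: \<tau>_def additive_zlin)
  have \<phi>_closed: "\<phi> x \<in> perm_module p J V" if "x \<in> perm_module p J V" for x
    unfolding \<phi>_def using that unfolding perm_module_def
    by (rule zlin_closed[OF subgrp_fsupp, rotated]) (use p in \<open>auto simp: subgrp_zero[OF subgrp_fsupp]\<close>)
  show thesis
  proof (rule that[OF \<phi> \<phi>_closed \<tau>])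
    show "\<tau> x \<in> fsupp V" if "x \<in> perm_module p J V" for x
      unfolding \<tau>_def using that unfolding perm_module_def
      by (rule zlin_closed[OF subgrp_fsupp, rotated]) (auto simp: subgrp_zero[OF subgrp_fsupp])
    show "\<tau> (perm_act p x) = \<tau> x" if x: "x \<in> perm_module p J V" for x
      by (rule additive_on_fsupp_eqI[OF x[unfolded perm_module_def] additive_on_comp[OF \<tau>[of UNIV]] \<tau>])
         (auto simp: perm_act_def additive_zlin \<tau>_def rot_def)
    fix x assume x: "x \<in> perm_module p J V"
    show "x = Tr p (perm_act p) (perm_act p) \<phi> x + zlin (\<lambda>v. frag_of (Inr v)) (\<tau> x)"
    proof (rule additive_on_fsupp_eqI[OF x[unfolded perm_module_def]], fold perm_module_def)
      show "additive_on (perm_module p J V) (\<lambda>x. x)" by (simp add: additive_on_def)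
      show "additive_on (perm_module p J V) (\<lambda>x. Tr p (perm_act p) (perm_act p) \<phi> x + zlin (\<lambda>v. frag_of (Inr v)) (\<tau> x))"
        by (intro additive_on_plus self.Tr_add \<phi> \<phi>_closed)
           (auto simp: additive_on_def additive_on_add[OF \<tau>[of UNIV]] zlin_add)
      fix y assume "y \<in> (J \<times> {..<p}) <+> V"
      then show "frag_of y = Tr p (perm_act p) (perm_act p) \<phi> (frag_of y) + zlin (\<lambda>v. frag_of (Inr v)) (\<tau> (frag_of y))"
      proof (rule PlusE)
        fix ji assume "ji \<in> J \<times> {..<p}" "y = Inl ji"
        then obtain j i where y: "i < p" "y = Inl (j, i)" by auto
        have "(perm_act p ^^ k) (\<phi> ((perm_act p ^^ (p - k)) (frag_of y))) = (if k = i then frag_of y else 0)"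
          if k: "k < p" for k
        proof (cases "k = i")
          case False
          have "(i + (p - k)) mod p \<noteq> 0"
          proof (cases "k < i")
            case True
            then have "(i + (p - k)) mod p = i - k" using y(1) k by (simp add: le_mod_geq)
            then show ?thesis using True by simp
          next
            case 2: False
            then have "i + (p - k) < p" "i + (p - k) \<noteq> 0" using k False by auto
            then show ?thesis by simp
          qed
          then show ?thesis using y False additive_on_zero[OF P.pow_add P.subgrp]
            by (simp add: perm_act_pow_Inl \<phi>_def)
        qed (use y in \<open>simp add: perm_act_pow_Inl \<phi>_def\<close>)
        then have "Tr p (perm_act p) (perm_act p) \<phi> (frag_of y) = frag_of y"
          unfolding Tr_def using y(1) by (simp add: sum.delta)
        then show ?thesis using y(2) by (simp add: \<tau>_def)
      next
        fix v assume "y = Inr v"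
        then show ?thesis
          using additive_on_zero[OF P.pow_add P.subgrp]
          by (simp add: Tr_def perm_act_pow_Inr \<phi>_def \<tau>_def)
      qed
    qed
  qed
qed

text \<open>Elements of norm zero are boundaries, that is \<open>H\<^sup>1 = 0\<close>.\<close>

lemma perm_module_boundary:
  assumes p: "0 < p" and x: "x \<in> perm_module p J V" "Nm p (perm_act p) x = 0"
  obtains w where "w \<in> perm_module p J V" "x = perm_act p w - w"
proof -
  interpret P: cyc_module p "perm_act p" "perm_module p J V" by (rule cyc_module_perm_module[OF p])
  obtain \<phi> and \<tau> :: "(('a \<times> nat) + 'b \<Rightarrow>\<^sub>0 int) \<Rightarrow> ('b \<Rightarrow>\<^sub>0 int)" where
    \<phi>: "additive_on (perm_module p J V) \<phi>" "\<And>x. x \<in> perm_module p J V \<Longrightarrow> \<phi> x \<in> perm_module p J V" and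
    \<tau>: "additive_on (perm_module p J V) \<tau>" "\<And>x. x \<in> perm_module p J V \<Longrightarrow> \<tau> x \<in> fsupp V"
      "\<And>x. x \<in> perm_module p J V \<Longrightarrow> \<tau> (perm_act p x) = \<tau> x" and
    sum: "\<And>x. x \<in> perm_module p J V \<Longrightarrow> x = Tr p (perm_act p) (perm_act p) \<phi> x + zlin (\<lambda>v. frag_of (Inr v)) (\<tau> x)"
  proof (rule perm_module_projections[OF p, of J V], goal_cases)
    case (1 \<phi> \<tau>)
    from 1(2-) show thesis by (rule 1(1))
  qed
  have "\<tau> ((perm_act p ^^ i) x) = \<tau> x" for i
    by (induction i) (simp_all add: \<tau>(3) P.pow_closed x(1))
  then have "\<tau> (Nm p (perm_act p) x) = int p *\<^sub>z \<tau> x"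
    unfolding Nm_def by (simp add: additive_on_sum[OF \<tau>(1) P.subgrp] P.pow_closed x(1) sum_const_zmul)
  then have "int p *\<^sub>z \<tau> x = 0" using x(2) additive_on_zero[OF \<tau>(1) P.subgrp] by simp
  then have "Poly_Mapping.lookup (int p *\<^sub>z \<tau> x) v = 0" for v by simp
  then have "\<tau> x = 0" using p by (intro poly_mapping_eqI) simp
  then have 1: "x = Tr p (perm_act p) (perm_act p) \<phi> x" using sum[OF x(1)] by simp
  let ?y = "\<lambda>i. \<phi> ((perm_act p ^^ (p - i)) x)"
  have y: "?y i \<in> perm_module p J V" for i by (simp add: \<phi> P.pow_closed x(1))
  have "(\<Sum>i<p. (perm_act p ^^ (p - i)) x) = 0"
    using P.Nm_inverse[OF x(1)] x(2) by simp
  then have "\<phi> (\<Sum>i<p. (perm_act p ^^ (p - i)) x) = 0"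
    using additive_on_zero[OF \<phi>(1) P.subgrp] by simp
  then have "(\<Sum>i<p. ?y i) = 0"
    by (simp add: additive_on_sum[OF \<phi>(1) P.subgrp] P.pow_closed x(1))
  then have "x = (\<Sum>i<p. (perm_act p ^^ i) (?y i) - ?y i)"
    using 1 by (simp add: Tr_def sum_subtractf)
  also have "\<dots> \<in> (\<lambda>w. perm_act p w - w) ` perm_module p J V"
    by (intro subgrp_sum P.subgrp_boundaries P.pow_boundary y)
  finally show thesis using that by blast
qed

text \<open>An invariant is a norm up to an element of the trivial part.\<close>

lemma perm_module_invariant:
  assumes p: "0 < p" and x: "x \<in> perm_module p J V" "perm_act p x = x"
  obtains f t where "f \<in> perm_module p J V" "t \<in> fsupp V" "x = Nm p (perm_act p) f + zlin (\<lambda>v. frag_of (Inr v)) t"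
proof -
  interpret P: cyc_module p "perm_act p" "perm_module p J V" by (rule cyc_module_perm_module[OF p])
  obtain \<phi> and \<tau> :: "(('a \<times> nat) + 'b \<Rightarrow>\<^sub>0 int) \<Rightarrow> ('b \<Rightarrow>\<^sub>0 int)" where
    \<phi>: "additive_on (perm_module p J V) \<phi>" "\<And>x. x \<in> perm_module p J V \<Longrightarrow> \<phi> x \<in> perm_module p J V" and
    \<tau>: "additive_on (perm_module p J V) \<tau>" "\<And>x. x \<in> perm_module p J V \<Longrightarrow> \<tau> x \<in> fsupp V"
      "\<And>x. x \<in> perm_module p J V \<Longrightarrow> \<tau> (perm_act p x) = \<tau> x" and
    sum: "\<And>x. x \<in> perm_module p J V \<Longrightarrow> x = Tr p (perm_act p) (perm_act p) \<phi> x + zlin (\<lambda>v. frag_of (Inr v)) (\<tau> x)"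
  proof (rule perm_module_projections[OF p, of J V], goal_cases)
    case (1 \<phi> \<tau>)
    from 1(2-) show thesis by (rule 1(1))
  qed
  have "Tr p (perm_act p) (perm_act p) \<phi> x = Nm p (perm_act p) (\<phi> x)"
    by (simp add: Tr_def Nm_def P.pow_fixed x(2))
  then show thesis using that[OF \<phi>(2) \<tau>(2), OF x(1) x(1)] sum[OF x(1)] by simp
qed

section \<open>Sequence modules and the swindle\<close>

text \<open>
  \<open>Seq P\<close> is the direct sum of countably many copies of \<open>P\<close>, as the sequences of finite support;
  \<open>seq_act\<close> is the action on the direct sum of a further module with it.
\<close>

definition Seq :: "'b::ab_group_add set \<Rightarrow> (nat \<Rightarrow> 'b) set" where
  "Seq P = {f. (\<forall>n. f n \<in> P) \<and> finite {n. f n \<noteq> 0}}"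

definition seq_act :: "('a \<Rightarrow> 'a) \<Rightarrow> ('b \<Rightarrow> 'b) \<Rightarrow> 'a \<times> (nat \<Rightarrow> 'b) \<Rightarrow> 'a \<times> (nat \<Rightarrow> 'b)" where
  "seq_act A B = (\<lambda>(x, f). (A x, \<lambda>n. B (f n)))"

lemma seq_act_pow: "(seq_act A B ^^ k) (x, f) = ((A ^^ k) x, \<lambda>n. (B ^^ k) (f n))"
  by (induction k) (auto simp: seq_act_def)

lemma subgrp_Seq: "subgrp P \<Longrightarrow> subgrp (Seq P)"
proof (rule subgrpI)
  fix f g assume P: "subgrp P" and fg: "f \<in> Seq P" "g \<in> Seq P"
  have "{n. (f - g) n \<noteq> 0} \<subseteq> {n. f n \<noteq> 0} \<union> {n. g n \<noteq> 0}" by auto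
  moreover have "finite ({n. f n \<noteq> 0} \<union> {n. g n \<noteq> 0})" using fg by (simp add: Seq_def)
  ultimately have "finite {n. (f - g) n \<noteq> 0}" by (rule finite_subset)
  then show "f - g \<in> Seq P" using fg by (simp add: Seq_def subgrp_diff[OF P])
qed (simp add: Seq_def subgrp_zero)

lemma cyc_module_seq:
  assumes "cyc_module p A H" "cyc_module p B P"
  shows "cyc_module p (seq_act A B) (H \<times> Seq P)"
proof -
  interpret H: cyc_module p A H by fact
  interpret P: cyc_module p B P by fact
  show ?thesis
  proof
    show "additive_on (H \<times> Seq P) (seq_act A B)"
      by (auto simp: additive_on_def seq_act_def additive_on_add[OF H.add] additive_on_add[OF P.add]
          Seq_def fun_eq_iff)
    show "seq_act A B x \<in> H \<times> Seq P" if "x \<in> H \<times> Seq P" for x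
    proof -
      have "{n. B (snd x n) \<noteq> 0} \<subseteq> {n. snd x n \<noteq> 0}" using additive_on_zero[OF P.add P.subgrp] by auto
      then have "finite {n. B (snd x n) \<noteq> 0}"
        using that by (auto simp: Seq_def elim: finite_subset)
      then show ?thesis using that by (auto simp: seq_act_def Seq_def H.closed P.closed)
    qed
    show "(seq_act A B ^^ p) x = x" if "x \<in> H \<times> Seq P" for x
      using that by (cases x) (auto simp: seq_act_pow H.order P.order Seq_def)
  qed (simp_all add: H.p_pos subgrp_Times H.subgrp subgrp_Seq P.subgrp)
qed

text \<open>
  If \<open>e\<close> is an epimorphism from \<open>E\<close> to \<open>H\<close> whose kernel is a direct summand both of \<open>E\<close> and, via the
  maps \<open>u\<close> and \<open>v\<close>, of \<open>P\<close>, then \<open>E \<oplus> P \<oplus> P \<oplus> \<dots>\<close> and \<open>H \<oplus> P \<oplus> P \<oplus> \<dots>\<close> are isomorphic: the kernel is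
  moved into the first copy of \<open>P\<close>, whose copy of the kernel is moved into the second, and so on.
\<close>

lemma swindle:
  assumes "cyc_module p A E" "cyc_module p B P" "cyc_module p C H"
    and e: "additive_on E e" "equivariant_on E C A e" "e ` E = H"
    and u: "additive_on E u" "equivariant_on E B A u" "\<And>x. x \<in> E \<Longrightarrow> u x \<in> P"
    and v: "additive_on P v" "equivariant_on P A B v" "\<And>y. y \<in> P \<Longrightarrow> v y \<in> E"
    and ev: "\<And>y. y \<in> P \<Longrightarrow> e (v y) = 0"
    and vu: "\<And>x. x \<in> E \<Longrightarrow> e x = 0 \<Longrightarrow> v (u x) = x"
    and uvu: "\<And>x. x \<in> E \<Longrightarrow> u (v (u x)) = u x"
  obtains \<Omega> where "bij_betw \<Omega> (E \<times> Seq P) (H \<times> Seq P)" "additive_on (E \<times> Seq P) \<Omega>"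
    "equivariant_on (E \<times> Seq P) (seq_act C B) (seq_act A B) \<Omega>"
proof -
  interpret E: cyc_module p A E by fact
  interpret P: cyc_module p B P by fact
  interpret H: cyc_module p C H by fact
  define D where "D y = u (v y)" for y
  have D: "additive_on P D" "\<And>y. y \<in> P \<Longrightarrow> D y \<in> P" "\<And>y. y \<in> P \<Longrightarrow> D (D y) = D y"
    "\<And>y. y \<in> P \<Longrightarrow> v (D y) = v y" "\<And>x. x \<in> E \<Longrightarrow> D (u x) = u x" "\<And>y. y \<in> P \<Longrightarrow> D (B y) = B (D y)"
    unfolding D_def
    by (rule additive_on_comp[OF u(1) v(1,3)])
       (auto simp: u v ev vu uvu equivariant_onD[OF u(2)] equivariant_onD[OF v(2)])
  have D0: "D 0 = 0" and u0: "u 0 = 0"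
    using additive_on_zero[OF D(1) P.subgrp] additive_on_zero[OF u(1) E.subgrp] by auto
  \<comment> \<open>\<open>D\<close> projects \<open>P\<close> to its copy of the kernel.  The map shifts these parts by one place and fills
    the first place with the kernel part of \<open>x\<close>.\<close>
  define F where "F x f n = f n - D (f n) + (case n of 0 \<Rightarrow> u x | Suc m \<Rightarrow> D (f m))" for x f and n :: nat
  define \<Omega> where "\<Omega> = (\<lambda>(x, f). (e x, F x f))"
  have dom: "subgrp (E \<times> Seq P)" by (intro subgrp_Times E.subgrp subgrp_Seq P.subgrp)
  have F_Seq: "F x f \<in> Seq P" if "x \<in> E" "f \<in> Seq P" for x f
  proof -
    have "{n. F x f n \<noteq> 0} \<subseteq> {n. f n \<noteq> 0} \<union> insert 0 (Suc ` {n. f n \<noteq> 0})"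
    proof
      fix n assume "n \<in> {n. F x f n \<noteq> 0}"
      then show "n \<in> {n. f n \<noteq> 0} \<union> insert 0 (Suc ` {n. f n \<noteq> 0})"
        by (cases n) (auto simp: F_def D0 split: if_splits)
    qed
    then have "finite {n. F x f n \<noteq> 0}"
      using that by (auto simp: Seq_def intro: finite_subset)
    moreover have "F x f n \<in> P" for n
      using that by (cases n) (auto simp: F_def Seq_def D u intro!: subgrp_add[OF P.subgrp] subgrp_diff[OF P.subgrp])
    ultimately show ?thesis by (simp add: Seq_def)
  qed
  have add: "additive_on (E \<times> Seq P) \<Omega>"
  proof (rule additive_onI)
    fix y z assume "y \<in> E \<times> Seq P" "z \<in> E \<times> Seq P"
    then obtain x f x' f' where *: "y = (x, f)" "z = (x', f')" "x \<in> E" "x' \<in> E" "\<And>n. f n \<in> P" "\<And>n. f' n \<in> P"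
      by (auto simp: Seq_def)
    have "F (x + x') (f + f') n = F x f n + F x' f' n" for n
      using * by (cases n) (simp_all add: F_def additive_on_add[OF D(1)] additive_on_add[OF u(1)])
    then show "\<Omega> (y + z) = \<Omega> y + \<Omega> z"
      using * by (auto simp: \<Omega>_def additive_on_add[OF e(1)])
  qed
  have equiv: "equivariant_on (E \<times> Seq P) (seq_act C B) (seq_act A B) \<Omega>"
    unfolding equivariant_on_def
  proof
    fix z assume "z \<in> E \<times> Seq P"
    then obtain x f where *: "z = (x, f)" "x \<in> E" "\<And>n. f n \<in> P" by (auto simp: Seq_def)
    have "F (A x) (\<lambda>n. B (f n)) n = B (F x f n)" for n
      using * by (cases n) (simp_all add: F_def D u equivariant_onD[OF u(2)] additive_on_add[OF P.add]
          additive_on_diff[OF P.add P.subgrp] subgrp_diff[OF P.subgrp])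
    then show "\<Omega> (seq_act A B z) = seq_act C B (\<Omega> z)"
      using * by (auto simp: \<Omega>_def seq_act_def equivariant_onD[OF e(2)])
  qed
  have "inj_on \<Omega> (E \<times> Seq P)"
    unfolding additive_on_inj_iff[OF add dom]
  proof (intro ballI impI)
    fix z assume z: "z \<in> E \<times> Seq P" "\<Omega> z = 0"
    then obtain x f where *: "z = (x, f)" "x \<in> E" "\<And>n. f n \<in> P" by (auto simp: Seq_def)
    then have ex: "e x = 0" and F: "\<And>n. F x f n = 0"
      using z(2) by (auto simp: \<Omega>_def zero_prod_def fun_eq_iff)
    have vF: "v (F x f n) = (case n of 0 \<Rightarrow> v (u x) | Suc m \<Rightarrow> v (f m))" for n
      using * by (cases n) (simp_all add: F_def additive_on_add[OF v(1)] additive_on_diff[OF v(1) P.subgrp]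
          D u subgrp_diff[OF P.subgrp])
    have v0: "v 0 = 0" by (rule additive_on_zero[OF v(1) P.subgrp])
    have "x = 0" using vF[of 0] F[of 0] vu[OF *(2) ex] v0 by simp
    moreover have Df: "D (f m) = 0" for m
      using vF[of "Suc m"] F[of "Suc m"] v0 u0 by (simp add: D_def)
    have "f n = 0" for n
      using F[of n] Df \<open>x = 0\<close> u0 by (cases n) (simp_all add: F_def)
    ultimately show "z = 0" using *(1) by (simp add: zero_prod_def fun_eq_iff)
  qed
  moreover have "\<Omega> ` (E \<times> Seq P) = H \<times> Seq P"
  proof
    show "\<Omega> ` (E \<times> Seq P) \<subseteq> H \<times> Seq P" using e(3) F_Seq by (auto simp: \<Omega>_def)
    show "H \<times> Seq P \<subseteq> \<Omega> ` (E \<times> Seq P)"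
    proof
      fix z assume "z \<in> H \<times> Seq P"
      then obtain n g where z: "z = (n, g)" "n \<in> H" "g \<in> Seq P" by auto
      then have g: "g k \<in> P" "finite {k. g k \<noteq> 0}" for k by (auto simp: Seq_def)
      obtain x0 where x0: "x0 \<in> E" "e x0 = n" using e(3) z(2) by blast
      \<comment> \<open>replace the kernel part of \<open>x0\<close> by that of \<open>g 0\<close>, and shift the other ones back\<close>
      define x where "x = x0 - v (u x0) + v (g 0)"
      define f where "f m = g m - D (g m) + D (g (Suc m))" for m
      have x: "x \<in> E" "e x = n" "u x = D (g 0)"
        using x0 g unfolding x_def
        by (simp_all add: additive_on_add[OF e(1)] additive_on_diff[OF e(1) E.subgrp] ev u v uvu
            subgrp_add[OF E.subgrp] subgrp_diff[OF E.subgrp] additive_on_add[OF u(1)]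
            additive_on_diff[OF u(1) E.subgrp] D_def)
      have fP: "f m \<in> P" for m
        by (simp add: f_def g D subgrp_add[OF P.subgrp] subgrp_diff[OF P.subgrp])
      have "{m. f m \<noteq> 0} \<subseteq> {k. g k \<noteq> 0} \<union> Suc -` {k. g k \<noteq> 0}" by (auto simp: f_def D0)
      moreover have "finite (Suc -` {k. g k \<noteq> 0})" using g(2) by (intro finite_vimageI) auto
      ultimately have "finite {m. f m \<noteq> 0}" using g(2) finite_subset by blast
      then have f: "f \<in> Seq P" using fP by (simp add: Seq_def)
      have Df: "D (f m) = D (g (Suc m))" for m
        by (simp add: f_def g D additive_on_add[OF D(1)] additive_on_diff[OF D(1) P.subgrp]
            subgrp_diff[OF P.subgrp])
      have "F x f k = g k" for k
        unfolding F_def Df by (cases k) (simp_all add: x Df f_def)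
      then have "\<Omega> (x, f) = z" using x(2) z(1) by (auto simp: \<Omega>_def)
      then show "z \<in> \<Omega> ` (E \<times> Seq P)" using x(1) f by blast
    qed
  qed
  ultimately have "bij_betw \<Omega> (E \<times> Seq P) (H \<times> Seq P)" by (simp add: bij_betw_def)
  then show thesis by (rule that[OF _ add equiv])
qed

text \<open>
  The direct sum of a permutation module and of countably many copies of a free module is a
  permutation module.
\<close>

lemma perm_module_Seq:
  fixes J :: "'j set" and V :: "'v set" and S :: "'s set"
  assumes p: "0 < p"
  defines "P \<equiv> (perm_module p S {} :: (('s \<times> nat) + 'w \<Rightarrow>\<^sub>0 int) set)"
  obtains \<Psi> where "bij_betw \<Psi> (perm_module p (J <+> S \<times> (UNIV :: nat set)) V) (perm_module p J V \<times> Seq P)"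
    "additive_on (perm_module p (J <+> S \<times> (UNIV :: nat set)) V) \<Psi>"
    "equivariant_on (perm_module p (J <+> S \<times> (UNIV :: nat set)) V) (seq_act (perm_act p) (perm_act p)) (perm_act p) \<Psi>"
    "\<And>j. \<Psi> (frag_of (Inl (Inl j, 0))) = (frag_of (Inl (j, 0)), 0)"
    "\<And>v. \<Psi> (frag_of (Inr v)) = (frag_of (Inr v), 0)"
proof -
  let ?X = "J <+> S \<times> (UNIV :: nat set)" and ?B = "seq_act (perm_act p) (perm_act p)" and ?C = "perm_module p J V \<times> Seq P"
  interpret P: cyc_module p "perm_act p" P unfolding P_def by (rule cyc_module_perm_module[OF p])
  interpret J: cyc_module p "perm_act p" "perm_module p J V" by (rule cyc_module_perm_module[OF p])
  interpret C: cyc_module p ?B ?C by (rule cyc_module_seq[OF J.cyc_module_axioms P.cyc_module_axioms])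
  define single where "single n y = (\<lambda>m. if m = n then y else (0 :: ('s \<times> nat) + 'w \<Rightarrow>\<^sub>0 int))" for n :: nat and y
  have single_Seq: "single n y \<in> Seq P" if "y \<in> P" for n y
    using that subgrp_zero[OF P.subgrp] by (auto simp: single_def Seq_def)
  define g where "g = case_sum (\<lambda>j. (frag_of (Inl (j, 0)), 0))
    (\<lambda>(s, n). (0, single n (frag_of (Inl (s, 0)))) :: (('j \<times> nat) + 'v \<Rightarrow>\<^sub>0 int) \<times> _)"
  define \<Psi> where "\<Psi> = perm_lift ?B g (\<lambda>v. (frag_of (Inr v), 0))"
  have add: "additive_on Y \<Psi>" for Y by (simp add: \<Psi>_def perm_lift_additive)
  have zero: "(perm_act p ^^ i) 0 = (0 :: ('a \<times> nat) + 'b \<Rightarrow>\<^sub>0 int)" for i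
    by (induction i) (auto simp: perm_act_def)
  have B: "(?B ^^ i) (x, f) = ((perm_act p ^^ i) x, \<lambda>n. (perm_act p ^^ i) (f n))" for i x f
    by (rule seq_act_pow)
  have g_in: "g j \<in> ?C" if "j \<in> ?X" for j
    using that p subgrp_zero[OF J.subgrp] subgrp_zero[OF subgrp_Seq[OF P.subgrp]]
    by (auto simp: g_def perm_module_def P_def intro!: single_Seq[unfolded P_def perm_module_def])
  have t_in: "(frag_of (Inr v), 0) \<in> ?C" "?B (frag_of (Inr v), 0) = (frag_of (Inr v), 0)" if "v \<in> V" for v
    using that subgrp_zero[OF subgrp_Seq[OF P.subgrp]] perm_act_pow_Inr[where n = 1 and p = p] zero[of 1]
    by (auto simp: perm_module_def seq_act_def fun_eq_iff)
  have closed: "\<Psi> x \<in> ?C" if "x \<in> perm_module p ?X V" for x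
    unfolding \<Psi>_def by (rule C.perm_lift_closed[OF g_in t_in that])
  have equiv: "equivariant_on (perm_module p ?X V) ?B (perm_act p) \<Psi>"
    unfolding \<Psi>_def by (rule C.perm_lift_equivariant[OF g_in t_in])
  have \<Psi>_J: "\<Psi> (frag_of (Inl (Inl j, i))) = (frag_of (Inl (j, i)), 0)" if "i < p" for i j
    using that p by (simp add: \<Psi>_def g_def B perm_act_pow_Inl zero fun_eq_iff)
  have \<Psi>_S: "\<Psi> (frag_of (Inl (Inr (s, n), i))) = (0, single n (frag_of (Inl (s, i))))" if "i < p" for i s n
    using that p by (auto simp: \<Psi>_def g_def B perm_act_pow_Inl zero fun_eq_iff single_def)
  have \<Psi>_V: "\<Psi> (frag_of (Inr v)) = (frag_of (Inr v), 0)" for v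
    by (simp add: \<Psi>_def)
  have dom: "subgrp (perm_module p ?X V)" by (simp add: perm_module_def subgrp_fsupp)

  \<comment> \<open>\<open>coord y\<close> reads off the coefficient at the basis element with index \<open>y\<close>\<close>
  define coord where "coord = case_sum
      (\<lambda>(q, i). case q of Inl j \<Rightarrow> (\<lambda>w. Poly_Mapping.lookup (fst w) (Inl (j, i)))
                | Inr (s, n) \<Rightarrow> (\<lambda>w. Poly_Mapping.lookup (snd w n) (Inl (s, i))))
      (\<lambda>v w :: (('j \<times> nat) + 'v \<Rightarrow>\<^sub>0 int) \<times> (nat \<Rightarrow> ('s \<times> nat) + 'w \<Rightarrow>\<^sub>0 int). Poly_Mapping.lookup (fst w) (Inr v))"
  have coord_add: "additive_on UNIV (coord y)" for y
    by (auto simp: additive_on_def coord_def lookup_add split: sum.splits prod.splits)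
  have lookup: "coord y (\<Psi> x) = Poly_Mapping.lookup x y"
    if x: "x \<in> perm_module p ?X V" for x and y :: "(('j + 's \<times> nat) \<times> nat) + 'v"
  proof (rule additive_on_fsupp_eqI[OF x[unfolded perm_module_def] additive_on_comp[OF coord_add add]])
    show "additive_on (fsupp (?X \<times> {..<p} <+> V)) (\<lambda>x. Poly_Mapping.lookup x y)"
      by (simp add: additive_on_def lookup_add)
    fix b assume "b \<in> ?X \<times> {..<p} <+> V"
    then show "coord y (\<Psi> (frag_of b)) = Poly_Mapping.lookup (frag_of b) y"
      by (auto simp: \<Psi>_J \<Psi>_S \<Psi>_V coord_def single_def lookup_single when_def
          split: sum.splits prod.splits)
  qed simp
  have "inj_on \<Psi> (perm_module p ?X V)"
    unfolding additive_on_inj_iff[OF add dom]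
  proof (intro ballI impI poly_mapping_eqI)
    fix x k assume "x \<in> perm_module p ?X V" "\<Psi> x = 0"
    then show "Poly_Mapping.lookup x k = Poly_Mapping.lookup 0 k"
      using lookup[of x k] additive_on_zero[OF coord_add subgrp_UNIV, of k] by simp
  qed
  moreover have "\<Psi> ` perm_module p ?X V = ?C"
  proof
    show "\<Psi> ` perm_module p ?X V \<subseteq> ?C" using closed by blast
    let ?I = "\<Psi> ` perm_module p ?X V"
    have I: "subgrp ?I" by (rule subgrp_image[OF add dom])
    have gen: "\<Psi> (frag_of b) \<in> ?I" if "b \<in> ?X \<times> {..<p} <+> V" for b
      using that by (auto simp: perm_module_def)
    have 1: "(x, 0) \<in> ?I" if "x \<in> perm_module p J V" for x
      using that unfolding perm_module_def
    proof (rule fsupp_additive_closed[OF I[unfolded perm_module_def], rotated 2])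
      fix b assume "b \<in> J \<times> {..<p} <+> V"
      then show "(frag_of b, 0) \<in> \<Psi> ` fsupp (?X \<times> {..<p} <+> V)"
      proof (rule PlusE)
        fix ji assume "ji \<in> J \<times> {..<p}" "b = Inl ji"
        then obtain j i where "j \<in> J" "i < p" "b = Inl (j, i)" by auto
        then show ?thesis using gen[of "Inl (Inl j, i)"] by (simp add: \<Psi>_J perm_module_def InlI)
      next
        fix v assume "v \<in> V" "b = Inr v"
        then show ?thesis using gen[of "Inr v"] by (simp add: \<Psi>_V perm_module_def InrI)
      qed
    qed (auto simp: additive_on_def)
    have 2: "(0, single n x) \<in> ?I" if "x \<in> P" for n x
      using that unfolding perm_module_def P_def
    proof (rule fsupp_additive_closed[OF I[unfolded perm_module_def], rotated 2])
      fix b :: "('s \<times> nat) + 'w" assume "b \<in> S \<times> {..<p} <+> {}"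
      then obtain s i where "s \<in> S" "i < p" "b = Inl (s, i)" by auto
      then show "(0, single n (frag_of b)) \<in> \<Psi> ` fsupp (?X \<times> {..<p} <+> V)"
        using gen[of "Inl (Inr (s, n), i)"] by (simp add: \<Psi>_S perm_module_def InlI InrI)
    qed (auto simp: additive_on_def single_def fun_eq_iff)
    have 3: "(0, \<lambda>m. if m \<in> F then f m else 0) \<in> ?I" if "finite F" "\<And>m. f m \<in> P" for F f
      using that(1)
    proof induction
      case empty
      then show ?case using subgrp_zero[OF I] by (simp add: zero_prod_def zero_fun_def)
    next
      case (insert n F)
      have split: "(0, \<lambda>m. if m \<in> insert n F then f m else 0)
          = (0, \<lambda>m. if m \<in> F then f m else 0) + (0 :: ('j \<times> nat) + 'v \<Rightarrow>\<^sub>0 int, single n (f n))"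
        using insert(2) by (auto simp: single_def fun_eq_iff)
      show ?case unfolding split by (rule subgrp_add[OF I insert(3) 2[OF that(2)]])
    qed
    show "?C \<subseteq> ?I"
    proof
      fix z assume "z \<in> ?C"
      then obtain x f where z: "z = (x, f)" "x \<in> perm_module p J V" "\<And>m. f m \<in> P" "finite {m. f m \<noteq> 0}"
        by (auto simp: Seq_def)
      have "(\<lambda>m. if m \<in> {m. f m \<noteq> 0} then f m else 0) = f" by auto
      then have "(0, f) \<in> ?I" using 3[OF z(4), of f] z(3) by simp
      then have "(x, 0) + (0, f) \<in> ?I" using subgrp_add[OF I 1[OF z(2)]] by blast
      then show "z \<in> ?I" using z(1) by simp
    qed
  qed
  ultimately have "bij_betw \<Psi> (perm_module p ?X V) ?C" by (simp add: bij_betw_def)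
  then show thesis using add equiv \<Psi>_J[OF p] \<Psi>_V by (rule that)
qed

section \<open>Modules without first cohomology\<close>

lemma zlin_code_inj:
  assumes "inj code"
  shows "inj (zlin (\<lambda>y. frag_of (code y)))"
  unfolding additive_on_inj_iff[OF additive_zlin subgrp_UNIV]
proof (intro ballI impI poly_mapping_eqI)
  fix z :: "'a \<Rightarrow>\<^sub>0 int" and y assume z: "zlin (\<lambda>y. frag_of (code y)) z = 0"
  have "Poly_Mapping.lookup (zlin (\<lambda>y. frag_of (code y)) z) (code y) = Poly_Mapping.lookup z y"
    by (rule additive_on_fsupp_eqI[where S = UNIV])
       (use assms in \<open>auto simp: additive_on_def zlin_add lookup_add lookup_single when_def inj_eq\<close>)
  then show "Poly_Mapping.lookup z y = Poly_Mapping.lookup 0 y" using z by simp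
qed

text \<open>
  A module that embeds as an abelian group into a free abelian group and in which the elements of
  norm zero are boundaries becomes a permutation module after adding a free module.  The index sets
  can be kept inside one type \<open>'x\<close>, provided that \<open>code\<close> embeds the indices of permutation modules
  over \<open>'x\<close> into \<open>'x\<close>.
\<close>

lemma (in cyc_module) stably_permutation:
  fixes \<iota> :: "'a \<Rightarrow> ('x \<Rightarrow>\<^sub>0 int)" and code :: "('x \<times> nat) + 'x \<Rightarrow> 'x"
  assumes p: "Factorial_Ring.prime p" and \<iota>: "additive_on H \<iota>" "inj_on \<iota> H" and code: "inj code"
    and H1: "\<And>x. x \<in> H \<Longrightarrow> Nm p A x = 0 \<Longrightarrow> \<exists>w\<in>H. x = A w - w"
  obtains J V S :: "'x set"
    and \<Omega> :: "(('x \<times> nat) + 'x \<Rightarrow>\<^sub>0 int) \<times> (nat \<Rightarrow> ('x \<times> nat) + 'x \<Rightarrow>\<^sub>0 int)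
      \<Rightarrow> 'a \<times> (nat \<Rightarrow> ('x \<times> nat) + 'x \<Rightarrow>\<^sub>0 int)" where
    "bij_betw \<Omega> (perm_module p J V \<times> Seq (perm_module p S ({} :: 'x set))) (H \<times> Seq (perm_module p S {}))"
    "additive_on (perm_module p J V \<times> Seq (perm_module p S {})) \<Omega>"
    "equivariant_on (perm_module p J V \<times> Seq (perm_module p S {})) (seq_act A (perm_act p)) (seq_act (perm_act p) (perm_act p)) \<Omega>"
proof -
  obtain J :: "'x set" and b where b: "zbasis J b H"
    using embedded_in_free_is_free[OF subgrp \<iota>] by metis
  \<comment> \<open>\<open>V\<close> indexes a basis of the invariants modulo norms\<close>
  define G where "G = {x \<in> H. A x = x}"
  have GH: "G \<subseteq> H" by (auto simp: G_def)
  have G: "subgrp G" unfolding G_def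
    by (rule subgrpI) (auto simp: subgrp_zero[OF subgrp] subgrp_diff[OF subgrp]
        additive_on_zero[OF add subgrp] additive_on_diff[OF add subgrp])
  obtain SG :: "'x set" and c where c: "zbasis SG c G"
    using embedded_in_free_is_free[OF G additive_on_subset[OF \<iota>(1) GH] inj_on_subset[OF \<iota>(2) GH]]
    by metis
  have zc: "zlin c z \<in> G" if "z \<in> fsupp SG" for z
    using c that by (auto simp: zbasis_def bij_betw_def)
  define L where "L = {z \<in> fsupp SG. zlin c z \<in> Nm p A ` H}"
  have NmH: "subgrp (Nm p A ` H)" by (rule subgrp_image[OF Nm_add subgrp])
  have "subgrp L" unfolding L_def by (rule subgrp_preimage[OF additive_zlin subgrp_fsupp NmH])
  moreover have "int p *\<^sub>z z \<in> L" if z: "z \<in> fsupp SG" for z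
  proof -
    have "zlin c (int p *\<^sub>z z) = int p *\<^sub>z zlin c z"
      by (rule additive_on_zmul[OF additive_zlin subgrp_UNIV UNIV_I])
    also have "\<dots> = Nm p A (zlin c z)" using zc[OF z] by (simp add: G_def Nm_fixed)
    finally show ?thesis using z zc[OF z] GH by (auto simp: L_def zmul_closed[OF subgrp_fsupp])
  qed
  ultimately obtain V where V: "V \<subseteq> SG" "\<And>z. z \<in> fsupp SG \<Longrightarrow> \<exists>v\<in>fsupp V. z - v \<in> L"
    "\<And>v. v \<in> fsupp V \<Longrightarrow> v \<in> L \<Longrightarrow> \<exists>u\<in>fsupp V. v = int p *\<^sub>z u"
    using basis_mod_subgroup[OF p, of L SG] unfolding L_def by blast

  define E :: "(('x \<times> nat) + 'x \<Rightarrow>\<^sub>0 int) set" where "E = perm_module p J V"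
  define e where "e = perm_lift A b c"
  interpret E: cyc_module p "perm_act p" E unfolding E_def by (rule cyc_module_perm_module[OF p_pos])
  interpret HE: cyc_module_pair p A H "perm_act p" E ..
  have cV: "c v \<in> H" "A (c v) = c v" if "v \<in> V" for v
    using zbasis_mem[OF c, of v] that V(1) by (auto simp: G_def)
  have e: "additive_on Y e" "equivariant_on E A (perm_act p) e" "\<And>x. x \<in> E \<Longrightarrow> e x \<in> H" for Y
    unfolding e_def E_def
    by (rule perm_lift_additive, rule perm_lift_equivariant[OF zbasis_mem[OF b] cV], assumption+)
       (rule perm_lift_closed[OF zbasis_mem[OF b] cV], assumption+)
  have gen: "frag_of (Inl (j, 0)) \<in> E" if "j \<in> J" for j
    using that p_pos by (auto simp: E_def perm_module_def)
  obtain s where s: "additive_on H s" "\<And>j. j \<in> J \<Longrightarrow> s (b j) = frag_of (Inl (j, 0))" "\<And>x. x \<in> H \<Longrightarrow> s x \<in> E"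
    using zbasis_extend[where c = "\<lambda>j. frag_of (Inl (j, 0))", OF b E.subgrp gen] by metis
  have es: "e (s x) = x" if "x \<in> H" for x
    by (rule zbasis_eqI[OF b additive_on_comp[OF e(1)[of UNIV] s(1)] _ _ that])
       (auto simp: additive_on_def s(2) e_def)
  have eE: "e ` E = H" using e(3) es s(3) by (auto simp: image_iff) metis

  define K where "K = {x \<in> E. e x = 0}"
  have KE: "K \<subseteq> E" by (auto simp: K_def)
  have K: "subgrp K"
    using subgrp_preimage[OF e(1) E.subgrp, of "{0}"] by (simp add: K_def subgrp_def)
  have "perm_act p x \<in> K" if "x \<in> K" for x
    using that E.closed equivariant_onD[OF e(2)] additive_on_zero[OF add subgrp] by (auto simp: K_def)
  then interpret K: cyc_module p "perm_act p" K by (rule E.cyc_module_subset[OF KE K])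
  obtain S :: "'x set" and d where d: "zbasis S d K"
    using embedded_in_free_is_free[OF K additive_zlin inj_on_subset[OF zlin_code_inj[OF code] subset_UNIV]]
    by metis

  \<comment> \<open>The Tate cohomology of \<open>K\<close> vanishes.\<close>
  define T where "T = zlin (\<lambda>v. frag_of (Inr v :: ('x \<times> nat) + 'x))"
  have T: "T z \<in> E" "perm_act p (T z) = T z" "e (T z) = zlin c z" if z: "z \<in> fsupp V" for z
  proof -
    show "T z \<in> E" unfolding T_def
      by (rule zlin_closed[OF E.subgrp _ z]) (auto simp: E_def perm_module_def)
    show "perm_act p (T z) = T z"
      by (rule additive_on_fsupp_eqI[OF z])
         (auto simp: T_def perm_act_def rot_def additive_on_def zlin_add)
    show "e (T z) = zlin c z"
      by (rule additive_on_fsupp_eqI[OF z additive_on_comp[OF e(1)[of UNIV]]])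
         (auto simp: T_def additive_zlin e_def)
  qed
  \<comment> \<open>Correct a preimage in \<open>E\<close> by a fixed element and a norm, since \<open>V\<close> spans the invariants of \<open>H\<close>
    modulo norms.\<close>
  have boundary: "\<exists>k\<in>K. z = perm_act p k - k" if z: "z \<in> K" "Nm p (perm_act p) z = 0" for z
  proof -
    obtain w where w: "w \<in> E" "z = perm_act p w - w"
      using perm_module_boundary[OF p_pos, of z J V] z KE unfolding E_def by blast
    have "A (e w) - e w = 0"
      using z(1) w equivariant_onD[OF e(2) w(1)] additive_on_diff[OF e(1) subgrp_UNIV]
      by (simp add: K_def)
    then have "e w \<in> G" using e(3)[OF w(1)] by (simp add: G_def)
    then obtain q where q: "q \<in> fsupp SG" "e w = zlin c q" using c by (auto simp: zbasis_def bij_betw_def)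
    obtain v where v: "v \<in> fsupp V" "q - v \<in> L" using V(2)[OF q(1)] by blast
    then obtain n where n: "n \<in> H" "zlin c (q - v) = Nm p A n" by (auto simp: L_def)
    obtain f where f: "f \<in> E" "e f = n" using n(1) eE by blast
    let ?k = "w - T v - Nm p (perm_act p) f"
    have "e ?k = 0"
      using n(2) f q v T HE.equivariant_Nm[OF e(2,1) f(1)]
      by (simp add: additive_on_diff[OF e(1) subgrp_UNIV] zlin_diff)
    then have "?k \<in> K"
      using w f T[OF v(1)] by (simp add: K_def subgrp_diff[OF E.subgrp] E.Nm_closed)
    moreover have "perm_act p ?k - ?k = z"
      using w f T[OF v(1)]
      by (simp add: additive_on_diff[OF E.add E.subgrp] subgrp_diff[OF E.subgrp] E.Nm_closed E.A_Nm)
    ultimately show ?thesis by metis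
  qed
  \<comment> \<open>The component in the trivial part is divisible by \<open>p\<close>, since \<open>V\<close> is independent modulo norms;
    hence it is a norm in \<open>E\<close>, and the vanishing first cohomology of \<open>H\<close> moves its preimage to \<open>K\<close>.\<close>
  have invariant: "\<exists>k\<in>K. x = Nm p (perm_act p) k" if x: "x \<in> K" "perm_act p x = x" for x
  proof -
    obtain f t where f: "f \<in> E" "t \<in> fsupp V" "x = Nm p (perm_act p) f + T t"
      using perm_module_invariant[OF p_pos, of x J V] x KE unfolding E_def T_def by blast
    have "e x = Nm p A (e f) + zlin c t"
      using f T(3)[OF f(2)] HE.equivariant_Nm[OF e(2,1) f(1)]
      by (simp add: additive_on_add[OF e(1)[of UNIV]])
    then have "zlin c t = Nm p A (- e f)"
      using x(1) e(3)[OF f(1)] by (simp add: K_def additive_on_minus[OF Nm_add subgrp] eq_neg_iff_add_eq_0 add.commute)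
    then have "t \<in> L"
      using f fsupp_mono[OF V(1)] e(3)[OF f(1)] by (auto simp: L_def subgrp_minus[OF subgrp])
    then obtain u where u: "u \<in> fsupp V" "t = int p *\<^sub>z u" using V(3)[OF f(2)] by blast
    let ?y = "f + T u"
    have "T t = Nm p (perm_act p) (T u)"
      using T[OF u(1)] u(2)
      by (simp add: E.Nm_fixed T_def additive_on_zmul[OF additive_zlin subgrp_UNIV UNIV_I])
    then have y: "?y \<in> E" "Nm p (perm_act p) ?y = x"
      using f T[OF u(1)] by (simp_all add: subgrp_add[OF E.subgrp] additive_on_add[OF E.Nm_add])
    then have "Nm p A (e ?y) = 0" using HE.equivariant_Nm[OF e(2,1) y(1)] x(1) by (simp add: K_def)
    then obtain n where n: "n \<in> H" "e ?y = A n - n" using H1[OF e(3)[OF y(1)]] by blast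
    then obtain w where w: "w \<in> E" "e w = n" using eE by blast
    let ?k = "?y - (perm_act p w - w)"
    have "e ?k = 0"
      using n w equivariant_onD[OF e(2) w(1)] by (simp add: additive_on_diff[OF e(1) subgrp_UNIV])
    then have "?k \<in> K" using y(1) w(1) by (simp add: K_def subgrp_diff[OF E.subgrp] E.closed)
    moreover have "Nm p (perm_act p) ?k = x"
      using y w(1) E.Nm_boundary[OF w(1)]
      by (simp add: additive_on_diff[OF E.Nm_add E.subgrp] subgrp_diff[OF E.subgrp] E.closed)
    ultimately show ?thesis by metis
  qed

  obtain \<phi> where \<phi>: "additive_on K \<phi>" "\<And>x. x \<in> K \<Longrightarrow> \<phi> x \<in> K" "\<And>x. x \<in> K \<Longrightarrow> Tr p (perm_act p) (perm_act p) \<phi> x = x"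
  proof (rule K.identity_is_trace[OF p d], goal_cases)
    case (1 x z)
    have "int p *\<^sub>z Nm p (perm_act p) z = Nm p (perm_act p) (perm_act p x - x)"
      using 1(2-) by (simp add: additive_on_zmul[OF K.Nm_add K])
    also have "\<dots> = 0" by (rule K.Nm_boundary[OF 1(2)])
    finally have "Nm p (perm_act p) z = 0"
      using zbasis_torsion_free[OF d K.Nm_closed[OF 1(3)]] p_pos by simp
    then obtain k where k: "k \<in> K" "z = perm_act p k - k" using boundary[OF 1(3)] by blast
    let ?x = "x - int p *\<^sub>z k"
    have "?x \<in> K" using 1(2-) k by (simp add: subgrp_diff_zmul[OF K])
    moreover have "perm_act p ?x = ?x"
      using 1(4) 1(2) k
      by (simp add: additive_on_diff[OF K.add K] additive_on_zmul[OF K.add K] zmul_closed[OF K] zmul_diff_right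
          algebra_simps)
    ultimately obtain y where "y \<in> K" "?x = Nm p (perm_act p) y" using invariant by blast
    then show ?case using k(1) by (intro bexI[of _ y] bexI[of _ k]) (auto simp: algebra_simps)
  next
    case (2 \<phi>)
    from 2(2-) show thesis by (rule 2(1))
  qed

  \<comment> \<open>Hence \<open>K\<close> is a direct summand of \<open>E\<close>, with projection \<open>\<rho>\<close>, and of the free module \<open>P\<close>.\<close>
  interpret KE: cyc_module_pair p "perm_act p" K "perm_act p" E ..
  define r where "r x = x - s (e x)" for x
  have r: "additive_on E r" "\<And>x. x \<in> E \<Longrightarrow> r x \<in> K"
    unfolding r_def
    by (intro additive_on_plus additive_on_comp[OF s(1) e(1,3)])
       (auto simp: additive_on_def K_def es e(3) s(3) additive_on_diff[OF e(1) subgrp_UNIV] subgrp_diff[OF E.subgrp])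
  have r_K: "r x = x" if "x \<in> K" for x
    using that additive_on_zero[OF s(1) subgrp] by (simp add: r_def K_def)
  define \<rho> where "\<rho> = Tr p (perm_act p) (perm_act p) (\<lambda>x. \<phi> (r x))"
  have \<phi>r: "additive_on E (\<lambda>x. \<phi> (r x))" "\<And>x. x \<in> E \<Longrightarrow> \<phi> (r x) \<in> K"
    by (rule additive_on_comp[OF \<phi>(1) r]) (simp_all add: \<phi> r)
  have \<rho>: "additive_on E \<rho>" "\<And>x. x \<in> E \<Longrightarrow> \<rho> x \<in> K" "equivariant_on E (perm_act p) (perm_act p) \<rho>"
    unfolding \<rho>_def using KE.Tr_add[OF \<phi>r] KE.Tr_closed[OF \<phi>r] KE.Tr_equivariant[OF \<phi>r] by auto
  have \<rho>_K: "\<rho> x = x" if "x \<in> K" for x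
    using \<phi>(3)[OF that] K.Tr_cong[of "\<lambda>x. \<phi> (r x)" \<phi> x "perm_act p"] that by (simp add: \<rho>_def r_K)

  define P :: "(('x \<times> nat) + 'x \<Rightarrow>\<^sub>0 int) set" where "P = perm_module p S {}"
  interpret P: cyc_module p "perm_act p" P unfolding P_def by (rule cyc_module_perm_module[OF p_pos])
  interpret PK: cyc_module_pair p "perm_act p" P "perm_act p" K ..
  interpret KP: cyc_module_pair p "perm_act p" K "perm_act p" P ..
  define v where "v = perm_lift (perm_act p) d (\<lambda>_ :: 'x. 0)"
  have v: "additive_on P v" "equivariant_on P (perm_act p) (perm_act p) v" "\<And>x. x \<in> P \<Longrightarrow> v x \<in> K"
    unfolding v_def P_def
    by (rule perm_lift_additive, rule K.perm_lift_equivariant[OF zbasis_mem[OF d]], simp_all)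
       (rule K.perm_lift_closed[OF zbasis_mem[OF d]], simp_all)
  have genP: "frag_of (Inl (j, 0)) \<in> P" if "j \<in> S" for j
    using that p_pos by (auto simp: P_def perm_module_def)
  obtain i where i: "additive_on K i" "\<And>j. j \<in> S \<Longrightarrow> i (d j) = frag_of (Inl (j, 0))" "\<And>x. x \<in> K \<Longrightarrow> i x \<in> P"
    using zbasis_extend[where c = "\<lambda>j. frag_of (Inl (j, 0))", OF d P.subgrp genP] by metis
  have vi: "v (i x) = x" if "x \<in> K" for x
    by (rule zbasis_eqI[OF d additive_on_comp[OF v(1) i(1,3)] _ _ that])
       (auto simp: additive_on_def i(2) v_def)
  define u where "u = Tr p (perm_act p) (perm_act p) (\<lambda>x. i (\<phi> x))"
  have i\<phi>: "additive_on K (\<lambda>x. i (\<phi> x))" "\<And>x. x \<in> K \<Longrightarrow> i (\<phi> x) \<in> P"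
    by (rule additive_on_comp[OF i(1) \<phi>(1,2)]) (simp_all add: \<phi> i)
  have u: "additive_on K u" "\<And>x. x \<in> K \<Longrightarrow> u x \<in> P" "equivariant_on K (perm_act p) (perm_act p) u"
    unfolding u_def using PK.Tr_add[OF i\<phi>] PK.Tr_closed[OF i\<phi>] PK.Tr_equivariant[OF i\<phi>] by auto
  have vu: "v (u x) = x" if x: "x \<in> K" for x
  proof -
    have "v (u x) = Tr p (perm_act p) (perm_act p) (\<lambda>x. v (i (\<phi> x))) x"
      unfolding u_def by (rule KP.Tr_equivariant_left[OF v(2,1)]) (simp add: i \<phi> K.pow_closed x)
    also have "\<dots> = Tr p (perm_act p) (perm_act p) \<phi> x" by (rule K.Tr_cong) (simp_all add: vi \<phi> x)
    finally show ?thesis using \<phi>(3)[OF x] by simp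
  qed
  show thesis
  proof (rule swindle[OF E.cyc_module_axioms P.cyc_module_axioms cyc_module_axioms e(1,2) eE,
        where u = "\<lambda>x. u (\<rho> x)" and v = v], goal_cases)
    case 1 show ?case by (rule additive_on_comp[OF u(1) \<rho>(1,2)])
  next
    case 2 then show ?case
      by (simp add: equivariant_on_def equivariant_onD[OF \<rho>(3)] equivariant_onD[OF u(3)] \<rho>)
  next
    case 3 then show ?case by (simp add: u \<rho>)
  next
    case 4 show ?case by (rule v)
  next
    case 5 show ?case by (rule v)
  next
    case 6 then show ?case using v KE by auto
  next
    case 7 then show ?case using v by (auto simp: K_def)
  next
    case 8 then show ?case by (simp add: \<rho>_K vu K_def)
  next
    case 9 then show ?case by (simp add: \<rho> \<rho>_K vu)
  next
    case (10 \<Omega>)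
    then show ?case using that[of \<Omega> J V S] unfolding E_def P_def by simp
  qed
qed

section \<open>Modules over the group ring\<close>

text \<open>A group of prime order \<open>p\<close> with a chosen generator.\<close>

locale prime_cyclic_group = group G for G :: "('g, 'c) monoid_scheme" (structure) +
  fixes p :: nat and \<alpha> :: 'g
  assumes prime: "Factorial_Ring.prime p" and order_G: "order G = p"
    and gen_in: "\<alpha> \<in> carrier G" and gen: "generate G {\<alpha>} = carrier G"
begin

lemma p_pos: "0 < p"
  using prime by (simp add: prime_gt_0_nat)

lemma finite_G: "finite (carrier G)"
  using order_G p_pos by (metis card_gt_0_iff order_def)

lemma ord_gen: "ord \<alpha> = p"
  using generate_pow_card[OF gen_in] gen order_G by (simp add: order_def)

lemma pow_gen_eq_iff: "\<alpha> [^] (i::nat) = \<alpha> [^] (j::nat) \<longleftrightarrow> i mod p = j mod p"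
proof -
  have "\<alpha> [^] i = \<alpha> [^] j \<longleftrightarrow> int p dvd int j - int i"
    using int_pow_eq[OF gen_in, of "int i" "int j"] by (simp add: int_pow_int ord_gen)
  also have "\<dots> \<longleftrightarrow> i mod p = j mod p"
    by (metis mod_eq_dvd_iff of_nat_eq_iff of_nat_mod)
  finally show ?thesis .
qed

lemma carrier_pow: "x \<in> carrier G \<Longrightarrow> \<exists>i<p. x = \<alpha> [^] (i::nat)"
proof -
  assume "x \<in> carrier G"
  then obtain k :: nat where "x = \<alpha> [^] k"
    using generate_pow_on_finite_carrier[OF finite_G gen_in] gen by auto
  then have "x = \<alpha> [^] (k mod p)" by (simp add: pow_gen_eq_iff)
  then show ?thesis using p_pos mod_less_divisor by blast
qed

lemma comm_group_G: "comm_group G"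
proof (rule group.group_comm_groupI[OF is_group])
  fix x y assume "x \<in> carrier G" "y \<in> carrier G"
  then obtain i j :: nat where "x = \<alpha> [^] i" "y = \<alpha> [^] j" using carrier_pow by blast
  then show "x \<otimes> y = y \<otimes> x" using gen_in by (simp add: nat_pow_mult add.commute)
qed

text \<open>The exponent of a group element with respect to the generator.\<close>

definition dlog :: "'g \<Rightarrow> nat" where
  "dlog x = (LEAST i. \<alpha> [^] i = x)"

lemma dlog: "x \<in> carrier G \<Longrightarrow> \<alpha> [^] dlog x = x" "x \<in> carrier G \<Longrightarrow> dlog x < p"
proof -
  assume "x \<in> carrier G"
  then obtain i :: nat where i: "i < p" "\<alpha> [^] i = x" using carrier_pow by blast
  show "\<alpha> [^] dlog x = x" unfolding dlog_def by (rule LeastI[where P = "\<lambda>i. \<alpha> [^] i = x", OF i(2)])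
  show "dlog x < p" unfolding dlog_def using Least_le[of "\<lambda>i. \<alpha> [^] i = x" i] i by simp
qed

lemma dlog_pow: "dlog (\<alpha> [^] i) = i mod p"
  using dlog[of "\<alpha> [^] i"] gen_in pow_gen_eq_iff[of "dlog (\<alpha> [^] i)" i] by simp

text \<open>The action of the group ring on a module on which the generator acts by \<open>A\<close>.\<close>

definition act :: "('a::ab_group_add \<Rightarrow> 'a) \<Rightarrow> ('g \<Rightarrow>\<^sub>0 int) \<Rightarrow> 'a \<Rightarrow> 'a" where
  "act A r x = zlin (\<lambda>y. (A ^^ dlog y) x) r"

text \<open>
  The module on the subgroup \<open>H\<close> on which the generator acts by \<open>A\<close>.  The record has fields for a
  multiplication and a unit, which play no role.
\<close>

definition op_module :: "('a::ab_group_add \<Rightarrow> 'a) \<Rightarrow> 'a set \<Rightarrow> ('g \<Rightarrow>\<^sub>0 int, 'a) module" where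
  "op_module A H = \<lparr>carrier = H, monoid.mult = (\<lambda>_ _. 0), one = 0, ring.zero = 0, ring.add = (+), smult = act A\<rparr>"

lemma op_module_simps [simp]:
  "carrier (op_module A H) = H" "ring.zero (op_module A H) = 0" "ring.add (op_module A H) = (+)"
  "smult (op_module A H) = act A" "(op_module A H)\<lparr>carrier := S\<rparr> = op_module A S"
  by (simp_all add: op_module_def)

lemma carrier_group_ring: "carrier (group_ring G) = fsupp (carrier G)"
  by (simp add: group_ring_def fsupp_def)

lemma act_add_left: "act A (r + s) x = act A r x + act A s x"
  by (simp add: act_def zlin_add)

lemma act_left: "additive_on Y (\<lambda>r. act A r x)"
  by (simp add: act_def additive_zlin)

lemma add_group_ring: "ring.add (group_ring G) = (+)"
  by (simp add: group_ring_def)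

lemma mult_group_ring:
  "additive_on Y (\<lambda>r. r \<otimes>\<^bsub>group_ring G\<^esub> s)"
  "additive_on Y (\<lambda>s. frag_of x \<otimes>\<^bsub>group_ring G\<^esub> s)"
  "frag_of x \<otimes>\<^bsub>group_ring G\<^esub> frag_of y = frag_of (x \<otimes> y)"
  by (simp_all add: group_ring_def additive_on_def frag_extend_add)

context
  fixes A :: "'a::ab_group_add \<Rightarrow> 'a" and H
  assumes mod: "cyc_module p A H"
begin

interpretation H: cyc_module p A H by (rule mod)

lemma act_gen_pow: "x \<in> H \<Longrightarrow> act A (frag_of (\<alpha> [^] (i::nat))) x = (A ^^ i) x"
  by (simp add: act_def dlog_pow H.pow_mod)

lemma act_closed: "x \<in> H \<Longrightarrow> act A r x \<in> H"
  unfolding act_def by (rule zlin_closed[OF H.subgrp, of UNIV]) (simp_all add: H.pow_closed)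

lemma act_right: "additive_on H (act A r)"
proof (rule additive_onI)
  fix x y assume xy: "x \<in> H" "y \<in> H"
  show "act A r (x + y) = act A r x + act A r y"
  proof (rule additive_on_fsupp_eqI[of r UNIV])
    show "additive_on (fsupp UNIV) (\<lambda>r. act A r (x + y))" by (rule act_left)
    show "additive_on (fsupp UNIV) (\<lambda>r. act A r x + act A r y)"
      by (rule additive_on_plus(1)[OF act_left act_left])
  qed (simp_all add: act_def additive_on_add[OF H.pow_add] xy)
qed

lemma act_mult:
  assumes r: "r \<in> fsupp (carrier G)" and s: "s \<in> fsupp (carrier G)" and x: "x \<in> H"
  shows "act A (r \<otimes>\<^bsub>group_ring G\<^esub> s) x = act A r (act A s x)"
proof (rule additive_on_fsupp_eqI[OF r])
  show "additive_on (fsupp (carrier G)) (\<lambda>r. act A (r \<otimes>\<^bsub>group_ring G\<^esub> s) x)"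
    by (rule additive_on_comp[OF act_left[of UNIV] mult_group_ring(1)]) simp
  show "additive_on (fsupp (carrier G)) (\<lambda>r. act A r (act A s x))" by (rule act_left)
  fix y assume y: "y \<in> carrier G"
  then obtain i :: nat where i: "y = \<alpha> [^] i" using carrier_pow by blast
  show "act A (frag_of y \<otimes>\<^bsub>group_ring G\<^esub> s) x = act A (frag_of y) (act A s x)"
  proof (rule additive_on_fsupp_eqI[OF s])
    show "additive_on (fsupp (carrier G)) (\<lambda>s. act A (frag_of y \<otimes>\<^bsub>group_ring G\<^esub> s) x)"
      by (rule additive_on_comp[OF act_left[of UNIV] mult_group_ring(2)]) simp
    show "additive_on (fsupp (carrier G)) (\<lambda>s. act A (frag_of y) (act A s x))"
      by (rule additive_on_comp[OF act_right act_left act_closed[OF x]])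
    fix z assume "z \<in> carrier G"
    then obtain j :: nat where j: "z = \<alpha> [^] j" using carrier_pow by blast
    show "act A (frag_of y \<otimes>\<^bsub>group_ring G\<^esub> frag_of z) x = act A (frag_of y) (act A (frag_of z) x)"
      by (simp add: mult_group_ring i j nat_pow_mult gen_in act_gen_pow x H.pow_closed funpow_add)
  qed
qed

lemma abelian_group_op_module: "abelian_group (op_module A H)"
proof (rule abelian_groupI)
  fix x assume "x \<in> carrier (op_module A H)"
  then show "\<exists>y\<in>carrier (op_module A H). y \<oplus>\<^bsub>op_module A H\<^esub> x = \<zero>\<^bsub>op_module A H\<^esub>"
    by (intro bexI[of _ "- x"]) (simp_all add: subgrp_minus[OF H.subgrp])
qed (auto simp: H.subgrp subgrp_zero subgrp_add add.assoc add.commute)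

lemma module_op_module: "module (group_ring G) (op_module A H)"
proof (rule moduleI)
  show "cring (group_ring G)" by (rule cring_group_ring[OF comm_group_G])
  show "abelian_group (op_module A H)" by (rule abelian_group_op_module)
  show "\<one>\<^bsub>group_ring G\<^esub> \<odot>\<^bsub>op_module A H\<^esub> x = x" if "x \<in> carrier (op_module A H)" for x
    using act_gen_pow[of x 0] that by (simp add: group_ring_def)
qed (simp_all add: carrier_group_ring act_closed act_mult act_add_left add_group_ring
      additive_on_add[OF act_right])

lemma add_pow_op_module: "x \<in> H \<Longrightarrow> [n] \<cdot>\<^bsub>op_module A H\<^esub> x = (n::int) *\<^sub>z x"
proof -
  assume x: "x \<in> H"
  interpret N: abelian_group "op_module A H" by (rule abelian_group_op_module)
  show ?thesis
  proof (induction n rule: int_induct[where k = 0])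
    case base then show ?case by (simp add: add_pow_def)
  next
    case (step1 i)
    have "[(i + 1)] \<cdot>\<^bsub>op_module A H\<^esub> x = [i] \<cdot>\<^bsub>op_module A H\<^esub> x + x"
      using N.add.int_pow_mult[of x i 1] N.add.int_pow_1[of x] x by simp
    then show ?case using step1 by (simp add: zmul_add_left)
  next
    case (step2 i)
    have "[i] \<cdot>\<^bsub>op_module A H\<^esub> x = [(i - 1)] \<cdot>\<^bsub>op_module A H\<^esub> x + x"
      using N.add.int_pow_mult[of x "i - 1" 1] N.add.int_pow_1[of x] x by simp
    then show ?case using step2 by (simp add: zmul_diff_left algebra_simps)
  qed
qed

lemma int_multiples_op_module: "x \<in> H \<Longrightarrow> int_multiples (op_module A H) x = range (\<lambda>n. n *\<^sub>z x)"
  by (simp add: int_multiples_def add_pow_op_module)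

lemma gfinprod_op_module:
  assumes "\<And>i. i \<in> I \<Longrightarrow> s i \<in> H"
  shows "gfinprod (add_monoid (op_module A H)) s I = (\<Sum>i\<in>{i \<in> I. s i \<noteq> 0}. s i)"
proof -
  interpret N: comm_group "add_monoid (op_module A H)"
    using abelian_group.a_comm_group[OF abelian_group_op_module] .
  have "finprod (add_monoid (op_module A H)) s F = sum s F" if "finite F" "F \<subseteq> I" for F
    using that
  proof (induction F rule: finite_induct)
    case empty
    show ?case using N.finprod_empty by simp
  next
    case (insert x F)
    then show ?case using N.finprod_insert[of F x s] assms by (simp add: Pi_def subset_iff)
  qed
  then show ?thesis unfolding gfinprod_def by auto
qed

end

lemma submodule_op_module:
  assumes mod: "cyc_module p A H" and "S \<subseteq> H" "subgrp S" "\<And>x. x \<in> S \<Longrightarrow> A x \<in> S"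
  shows "submodule S (group_ring G) (op_module A H)"
proof -
  interpret S: cyc_module p A S by (rule cyc_module.cyc_module_subset[OF assms])
  interpret M: module "group_ring G" "op_module A H" by (rule module_op_module[OF mod])
  show ?thesis
    using M.module_incl_imp_submodule[of S] module_op_module[OF S.cyc_module_axioms] assms(2) by simp
qed

end

section \<open>Direct sum decompositions\<close>

lemma zbasis_reindex:
  assumes c: "bij_betw c Y' Y" and b: "zbasis Y b H"
  shows "zbasis Y' (\<lambda>y. b (c y)) H"
proof (rule zbasisI)
  let ?c = "zlin (\<lambda>y. frag_of (c y))" and ?d = "zlin (\<lambda>y. frag_of (inv_into Y' c y))"
  have bc: "zlin (\<lambda>y. b (c y)) z = zlin b (?c z)" for z
    by (rule additive_on_fsupp_eqI[of z UNIV])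
       (simp_all add: additive_zlin additive_on_comp[OF additive_zlin[of UNIV] additive_zlin])
  have c_in: "?c z \<in> fsupp Y" if "z \<in> fsupp Y'" for z
    by (rule zlin_closed[OF subgrp_fsupp _ that]) (use c in \<open>auto simp: bij_betw_def\<close>)
  have d_in: "?d z \<in> fsupp Y'" if "z \<in> fsupp Y" for z
    by (rule zlin_closed[OF subgrp_fsupp _ that])
       (use bij_betwE[OF bij_betw_inv_into[OF c]] in auto)
  have dc: "?d (?c z) = z" if "z \<in> fsupp Y'" for z
    by (rule additive_on_fsupp_eqI[OF that additive_on_comp[OF additive_zlin[of UNIV] additive_zlin]])
       (use bij_betw_inv_into_left[OF c] in \<open>auto simp: additive_on_def\<close>)
  have cd: "?c (?d z) = z" if "z \<in> fsupp Y" for z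
    by (rule additive_on_fsupp_eqI[OF that additive_on_comp[OF additive_zlin[of UNIV] additive_zlin]])
       (use bij_betw_inv_into_right[OF c] in \<open>auto simp: additive_on_def\<close>)
  show "z = 0" if z: "z \<in> fsupp Y'" "zlin (\<lambda>y. b (c y)) z = 0" for z
  proof -
    have "?c z = 0"
      using b z c_in[OF z(1)]
      by (auto simp: bc zbasis_def bij_betw_def additive_on_inj_iff[OF additive_zlin subgrp_fsupp])
    then show ?thesis using dc[OF z(1)] by simp
  qed
  show "y \<in> zlin (\<lambda>y. b (c y)) ` fsupp Y'" if y: "y \<in> H" for y
  proof -
    obtain z where z: "z \<in> fsupp Y" "y = zlin b z"
      using b y by (auto simp: zbasis_def bij_betw_def)
    then have "y = zlin (\<lambda>y. b (c y)) (?d z)" by (simp add: bc cd)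
    then show ?thesis using d_in[OF z(1)] by blast
  qed
  show "b (c y) \<in> H" if "y \<in> Y'" for y
    using zbasis_mem[OF b, of "c y"] c that by (auto simp: bij_betw_def)
qed (rule zbasis_subgrp[OF b])

lemma zbasis_subset:
  assumes "zbasis Y b H" "Y' \<subseteq> Y"
  shows "zbasis Y' b (zlin b ` fsupp Y')" "zlin b ` fsupp Y' \<subseteq> H"
  using assms fsupp_mono[OF assms(2)]
  by (auto simp: zbasis_def bij_betw_def intro: inj_on_subset)

lemma zbasis_inj: "zbasis Y b H \<Longrightarrow> inj_on b Y"
proof (rule inj_onI)
  fix x y assume b: "zbasis Y b H" and xy: "x \<in> Y" "y \<in> Y" "b x = b y"
  have inj: "inj_on (zlin b) (fsupp Y)" using b by (simp add: zbasis_def bij_betw_def)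
  have "frag_of x = frag_of y" by (rule inj_onD[OF inj]) (use xy in auto)
  then show "x = y" using keys_frag_of by (metis singleton_inject)
qed

lemma zbasis_nonzero: "zbasis Y b H \<Longrightarrow> y \<in> Y \<Longrightarrow> b y \<noteq> 0"
proof
  assume b: "zbasis Y b H" "y \<in> Y" "b y = 0"
  have inj: "inj_on (zlin b) (fsupp Y)" using b by (simp add: zbasis_def bij_betw_def)
  have "frag_of y = 0" by (rule inj_onD[OF inj]) (use b in \<open>auto simp: subgrp_zero[OF subgrp_fsupp]\<close>)
  then show False by simp
qed

text \<open>
  A basis consisting of the translates of the \<open>\<xi> j\<close> and of the fixed elements \<open>\<eta> v\<close>.
\<close>

definition translates :: "('a \<Rightarrow> 'a) \<Rightarrow> ('j \<Rightarrow> 'a) \<Rightarrow> ('v \<Rightarrow> 'a) \<Rightarrow> ('j \<times> nat) + 'v \<Rightarrow> 'a" where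
  "translates A \<xi> \<eta> = case_sum (\<lambda>(j, i). (A ^^ i) (\<xi> j)) \<eta>"

definition perm_basis ::
    "nat \<Rightarrow> ('a::ab_group_add \<Rightarrow> 'a) \<Rightarrow> 'a set \<Rightarrow> 'j set \<Rightarrow> 'v set \<Rightarrow> ('j \<Rightarrow> 'a) \<Rightarrow> ('v \<Rightarrow> 'a) \<Rightarrow> bool" where
  "perm_basis p A H J V \<xi> \<eta> \<longleftrightarrow>
     zbasis (J \<times> {..<p} <+> V) (translates A \<xi> \<eta>) H \<and> (\<forall>v\<in>V. A (\<eta> v) = \<eta> v)"

lemma translates_simps [simp]:
  "translates A \<xi> \<eta> (Inl (j, i)) = (A ^^ i) (\<xi> j)" "translates A \<xi> \<eta> (Inr v) = \<eta> v"
  by (simp_all add: translates_def)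

lemma perm_basis_reindex:
  assumes "perm_basis p A H J V \<xi> \<eta>" "bij_betw f J' J" "bij_betw g V' V"
  shows "perm_basis p A H J' V' (\<lambda>j. \<xi> (f j)) (\<lambda>v. \<eta> (g v))"
proof -
  let ?c = "map_sum (map_prod f id) g"
  have "inj_on ?c (J' \<times> {..<p} <+> V')"
  proof (rule inj_onI)
    have f: "inj_on f J'" and g: "inj_on g V'" using assms(2,3) by (auto simp: bij_betw_def)
    fix x y assume "x \<in> J' \<times> {..<p} <+> V'" "y \<in> J' \<times> {..<p} <+> V'" "?c x = ?c y"
    then show "x = y"
      by (cases x; cases y) (auto dest: inj_onD[OF f] inj_onD[OF g])
  qed
  moreover have "?c ` (J' \<times> {..<p} <+> V') = J \<times> {..<p} <+> V"
  proof -
    have "map_prod f id ` (J' \<times> {..<p}) = f ` J' \<times> {..<p}"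
      by (rule map_prod_surj_on) simp_all
    moreover have "?c ` (J' \<times> {..<p} <+> V') = map_prod f id ` (J' \<times> {..<p}) <+> g ` V'"
      by (simp add: Plus_def image_Un image_image)
    ultimately have "?c ` (J' \<times> {..<p} <+> V') = f ` J' \<times> {..<p} <+> g ` V'" by simp
    then show ?thesis using assms(2,3) by (simp add: bij_betw_def)
  qed
  ultimately have "bij_betw ?c (J' \<times> {..<p} <+> V') (J \<times> {..<p} <+> V)" by (simp add: bij_betw_def)
  then have "zbasis (J' \<times> {..<p} <+> V') (\<lambda>y. translates A \<xi> \<eta> (?c y)) H"
    using zbasis_reindex assms(1) unfolding perm_basis_def by blast
  moreover have "(\<lambda>y. translates A \<xi> \<eta> (?c y)) = translates A (\<lambda>j. \<xi> (f j)) (\<lambda>v. \<eta> (g v))"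
    by (auto simp: translates_def fun_eq_iff split: sum.splits)
  ultimately show ?thesis
    using assms(1,3) by (auto simp: perm_basis_def bij_betw_def)
qed

lemma (in cyc_module) perm_basis_of_iso:
  assumes bij: "bij_betw \<Psi> (perm_module p J V) H" and add': "additive_on (perm_module p J V) \<Psi>"
    and equiv: "equivariant_on (perm_module p J V) A (perm_act p) \<Psi>"
  shows "perm_basis p A H J V (\<lambda>j. \<Psi> (frag_of (Inl (j, 0)))) (\<lambda>v. \<Psi> (frag_of (Inr v)))"
proof -
  interpret P: cyc_module p "perm_act p" "perm_module p J V" by (rule cyc_module_perm_module[OF p_pos])
  interpret HP: cyc_module_pair p A H "perm_act p" "perm_module p J V" ..
  let ?b = "translates A (\<lambda>j. \<Psi> (frag_of (Inl (j, 0)))) (\<lambda>v. \<Psi> (frag_of (Inr v)))"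
  have "zlin ?b z = \<Psi> z" if z: "z \<in> perm_module p J V" for z
  proof (rule additive_on_fsupp_eqI[OF z[unfolded perm_module_def] additive_zlin add'[unfolded perm_module_def]])
    fix y assume "y \<in> J \<times> {..<p} <+> V"
    then show "zlin ?b (frag_of y) = \<Psi> (frag_of y)"
    proof (rule PlusE)
      fix ji assume "ji \<in> J \<times> {..<p}" "y = Inl ji"
      then obtain j i where y: "j \<in> J" "i < p" "y = Inl (j, i)" by auto
      then have "frag_of (Inl (j, 0)) \<in> perm_module p J V" by (auto simp: perm_module_def)
      from HP.equivariant_pow[OF equiv this, of i] show ?thesis
        using y p_pos by (simp add: perm_act_pow_Inl)
    qed simp
  qed
  then have "zbasis (J \<times> {..<p} <+> V) ?b H"
    using bij bij_betw_cong[of "perm_module p J V" "zlin ?b" \<Psi> H] by (simp add: zbasis_def perm_module_def)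
  moreover have "A (\<Psi> (frag_of (Inr v))) = \<Psi> (frag_of (Inr v))" if "v \<in> V" for v
    using equivariant_onD[OF equiv, of "frag_of (Inr v)"]
      frag_of_fsupp[of "Inr v" "J \<times> {..<p} <+> V"] that
    by (simp add: perm_module_def perm_act_def rot_def Plus_def)
  ultimately show ?thesis by (simp add: perm_basis_def)
qed

context prime_cyclic_group
begin

text \<open>Submodules \<open>S i\<close> with orthogonal projections \<open>q i\<close> that add up to the identity.\<close>

lemma direct_sum_by_projections:
  assumes mod: "cyc_module p A H"
    and S: "\<And>i. i \<in> I \<Longrightarrow> S i \<subseteq> H" "\<And>i. i \<in> I \<Longrightarrow> subgrp (S i)" "\<And>i x. i \<in> I \<Longrightarrow> x \<in> S i \<Longrightarrow> A x \<in> S i"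
    and q: "\<And>i. i \<in> I \<Longrightarrow> additive_on H (q i)" "\<And>i x. i \<in> I \<Longrightarrow> x \<in> H \<Longrightarrow> q i x \<in> S i"
      "\<And>i j x. i \<in> I \<Longrightarrow> j \<in> I \<Longrightarrow> x \<in> S j \<Longrightarrow> q i x = (if i = j then x else 0)"
      "\<And>x. x \<in> H \<Longrightarrow> \<exists>F. finite F \<and> F \<subseteq> I \<and> x = (\<Sum>i\<in>F. q i x)"
  shows "internal_direct_sum (group_ring G) (op_module A H) I S"
proof -
  interpret H: cyc_module p A H by (rule mod)
  let ?D = "sum_group I (\<lambda>i. add_monoid (op_module A (S i)))"
  let ?g = "\<lambda>s. gfinprod (add_monoid (op_module A H)) s I"
  have group: "group (add_monoid (op_module A (S i)))" if "i \<in> I" for i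
    using abelian_group.a_group[OF abelian_group_op_module[OF H.cyc_module_subset[OF S[OF that]]]] .
  have D: "carrier ?D = {s \<in> \<Pi>\<^sub>E i\<in>I. S i. finite {i \<in> I. s i \<noteq> 0}}"
    using carrier_sum_group[of I "\<lambda>i. add_monoid (op_module A (S i))", OF group] by simp
  have g: "?g s = (\<Sum>i\<in>{i \<in> I. s i \<noteq> 0}. s i)" if "s \<in> carrier ?D" for s
    using that S(1) unfolding D by (intro gfinprod_op_module[OF mod]) auto
  have g': "?g s = (\<Sum>i\<in>F. s i)"
    if "s \<in> carrier ?D" "finite F" "F \<subseteq> I" "{i \<in> I. s i \<noteq> 0} \<subseteq> F" for s F
    unfolding g[OF that(1)] using that by (intro sum.mono_neutral_left) auto
  have g_in: "?g s \<in> H" if "s \<in> carrier ?D" for s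
    unfolding g[OF that] using that S(1) unfolding D by (intro subgrp_sum[OF H.subgrp]) auto
  have q_g: "q j (?g s) = s j" if s: "s \<in> carrier ?D" and j: "j \<in> I" for s j
  proof -
    have s_in: "s i \<in> S i" if "i \<in> I" for i using s that unfolding D by auto
    have fin: "finite {i \<in> I. s i \<noteq> 0}" using s unfolding D by simp
    have "q j (?g s) = (\<Sum>i\<in>{i \<in> I. s i \<noteq> 0}. q j (s i))"
      unfolding g[OF s] by (rule additive_on_sum[OF q(1)[OF j] H.subgrp]) (use s_in S(1) in auto)
    also have "\<dots> = (\<Sum>i\<in>{i \<in> I. s i \<noteq> 0}. if j = i then s j else 0)"
      by (intro sum.cong refl) (auto simp: q(3)[OF j _ s_in])
    also have "\<dots> = s j" using fin j by (simp add: sum.delta)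
    finally show ?thesis .
  qed
  have "?g \<in> iso ?D (add_monoid (op_module A H))"
  proof (rule isoI)
    show "?g \<in> hom ?D (add_monoid (op_module A H))"
    proof (rule homI)
      show "?g s \<in> carrier (add_monoid (op_module A H))" if "s \<in> carrier ?D" for s
        using g_in[OF that] by simp
      fix s t assume st: "s \<in> carrier ?D" "t \<in> carrier ?D"
      let ?u = "s \<otimes>\<^bsub>?D\<^esub> t" and ?F = "{i \<in> I. s i \<noteq> 0} \<union> {i \<in> I. t i \<noteq> 0}"
      have u: "?u = (\<lambda>i\<in>I. s i + t i)" by simp
      have F: "finite ?F" "?F \<subseteq> I" using st unfolding D by auto
      have "{i \<in> I. ?u i \<noteq> 0} \<subseteq> ?F" by (auto simp: u)
      moreover have "?u \<in> carrier ?D"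
        by (rule monoid.m_closed[OF group.is_monoid[OF sum_group[OF group]] st])
      ultimately have "?g ?u = (\<Sum>i\<in>?F. ?u i)" using g' F by blast
      also have "\<dots> = (\<Sum>i\<in>?F. s i) + (\<Sum>i\<in>?F. t i)"
        unfolding sum.distrib[symmetric] using F(2) by (intro sum.cong) (auto simp: u)
      also have "(\<Sum>i\<in>?F. s i) = ?g s" by (rule g'[OF st(1) F, symmetric]) blast
      also have "(\<Sum>i\<in>?F. t i) = ?g t" by (rule g'[OF st(2) F, symmetric]) blast
      finally show "?g ?u = ?g s \<otimes>\<^bsub>add_monoid (op_module A H)\<^esub> ?g t"
        by (simp only: monoid.simps op_module_simps)
    qed
    have "inj_on ?g (carrier ?D)"
    proof (rule inj_onI)
      fix s t assume st: "s \<in> carrier ?D" "t \<in> carrier ?D" "?g s = ?g t"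
      then have "s j = t j" if "j \<in> I" for j
        using q_g[OF st(1) that] q_g[OF st(2) that] by simp
      then show "s = t" using st unfolding D by (auto intro: PiE_ext)
    qed
    moreover have "?g ` carrier ?D = H"
    proof
      show "?g ` carrier ?D \<subseteq> H" using g_in by blast
      show "H \<subseteq> ?g ` carrier ?D"
      proof
        fix x assume x: "x \<in> H"
        then obtain F where F: "finite F" "F \<subseteq> I" "x = (\<Sum>i\<in>F. q i x)" using q(4) by blast
        let ?s = "\<lambda>i\<in>I. q i x"
        have "q j x = 0" if j: "j \<in> I" "j \<notin> F" for j
        proof -
          have "q j x = (\<Sum>i\<in>F. q j (q i x))"
            using q(2)[OF _ x] S(1) F(2)
            by (subst F(3), subst additive_on_sum[OF q(1)[OF j(1)] H.subgrp]) blast+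
          also have "\<dots> = 0"
            using q(3)[OF j(1) _ q(2)[OF _ x]] F(2) j(2) by (intro sum.neutral) auto
          finally show ?thesis .
        qed
        then have sub: "{i \<in> I. ?s i \<noteq> 0} \<subseteq> F" by auto
        then have s: "?s \<in> carrier ?D"
          using q(2)[OF _ x] finite_subset[OF sub F(1)] unfolding D by simp
        have "?g ?s = (\<Sum>i\<in>F. ?s i)" by (rule g'[OF s F(1,2) sub])
        also have "\<dots> = (\<Sum>i\<in>F. q i x)" using F(2) by (intro sum.cong) auto
        also have "\<dots> = x" by (rule F(3)[symmetric])
        finally show "x \<in> ?g ` carrier ?D" by (intro image_eqI[OF sym s])
      qed
    qed
    ultimately show "bij_betw ?g (carrier ?D) (carrier (add_monoid (op_module A H)))"
      by (simp add: bij_betw_def)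
  qed
  then show ?thesis
    unfolding internal_direct_sum_def using submodule_op_module[OF mod S] by simp
qed

text \<open>A partition of a basis into the fibres of a map \<open>\<kappa>\<close> decomposes the module.\<close>

lemma direct_sum_by_basis:
  assumes mod: "cyc_module p A H" and b: "zbasis Y b H"
    and \<kappa>: "\<And>y. y \<in> Y \<Longrightarrow> \<kappa> y \<in> I"
    and S: "\<And>i. i \<in> I \<Longrightarrow> S i = zlin b ` fsupp {y \<in> Y. \<kappa> y = i}"
    and closed: "\<And>i x. i \<in> I \<Longrightarrow> x \<in> S i \<Longrightarrow> A x \<in> S i"
  shows "internal_direct_sum (group_ring G) (op_module A H) I S"
proof -
  have S_sub: "S i \<subseteq> H" "subgrp (S i)" if "i \<in> I" for i
    unfolding S[OF that] using zbasis_subset[OF b, of "{y \<in> Y. \<kappa> y = i}"]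
    by (auto intro: subgrp_image additive_zlin subgrp_fsupp)
  have b_S: "b y \<in> S (\<kappa> y)" if "y \<in> Y" for y
    unfolding S[OF \<kappa>[OF that]] using that by (intro image_eqI[of _ _ "frag_of y"]) auto
  have "\<exists>q. additive_on H q \<and> (\<forall>y\<in>Y. q (b y) = (if \<kappa> y = i then b y else 0)) \<and> (\<forall>x\<in>H. q x \<in> S i)"
    if i: "i \<in> I" for i
  proof -
    have "(if \<kappa> y = i then b y else 0) \<in> S i" if "y \<in> Y" for y
      using b_S[OF that] subgrp_zero[OF S_sub(2)[OF i]] by auto
    from zbasis_extend[where c = "\<lambda>y. if \<kappa> y = i then b y else 0", OF b S_sub(2)[OF i] this]
    show ?thesis by metis
  qed
  then obtain q where q: "\<And>i. i \<in> I \<Longrightarrow> additive_on H (q i)"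
      "\<And>i y. i \<in> I \<Longrightarrow> y \<in> Y \<Longrightarrow> q i (b y) = (if \<kappa> y = i then b y else 0)"
      "\<And>i x. i \<in> I \<Longrightarrow> x \<in> H \<Longrightarrow> q i x \<in> S i"
    by metis
  have zlin_H: "zlin b z \<in> H" if "z \<in> fsupp Y" for z
    using b that by (auto simp: zbasis_def bij_betw_def)
  show ?thesis
  proof (rule direct_sum_by_projections[OF mod S_sub closed q(1,3)])
    fix i j x assume ij: "i \<in> I" "j \<in> I" and x: "x \<in> S j"
    then obtain z where z: "z \<in> fsupp {y \<in> Y. \<kappa> y = j}" "x = zlin b z" using S by blast
    have in_H: "zlin b w \<in> H" if "w \<in> fsupp {y \<in> Y. \<kappa> y = j}" for w
      using that zlin_H fsupp_mono[of "{y \<in> Y. \<kappa> y = j}" Y] by blast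
    have "q i (zlin b z) = (if i = j then zlin b z else 0)"
    proof (rule additive_on_fsupp_eqI[OF z(1) additive_on_comp[OF q(1)[OF ij(1)] additive_zlin in_H]])
    qed (use ij in \<open>auto simp: additive_on_def zlin_add q(2)\<close>)
    then show "q i x = (if i = j then x else 0)" using z(2) by simp
  next
    fix x assume "x \<in> H"
    then obtain z where z: "z \<in> fsupp Y" "x = zlin b z" using b by (auto simp: zbasis_def bij_betw_def)
    define K F where "K = Poly_Mapping.keys z" and "F = \<kappa> ` K"
    have K: "K \<subseteq> Y" using z(1) by (simp add: fsupp_def K_def)
    then have F: "finite F" "F \<subseteq> I" using \<kappa> by (auto simp: F_def K_def)
    have "zlin b z = (\<Sum>i\<in>F. q i (zlin b z))"
    proof (rule additive_on_fsupp_eqI[of z K])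
      show "additive_on (fsupp K) (\<lambda>z. \<Sum>i\<in>F. q i (zlin b z))"
        using F(2) fsupp_mono[OF K] zlin_H
        by (intro additive_on_SUM additive_on_comp[OF q(1) additive_zlin]) auto
      fix y assume y: "y \<in> K"
      then have "(\<Sum>i\<in>F. q i (b y)) = (\<Sum>i\<in>F. if \<kappa> y = i then b y else 0)"
        using F(2) K by (intro sum.cong refl q(2)) auto
      also have "\<dots> = b y" using F(1) y by (simp add: F_def sum.delta)
      finally show "zlin b (frag_of y) = (\<Sum>i\<in>F. q i (zlin b (frag_of y)))" by simp
    qed (simp_all add: fsupp_def K_def additive_zlin)
    then show "\<exists>F. finite F \<and> F \<subseteq> I \<and> x = (\<Sum>i\<in>F. q i x)"
      using F z(2) by blast
  qed
qed

text \<open>The basis itself, rather than its index set, serves as set of generators of the required type.\<close>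

lemma free_abelian_op_module:
  assumes "zbasis Y b H"
  shows "free_abelian (add_monoid (op_module A H))"
proof -
  let ?T = "b ` Y"
  have "bij_betw b Y ?T" using zbasis_inj[OF assms] by (simp add: bij_betw_def)
  then have "bij_betw (inv_into Y b) ?T Y" by (rule bij_betw_inv_into)
  then have "zbasis ?T (\<lambda>y. b (inv_into Y b y)) H" by (rule zbasis_reindex[OF _ assms])
  then have "zlin (\<lambda>y. b (inv_into Y b y)) \<in> iso (free_Abelian_group ?T) (add_monoid (op_module A H))"
    by (auto simp: iso_def hom_def zlin_add free_Abelian_group_def zbasis_def fsupp_def bij_betw_def)
  then have "free_Abelian_group ?T \<cong> add_monoid (op_module A H)" by (rule is_isoI)
  then show ?thesis
    unfolding free_abelian_def by (meson group.iso_sym group_free_Abelian_group)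
qed

context
  fixes A :: "'a::ab_group_add \<Rightarrow> 'a" and H J V and \<xi> :: "'j \<Rightarrow> 'a" and \<eta> :: "'v \<Rightarrow> 'a"
  assumes mod: "cyc_module p A H" and pb: "perm_basis p A H J V \<xi> \<eta>"
begin

interpretation H: cyc_module p A H by (rule mod)

lemma perm_basis_zbasis: "zbasis (J \<times> {..<p} <+> V) (translates A \<xi> \<eta>) H"
  and perm_basis_fixed: "v \<in> V \<Longrightarrow> A (\<eta> v) = \<eta> v"
  using pb by (auto simp: perm_basis_def)

lemma perm_basis_in: "j \<in> J \<Longrightarrow> \<xi> j \<in> H" "v \<in> V \<Longrightarrow> \<eta> v \<in> H"
  using zbasis_mem[OF perm_basis_zbasis, of "Inl (j, 0)"] zbasis_mem[OF perm_basis_zbasis, of "Inr v"] p_pos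
  by auto

lemma perm_basis_closed:
  assumes Y: "Y \<subseteq> J \<times> {..<p} <+> V" "rot p ` Y \<subseteq> Y"
    and x: "x \<in> zlin (translates A \<xi> \<eta>) ` fsupp Y"
  shows "A x \<in> zlin (translates A \<xi> \<eta>) ` fsupp Y"
proof -
  let ?b = "translates A \<xi> \<eta>"
  obtain z where z: "z \<in> fsupp Y" "x = zlin ?b z" using x by blast
  have "A (zlin ?b z) = zlin ?b (perm_act p z)"
  proof (rule additive_on_fsupp_eqI[OF z(1) additive_on_comp[OF H.add additive_zlin]])
    show "zlin ?b w \<in> H" if "w \<in> fsupp Y" for w
      using that fsupp_mono[OF Y(1)] perm_basis_zbasis by (auto simp: zbasis_def bij_betw_def)
    show "additive_on (fsupp Y) (\<lambda>z. zlin ?b (perm_act p z))"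
      unfolding perm_act_def by (rule additive_on_comp[OF additive_zlin[of UNIV] additive_zlin]) simp
    fix y assume "y \<in> Y"
    then have "y \<in> J \<times> {..<p} <+> V" using Y(1) by blast
    then show "A (zlin ?b (frag_of y)) = zlin ?b (perm_act p (frag_of y))"
      using H.pow_mod[OF perm_basis_in(1), of _ "Suc i" for i] by (auto simp: perm_act_def rot_def perm_basis_fixed)
  qed
  moreover have "perm_act p z \<in> fsupp Y"
    unfolding perm_act_def by (rule zlin_closed[OF subgrp_fsupp _ z(1)]) (use Y(2) in auto)
  ultimately show ?thesis using z(2) by blast
qed

lemma cyclic_submodule_op_module:
  assumes j: "j \<in> J"
  shows "cyclic_submodule (group_ring G) (op_module A K) (\<xi> j)
    = zlin (translates A \<xi> \<eta>) ` fsupp (Inl ` ({j} \<times> {..<p}))" (is "?C = zlin ?b ` fsupp ?Y")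
proof
  have I: "subgrp (zlin ?b ` fsupp ?Y)" by (rule subgrp_image[OF additive_zlin subgrp_fsupp])
  have C: "?C = (\<lambda>r. act A r (\<xi> j)) ` fsupp (carrier G)"
    by (simp add: cyclic_submodule_def carrier_group_ring)
  show "?C \<subseteq> zlin ?b ` fsupp ?Y"
  proof
    fix x assume "x \<in> ?C"
    then obtain r where r: "x = act A r (\<xi> j)" unfolding C by blast
    show "x \<in> zlin ?b ` fsupp ?Y" unfolding r act_def
    proof (rule zlin_closed[OF I, of UNIV])
      fix y
      have "zlin ?b (frag_of (Inl (j, dlog y mod p))) \<in> zlin ?b ` fsupp ?Y"
        using p_pos by (intro imageI) auto
      then show "(A ^^ dlog y) (\<xi> j) \<in> zlin ?b ` fsupp ?Y" by (simp add: H.pow_mod[OF perm_basis_in(1)[OF j]])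
    qed simp
  qed
  have C_sub: "subgrp ?C" unfolding C by (rule subgrp_image[OF act_left subgrp_fsupp])
  show "zlin ?b ` fsupp ?Y \<subseteq> ?C"
  proof
    fix x assume "x \<in> zlin ?b ` fsupp ?Y"
    then obtain z where z: "z \<in> fsupp ?Y" "x = zlin ?b z" by blast
    show "x \<in> ?C" unfolding z(2)
    proof (rule zlin_closed[OF C_sub _ z(1)])
      fix y assume "y \<in> ?Y"
      then obtain i where "y = Inl (j, i)" by auto
      then have "?b y = act A (frag_of (\<alpha> [^] i)) (\<xi> j)"
        by (simp add: act_gen_pow[OF mod perm_basis_in(1)[OF j]])
      then show "?b y \<in> ?C" unfolding C using gen_in by auto
    qed
  qed
qed

lemma free_generator_op_module:
  assumes j: "j \<in> J"
  shows "free_generator (group_ring G) (op_module A H) (\<xi> j)"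
proof -
  let ?b = "translates A \<xi> \<eta>"
  let ?d = "zlin (\<lambda>y. frag_of (Inl (j, dlog y) :: ('j \<times> nat) + 'v))"
    and ?e = "zlin (case_sum (\<lambda>(j, i). frag_of (\<alpha> [^] i)) (\<lambda>_. 0))"
  have "r = 0" if r: "r \<in> fsupp (carrier G)" "act A r (\<xi> j) = 0" for r
  proof -
    have "act A r (\<xi> j) = zlin ?b (?d r)"
      by (rule additive_on_fsupp_eqI[OF r(1) act_left additive_on_comp[OF additive_zlin[of UNIV] additive_zlin]])
         (simp_all add: act_def)
    moreover have "?d r \<in> fsupp (J \<times> {..<p} <+> V)"
      by (rule zlin_closed[OF subgrp_fsupp _ r(1)]) (use j dlog(2) in auto)
    ultimately have "?d r = 0"
      using perm_basis_zbasis r(2)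
      by (auto simp: zbasis_def bij_betw_def additive_on_inj_iff[OF additive_zlin subgrp_fsupp])
    moreover have "?e (?d r) = r"
      by (rule additive_on_fsupp_eqI[OF r(1) additive_on_comp[OF additive_zlin[of UNIV] additive_zlin]])
         (simp_all add: additive_on_def dlog)
    ultimately show ?thesis by simp
  qed
  then show ?thesis
    unfolding free_generator_def
    by (simp add: perm_basis_in(1)[OF j] carrier_group_ring additive_on_inj_iff[OF act_left subgrp_fsupp])
qed

lemma trivial_generator_op_module:
  assumes v: "v \<in> V"
  shows "inj (\<lambda>n::int. [n] \<cdot>\<^bsub>op_module A H\<^esub> \<eta> v)"
    "int_multiples (op_module A H) (\<eta> v) = zlin (translates A \<xi> \<eta>) ` fsupp {Inr v}"
    "trivial_module \<alpha> (op_module A (int_multiples (op_module A H) (\<eta> v)))"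
proof -
  have \<eta>: "\<eta> v \<in> H" "\<eta> v \<noteq> 0"
    using perm_basis_in(2)[OF v] zbasis_nonzero[OF perm_basis_zbasis, of "Inr v"] v by auto
  have IM: "int_multiples (op_module A H) (\<eta> v) = range (\<lambda>n. n *\<^sub>z \<eta> v)"
    by (rule int_multiples_op_module[OF mod \<eta>(1)])
  show "inj (\<lambda>n::int. [n] \<cdot>\<^bsub>op_module A H\<^esub> \<eta> v)"
  proof (rule injI)
    fix m n :: int assume "[m] \<cdot>\<^bsub>op_module A H\<^esub> \<eta> v = [n] \<cdot>\<^bsub>op_module A H\<^esub> \<eta> v"
    then have "(m - n) *\<^sub>z \<eta> v = 0" by (simp add: add_pow_op_module[OF mod \<eta>(1)] zmul_diff_left)
    then show "m = n" using zbasis_torsion_free[OF perm_basis_zbasis \<eta>(1), of "m - n"] \<eta>(2) by auto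
  qed
  show "int_multiples (op_module A H) (\<eta> v) = zlin (translates A \<xi> \<eta>) ` fsupp {Inr v}"
  proof
    have "n *\<^sub>z \<eta> v = zlin (translates A \<xi> \<eta>) (n *\<^sub>z frag_of (Inr v))" for n
      by (simp add: additive_on_zmul[OF additive_zlin[of UNIV] subgrp_UNIV])
    then show "int_multiples (op_module A H) (\<eta> v) \<subseteq> zlin (translates A \<xi> \<eta>) ` fsupp {Inr v}"
      unfolding IM using zmul_closed[OF subgrp_fsupp, of "frag_of (Inr v)" "{Inr v}"] by auto
    have "zlin (translates A \<xi> \<eta>) z = Poly_Mapping.lookup z (Inr v) *\<^sub>z \<eta> v" if "z \<in> fsupp {Inr v}" for z
      using zlin_superset[of "{Inr v}" z "translates A \<xi> \<eta>"] that by (simp add: fsupp_def)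
    then show "zlin (translates A \<xi> \<eta>) ` fsupp {Inr v} \<subseteq> int_multiples (op_module A H) (\<eta> v)"
      unfolding IM by auto
  qed
  have "act A (frag_of \<alpha>) (n *\<^sub>z \<eta> v) = n *\<^sub>z \<eta> v" for n
    using act_gen_pow[OF mod zmul_closed[OF H.subgrp \<eta>(1)], of 1 n] gen_in
    by (simp add: additive_on_zmul[OF H.add H.subgrp \<eta>(1)] perm_basis_fixed[OF v])
  then show "trivial_module \<alpha> (op_module A (int_multiples (op_module A H) (\<eta> v)))"
    unfolding trivial_module_def IM by auto
qed

lemma direct_sum_op_module:
  "internal_direct_sum (group_ring G) (op_module A H) (J <+> V)
     (case_sum (\<lambda>j. cyclic_submodule (group_ring G) (op_module A H) (\<xi> j)) (\<lambda>v. int_multiples (op_module A H) (\<eta> v)))"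
    (is "internal_direct_sum _ _ _ ?S")
proof -
  let ?\<kappa> = "case_sum (\<lambda>(j, i). Inl j) Inr"
  let ?Y = "\<lambda>i. {y \<in> J \<times> {..<p} <+> V. ?\<kappa> y = i}"
  have Y: "?Y (Inl j) = Inl ` ({j} \<times> {..<p})" if "j \<in> J" for j using that by auto
  have Y': "?Y (Inr v) = {Inr v}" if "v \<in> V" for v using that by auto
  have S: "?S i = zlin (translates A \<xi> \<eta>) ` fsupp (?Y i)" if "i \<in> J <+> V" for i
    using that
  proof (rule PlusE)
    fix j assume "j \<in> J" "i = Inl j"
    then show ?thesis by (simp only: Y sum.case cyclic_submodule_op_module)
  next
    fix v assume "v \<in> V" "i = Inr v"
    then show ?thesis by (simp only: Y' sum.case trivial_generator_op_module)
  qed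
  show ?thesis
  proof (rule direct_sum_by_basis[OF mod perm_basis_zbasis, where \<kappa> = ?\<kappa>])
    fix i x assume i: "i \<in> J <+> V" and x: "x \<in> ?S i"
    have "rot p ` ?Y i \<subseteq> ?Y i" using p_pos by (auto simp: rot_def)
    then show "A x \<in> ?S i" using perm_basis_closed[of "?Y i" x] x unfolding S[OF i] by blast
  qed (use S in auto)
qed

lemma free_module_op_module:
  assumes "V = {}"
  shows "free_module (group_ring G) (op_module A H)"
  unfolding free_module_def
proof (intro exI[of _ "\<xi> ` J"] conjI ballI)
  show "free_generator (group_ring G) (op_module A H) b" if "b \<in> \<xi> ` J" for b
    using that free_generator_op_module by blast
  let ?\<kappa> = "case_sum (\<lambda>(j, i). \<xi> j) (\<lambda>_. 0)"
  let ?Y = "\<lambda>i. {y \<in> J \<times> {..<p} <+> V. ?\<kappa> y = i}"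
  let ?S = "cyclic_submodule (group_ring G) (op_module A H)"
  have inj: "j = j'" if "\<xi> j = \<xi> j'" "j \<in> J" "j' \<in> J" for j j'
    using inj_onD[OF zbasis_inj[OF perm_basis_zbasis], of "Inl (j, 0)" "Inl (j', 0)"] that p_pos by auto
  have Y: "?Y (\<xi> j) = Inl ` ({j} \<times> {..<p})" if "j \<in> J" for j
    using that inj assms by auto
  have S: "?S i = zlin (translates A \<xi> \<eta>) ` fsupp (?Y i)" if i: "i \<in> \<xi> ` J" for i
  proof -
    obtain j where "j \<in> J" "i = \<xi> j" using i by blast
    then show ?thesis by (simp only: Y cyclic_submodule_op_module)
  qed
  show "internal_direct_sum (group_ring G) (op_module A H) (\<xi> ` J) ?S"
  proof (rule direct_sum_by_basis[OF mod perm_basis_zbasis, where \<kappa> = ?\<kappa>])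
    fix i x assume i: "i \<in> \<xi> ` J" and x: "x \<in> ?S i"
    have "rot p ` ?Y i \<subseteq> ?Y i" using p_pos by (auto simp: rot_def)
    then show "A x \<in> ?S i" using perm_basis_closed[of "?Y i" x] x unfolding S[OF i] by blast
  qed (use S assms in auto)
qed

end

lemma free_plus_trivial_op_module:
  assumes mod: "cyc_module p A H" and pb: "perm_basis p A H J V \<xi> \<eta>"
  shows "free_plus_trivial G \<alpha> (op_module A H)"
proof -
  interpret H: cyc_module p A H by (rule mod)
  let ?b = "translates A \<xi> \<eta>"
  let ?YF = "J \<times> {..<p} <+> {}" and ?YT = "{} <+> V"
  let ?F = "zlin ?b ` fsupp ?YF" and ?T = "zlin ?b ` fsupp ?YT"
  let ?\<kappa> = "case_sum (\<lambda>_. True) (\<lambda>_. False)"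
  note b = perm_basis_zbasis[OF mod pb]
  have YF: "?YF \<subseteq> J \<times> {..<p} <+> V" "rot p ` ?YF \<subseteq> ?YF" using p_pos by (auto simp: rot_def)
  have YT: "?YT \<subseteq> J \<times> {..<p} <+> V" "rot p ` ?YT \<subseteq> ?YT" by (auto simp: rot_def)
  have "internal_direct_sum (group_ring G) (op_module A H) UNIV (\<lambda>b. if b then ?F else ?T)"
  proof (rule direct_sum_by_basis[OF mod b, where \<kappa> = ?\<kappa>])
    have "{y \<in> J \<times> {..<p} <+> V. ?\<kappa> y = True} = ?YF" "{y \<in> J \<times> {..<p} <+> V. ?\<kappa> y = False} = ?YT"
      by auto
    then show "(if i then ?F else ?T) = zlin ?b ` fsupp {y \<in> J \<times> {..<p} <+> V. ?\<kappa> y = i}" for i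
      by (cases i) simp_all
    show "A x \<in> (if i then ?F else ?T)" if "x \<in> (if i then ?F else ?T)" for i x
      using that perm_basis_closed[OF mod pb YF] perm_basis_closed[OF mod pb YT] by (cases i) auto
  qed simp
  moreover have "free_module (group_ring G) (op_module A ?F)"
  proof -
    have "cyc_module p A ?F"
      by (rule H.cyc_module_subset[OF zbasis_subset(2)[OF b YF(1)] subgrp_image[OF additive_zlin subgrp_fsupp]
            perm_basis_closed[OF mod pb YF]])
    moreover have "perm_basis p A ?F J {} \<xi> \<eta>"
      using zbasis_subset(1)[OF b YF(1)] by (simp add: perm_basis_def)
    ultimately show ?thesis by (rule free_module_op_module) simp
  qed
  moreover have "trivial_module \<alpha> (op_module A ?T)"
    unfolding trivial_module_def
  proof
    fix x assume "x \<in> carrier (op_module A ?T)"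
    then obtain z where z: "z \<in> fsupp ?YT" "x = zlin ?b z" by auto
    have in_H: "zlin ?b w \<in> H" if "w \<in> fsupp ?YT" for w
      using zbasis_subset(2)[OF b YT(1)] that by blast
    have "A (zlin ?b z) = zlin ?b z"
      by (rule additive_on_fsupp_eqI[OF z(1) additive_on_comp[OF H.add additive_zlin in_H] additive_zlin])
         (use perm_basis_fixed[OF mod pb] in auto)
    then show "frag_of \<alpha> \<odot>\<^bsub>op_module A ?T\<^esub> x = x"
      using act_gen_pow[OF mod in_H[OF z(1)], of 1] gen_in z(2) by simp
  qed
  ultimately show ?thesis unfolding free_plus_trivial_def op_module_simps
    by (intro exI[of _ ?F] exI[of _ ?T] conjI)
qed

end

section \<open>The resolution\<close>

text \<open>Transport of the action along an embedding of abelian groups.\<close>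

lemma (in cyc_module) transport:
  assumes f: "additive_on H f" "inj_on f H"
  defines "B \<equiv> \<lambda>y. f (A (inv_into H f y))"
  shows "cyc_module p B (f ` H)" "equivariant_on H B A f"
proof -
  have B: "B (f x) = f (A x)" if "x \<in> H" for x using that f(2) by (simp add: B_def)
  then show equiv: "equivariant_on H B A f" by (simp add: equivariant_on_def)
  have pow: "(B ^^ i) (f x) = f ((A ^^ i) x)" if "x \<in> H" for x i
    using that by (induction i) (simp_all add: B pow_closed)
  show "cyc_module p B (f ` H)"
  proof
    show "additive_on (f ` H) B"
    proof (rule additive_onI)
      fix x y assume "x \<in> f ` H" "y \<in> f ` H"
      then obtain x' y' where "x' \<in> H" "y' \<in> H" "x = f x'" "y = f y'" by blast
      then show "B (x + y) = B x + B y"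
        by (simp add: B additive_on_add[OF f(1), symmetric] subgrp_add[OF subgrp] closed
            additive_on_add[OF add])
    qed
  qed (auto simp: p_pos subgrp_image[OF f(1) subgrp] B closed pow order)
qed

lemma equivariant_on_comp:
  assumes "equivariant_on K B C f" "equivariant_on H C D g" "\<And>x. x \<in> H \<Longrightarrow> g x \<in> K"
  shows "equivariant_on H B D (\<lambda>x. f (g x))"
  using assms by (simp add: equivariant_on_def)

theorem theorem1p3:
  fixes p :: nat
    and G :: "('g, 'c) monoid_scheme"
    and \<alpha> :: 'g
    and M :: "('g \<Rightarrow>\<^sub>0 int, 'm, 'd) module_scheme"
  assumes "Factorial_Ring.prime p"
    and "group G" and "order G = p"
    and "\<alpha> \<in> carrier G" and "generate G {\<alpha>} = carrier G"
    and "module (group_ring G) M"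
  shows "\<exists>(N\<^sub>1 :: ('g \<Rightarrow>\<^sub>0 int, ('g, 'm) resolution_elem) module)
          (N\<^sub>2 :: ('g \<Rightarrow>\<^sub>0 int, ('g, 'm) resolution_elem) module) f g.
      module (group_ring G) N\<^sub>1 \<and> module (group_ring G) N\<^sub>2 \<and>
      module_short_exact (group_ring G) N\<^sub>1 N\<^sub>2 M f g \<and>
      free_abelian (add_monoid N\<^sub>1) \<and> free_abelian (add_monoid N\<^sub>2) \<and>
      free_plus_trivial G \<alpha> N\<^sub>1 \<and> free_plus_trivial G \<alpha> N\<^sub>2 \<and>
      (\<exists>(J :: ('m \<times> nat) set) (K :: ('m \<times> nat) set) \<xi> \<eta>.
         (\<forall>j\<in>J. free_generator (group_ring G) N\<^sub>2 (\<xi> j)) \<and>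
         (\<forall>k\<in>K. \<eta> k \<in> carrier N\<^sub>2 \<and> inj (\<lambda>n::int. [n] \<cdot>\<^bsub>N\<^sub>2\<^esub> \<eta> k) \<and>
            trivial_module \<alpha> (N\<^sub>2\<lparr>carrier := int_multiples N\<^sub>2 (\<eta> k)\<rparr>)) \<and>
         internal_direct_sum (group_ring G) N\<^sub>2 (J <+> K)
           (case_sum (\<lambda>j. cyclic_submodule (group_ring G) N\<^sub>2 (\<xi> j)) (\<lambda>k. int_multiples N\<^sub>2 (\<eta> k))) \<and>
         (\<forall>m\<in>carrier M.
            (\<exists>j\<in>J. \<exists>i::nat. m = g (frag_of (\<alpha> [^]\<^bsub>G\<^esub> i) \<odot>\<^bsub>N\<^sub>2\<^esub> \<xi> j)) \<or>
            (\<exists>k\<in>K. m = g (\<eta> k))))"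
proof -
  interpret prime_cyclic_group G p \<alpha>
    by (intro prime_cyclic_group.intro prime_cyclic_group_axioms.intro assms)
  interpret M: module "group_ring G" M by fact
  have frag_in: "frag_of x \<in> carrier (group_ring G)" if "x \<in> carrier G" for x
    using that by (simp add: carrier_group_ring)
  define a where "a m = frag_of \<alpha> \<odot>\<^bsub>M\<^esub> m" for m
  have a: "a m \<in> carrier M" if "m \<in> carrier M" for m
    using that by (simp add: a_def frag_in gen_in)
  have a_add: "a (m \<oplus>\<^bsub>M\<^esub> n) = a m \<oplus>\<^bsub>M\<^esub> a n" if "m \<in> carrier M" "n \<in> carrier M" for m n
    using that by (simp add: a_def M.smult_r_distr frag_in gen_in)
  have one: "frag_of \<one>\<^bsub>G\<^esub> \<odot>\<^bsub>M\<^esub> m = m" if "m \<in> carrier M" for m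
    using M.smult_one[OF that] by (simp add: group_ring_def)
  have a_pow: "a (frag_of (\<alpha> [^]\<^bsub>G\<^esub> i) \<odot>\<^bsub>M\<^esub> m) = frag_of (\<alpha> [^]\<^bsub>G\<^esub> Suc i) \<odot>\<^bsub>M\<^esub> m"
    if "m \<in> carrier M" for m and i :: nat
    using M.smult_assoc1[of "frag_of \<alpha>" "frag_of (\<alpha> [^]\<^bsub>G\<^esub> i)" m] that gen_in
      nat_pow_mult[OF gen_in, of 1 i]
    by (simp add: a_def frag_in mult_group_ring)

  \<comment> \<open>The permutation module \<open>L\<close>, with a free generator for every element of \<open>M\<close> and a fixed generator
    for every fixed element, and its map \<open>h\<close> to \<open>M\<close>.\<close>
  define F where "F = {m \<in> carrier M. a m = m}"
  let ?Y = "carrier M \<times> {..<p} <+> F"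
  define L where "L = perm_module p (carrier M) F"
  interpret L: cyc_module p "perm_act p" L unfolding L_def by (rule cyc_module_perm_module[OF p_pos])
  have carrier_L: "carrier (free_Abelian_group ?Y) = L"
    by (simp add: free_Abelian_group_def L_def perm_module_def fsupp_def)
  have "case_sum (\<lambda>(m, i). frag_of (\<alpha> [^]\<^bsub>G\<^esub> i) \<odot>\<^bsub>M\<^esub> m) (\<lambda>m. m) ` ?Y \<subseteq> carrier (add_monoid M)"
    using gen_in by (auto simp: F_def frag_in)
  from comm_group.free_Abelian_group_universal[OF M.a_comm_group this]
  obtain h where h: "h \<in> hom (free_Abelian_group ?Y) (add_monoid M)"
    and h_gen: "\<And>y. y \<in> ?Y \<Longrightarrow> h (frag_of y) = case_sum (\<lambda>(m, i). frag_of (\<alpha> [^]\<^bsub>G\<^esub> i) \<odot>\<^bsub>M\<^esub> m) (\<lambda>m. m) y"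
    by metis
  have h_in: "h x \<in> carrier M" if "x \<in> L" for x
    using hom_in_carrier[OF h, of x] that by (simp add: carrier_L)
  have h_add: "h (x + y) = h x \<oplus>\<^bsub>M\<^esub> h y" if "x \<in> L" "y \<in> L" for x y
    using hom_mult[OF h, of x y] that by (simp add: carrier_L)
  have h_diff: "h (x - y) = \<zero>\<^bsub>M\<^esub> \<longleftrightarrow> h x = h y" if "x \<in> L" "y \<in> L" for x y
  proof -
    have "h x = h (x - y) \<oplus>\<^bsub>M\<^esub> h y"
      using h_add[of "x - y" y] that by (simp add: subgrp_diff[OF L.subgrp])
    then show ?thesis
      using h_in[OF that(1)] h_in[OF that(2)] h_in[OF subgrp_diff[OF L.subgrp that]]
      by (metis M.add.r_cancel_one M.l_zero)
  qed
  have h_zero: "h 0 = \<zero>\<^bsub>M\<^esub>"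
    using h_diff[of 0 0] by (simp add: subgrp_zero[OF L.subgrp])
  have h_act: "h (perm_act p z) = a (h z)" if z: "z \<in> L" for z
  proof -
    have "z \<in> L \<and> h (perm_act p z) = a (h z)"
    proof (rule frag_induction[of z ?Y])
      show "Poly_Mapping.keys z \<subseteq> ?Y" using z by (simp add: L_def perm_module_def fsupp_def)
      have "a \<zero>\<^bsub>M\<^esub> = \<zero>\<^bsub>M\<^esub>" by (simp add: a_def frag_in gen_in)
      then show "0 \<in> L \<and> h (perm_act p 0) = a (h 0)"
        using h_zero by (simp add: subgrp_zero[OF L.subgrp] additive_on_zero[OF L.add L.subgrp])
    next
      fix y assume y: "y \<in> ?Y"
      from y have "h (perm_act p (frag_of y)) = a (h (frag_of y))"
      proof (rule PlusE)
        fix mi assume "mi \<in> carrier M \<times> {..<p}" "y = Inl mi"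
        then obtain m i where *: "m \<in> carrier M" "i < p" "y = Inl (m, i)" by auto
        have "\<alpha> [^]\<^bsub>G\<^esub> (Suc i mod p) = \<alpha> [^]\<^bsub>G\<^esub> Suc i" by (simp only: pow_gen_eq_iff mod_mod_trivial)
        moreover have "Inl (m, Suc i mod p) \<in> ?Y" using * p_pos by auto
        ultimately show ?thesis
          using y * a_pow[of m i] by (simp add: perm_act_def rot_def h_gen del: nat_pow_Suc)
      next
        fix m assume "m \<in> F" "y = Inr m"
        then show ?thesis using y by (simp add: perm_act_def rot_def h_gen) (simp add: F_def)
      qed
      then show "frag_of y \<in> L \<and> h (perm_act p (frag_of y)) = a (h (frag_of y))"
        using y by (simp add: L_def perm_module_def)
    next
      fix x y assume x: "x \<in> L \<and> h (perm_act p x) = a (h x)" and y: "y \<in> L \<and> h (perm_act p y) = a (h y)"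
      let ?u = "x - y"
      have u: "?u \<in> L" using x y by (simp add: subgrp_diff[OF L.subgrp])
      have "h (perm_act p x) = h (perm_act p ?u) \<oplus>\<^bsub>M\<^esub> h (perm_act p y)"
        using h_add[of "perm_act p ?u" "perm_act p y"] u x y additive_on_add[OF L.add, of ?u y] by (simp add: L.closed)
      moreover have "a (h x) = a (h ?u) \<oplus>\<^bsub>M\<^esub> a (h y)"
        using h_add[of ?u y] u y by (simp add: a_add h_in)
      ultimately have "h (perm_act p ?u) \<oplus>\<^bsub>M\<^esub> a (h y) = a (h ?u) \<oplus>\<^bsub>M\<^esub> a (h y)" using x y by simp
      then show "?u \<in> L \<and> h (perm_act p ?u) = a (h ?u)"
        using u y by (simp add: M.add.r_cancel h_in a L.closed)
    qed
    then show ?thesis by simp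
  qed
  have h_Inl: "frag_of (Inl (m, 0)) \<in> L" "h (frag_of (Inl (m, 0))) = m" if "m \<in> carrier M" for m
    using that h_gen[of "Inl (m, 0)"] p_pos one[OF that] by (auto simp: L_def perm_module_def)

  define N where "N = {z \<in> L. h z = \<zero>\<^bsub>M\<^esub>}"
  have NL: "N \<subseteq> L" by (auto simp: N_def)
  have N_sub: "subgrp N"
    by (rule subgrpI) (auto simp: N_def h_zero h_diff subgrp_zero[OF L.subgrp] subgrp_diff[OF L.subgrp])
  have "perm_act p z \<in> N" if "z \<in> N" for z
    using that by (simp add: N_def L.closed h_act) (simp add: a_def frag_in gen_in)
  then interpret N: cyc_module p "perm_act p" N by (rule L.cyc_module_subset[OF NL N_sub])
  \<comment> \<open>An element \<open>w\<close> of \<open>L\<close> whose boundary lies in \<open>N\<close> has a fixed image in \<open>M\<close>, which is also the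
    image of a fixed basis element.\<close>
  have H1: "\<exists>w\<in>N. z = perm_act p w - w" if z: "z \<in> N" "Nm p (perm_act p) z = 0" for z
  proof -
    obtain w where w: "w \<in> L" "z = perm_act p w - w"
      using perm_module_boundary[OF p_pos, of z "carrier M" F] z NL unfolding L_def by blast
    have "h (perm_act p w) = h w" using z(1) w h_diff[OF L.closed[OF w(1)] w(1)] by (simp add: N_def)
    then have F: "h w \<in> F" using w(1) by (simp add: F_def h_act h_in)
    let ?e = "frag_of (Inr (h w))"
    have e: "?e \<in> L" "h ?e = h w" "perm_act p ?e = ?e"
      using F h_gen[of "Inr (h w)"] by (auto simp: L_def perm_module_def perm_act_def rot_def)
    have "w - ?e \<in> N" using w(1) e by (simp add: N_def h_diff subgrp_diff[OF L.subgrp])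
    moreover have "z = perm_act p (w - ?e) - (w - ?e)"
      using w e(1) by (simp add: additive_on_diff[OF L.add L.subgrp] e(3))
    ultimately show ?thesis by blast
  qed

  \<comment> \<open>Injective codings of the index sets in the type of pairs\<close>
  define code0 :: "('m \<times> nat) + 'm \<Rightarrow> 'm \<times> nat" where
    "code0 = case_sum (\<lambda>(m, i). (m, Suc i)) (\<lambda>m. (m, 0))"
  define code :: "(('m \<times> nat) \<times> nat) + ('m \<times> nat) \<Rightarrow> 'm \<times> nat" where
    "code = case_sum (\<lambda>((m, i), k). (m, sum_encode (Inl (prod_encode (i, k))))) (\<lambda>(m, i). (m, sum_encode (Inr i)))"
  have inj0: "inj code0" by (auto simp: inj_def code0_def split: sum.splits)
  have inj: "inj code"
    by (auto simp: inj_def code_def inj_eq[OF inj_sum_encode[of UNIV]] inj_eq[OF inj_prod_encode[of UNIV]]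
        split: sum.splits)
  obtain J V S :: "('m \<times> nat) set" and \<Omega> where
    \<Omega>: "bij_betw \<Omega> (perm_module p J V \<times> Seq (perm_module p S ({} :: ('m \<times> nat) set))) (N \<times> Seq (perm_module p S ({} :: ('m \<times> nat) set)))"
      "additive_on (perm_module p J V \<times> Seq (perm_module p S {})) \<Omega>"
      "equivariant_on (perm_module p J V \<times> Seq (perm_module p S {})) (seq_act (perm_act p) (perm_act p)) (seq_act (perm_act p) (perm_act p)) \<Omega>"
  proof (rule N.stably_permutation[OF prime additive_zlin
        inj_on_subset[OF zlin_code_inj[OF inj0] subset_UNIV] inj H1], goal_cases)
    case (3 J V S \<Omega>)
    from 3(2-) show thesis by (rule 3(1))
  qed

  \<comment> \<open>The sequence is \<open>C1 \<rightarrow> C2 \<rightarrow> M\<close>, where the last map is \<open>h\<close> on the first component.\<close>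
  define P :: "((('m \<times> nat) \<times> nat) + ('m \<times> nat) \<Rightarrow>\<^sub>0 int) set" where "P = perm_module p S {}"
  define C1 where "C1 = N \<times> Seq P"
  define C2 where "C2 = L \<times> Seq P"
  let ?A = "seq_act (perm_act p) (perm_act p)"
  interpret P: cyc_module p "perm_act p" P unfolding P_def by (rule cyc_module_perm_module[OF p_pos])
  interpret C1: cyc_module p ?A C1
    unfolding C1_def by (rule cyc_module_seq[OF N.cyc_module_axioms P.cyc_module_axioms])
  interpret C2: cyc_module p ?A C2
    unfolding C2_def by (rule cyc_module_seq[OF L.cyc_module_axioms P.cyc_module_axioms])
  have C12: "C1 \<subseteq> C2" using NL by (auto simp: C1_def C2_def)
  let ?J1 = "J <+> S \<times> (UNIV :: nat set)" and ?J2 = "carrier M <+> S \<times> (UNIV :: nat set)"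
  obtain \<Psi>1 where \<Psi>1: "bij_betw \<Psi>1 (perm_module p ?J1 V) (perm_module p J V \<times> Seq P)" "additive_on (perm_module p ?J1 V) \<Psi>1"
    "equivariant_on (perm_module p ?J1 V) ?A (perm_act p) \<Psi>1"
    using perm_module_Seq[OF p_pos, of J S V] unfolding P_def by metis
  obtain \<Psi>2 where \<Psi>2: "bij_betw \<Psi>2 (perm_module p ?J2 F) C2" "additive_on (perm_module p ?J2 F) \<Psi>2"
    "equivariant_on (perm_module p ?J2 F) ?A (perm_act p) \<Psi>2"
    "\<And>m. \<Psi>2 (frag_of (Inl (Inl m, 0))) = (frag_of (Inl (m, 0)), 0)"
    using perm_module_Seq[OF p_pos, of "carrier M" S F] unfolding P_def C2_def L_def by metis
  have perm_sub: "subgrp (perm_module p X' V')" for X' :: "'x set" and V' :: "'y set"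
    by (simp add: perm_module_def subgrp_fsupp)

  \<comment> \<open>Embed the abelian group \<open>C2\<close> into the second component of the element type, and carry the
    action along.\<close>
  define codeJ :: "'m + ('m \<times> nat) \<times> nat \<Rightarrow> 'm \<times> nat" where
    "codeJ = case_sum (\<lambda>m. (m, 0)) (\<lambda>((m, i), k). (m, Suc (prod_encode (i, k))))"
  have injJ: "inj codeJ"
    by (auto simp: inj_def codeJ_def inj_eq[OF inj_prod_encode[of UNIV]] split: sum.splits)
  let ?c = "\<lambda>y. code (map_sum (map_prod codeJ id) (\<lambda>m. (m, 0)) y)"
  have "inj ?c"
    using inj_compose[OF inj sum.inj_map[OF prod.inj_map[OF injJ inj_on_id], of "\<lambda>m. (m, 0)"]]
    by (simp add: inj_def comp_def)
  from zlin_code_inj[OF this]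
  have inj_c: "inj (zlin (\<lambda>y. frag_of (?c y)))" .
  define \<Lambda> :: "_ \<Rightarrow> ('g, 'm) resolution_elem" where
    "\<Lambda> x = (0, zlin (\<lambda>y. frag_of (?c y)) (inv_into (perm_module p ?J2 F) \<Psi>2 x))" for x
  have \<Psi>2_inv: "additive_on C2 (inv_into (perm_module p ?J2 F) \<Psi>2)" "inj_on (inv_into (perm_module p ?J2 F) \<Psi>2) C2"
    using additive_on_inv_into[OF \<Psi>2(1,2) perm_sub] bij_betw_inv_into[OF \<Psi>2(1)]
    by (auto simp: bij_betw_def)
  have \<Lambda>: "additive_on C2 \<Lambda>" "inj_on \<Lambda> C2"
  proof -
    show "additive_on C2 \<Lambda>"
      by (rule additive_onI) (simp add: \<Lambda>_def additive_on_add[OF \<Psi>2_inv(1)] zlin_add)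
    show "inj_on \<Lambda> C2"
      by (rule inj_onI) (auto simp: \<Lambda>_def dest!: injD[OF inj_c] dest: inj_onD[OF \<Psi>2_inv(2)])
  qed
  define B where "B = (\<lambda>y. \<Lambda> (?A (inv_into C2 \<Lambda> y)))"
  define H1 where "H1 = \<Lambda> ` C1"
  define H2 where "H2 = \<Lambda> ` C2"
  have B: "cyc_module p B H2" "equivariant_on C2 B ?A \<Lambda>"
    using C2.transport[OF \<Lambda>] by (simp_all add: B_def H2_def)
  interpret H2: cyc_module p B H2 by (rule B)
  have H12: "H1 \<subseteq> H2" using C12 by (auto simp: H1_def H2_def)
  have "B y \<in> H1" if "y \<in> H1" for y
  proof -
    obtain x where x: "x \<in> C1" "y = \<Lambda> x" using \<open>y \<in> H1\<close> by (auto simp: H1_def)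
    have "B y = \<Lambda> (?A x)" using equivariant_onD[OF B(2), of x] x C12 by (simp add: subsetD)
    then show ?thesis using C1.closed[OF x(1)] by (simp add: H1_def)
  qed
  moreover have "subgrp H1"
    unfolding H1_def by (rule subgrp_image[OF additive_on_subset[OF \<Lambda>(1) C12] C1.subgrp])
  ultimately interpret H1: cyc_module p B H1 by (intro H2.cyc_module_subset[OF H12])

  have bij2: "bij_betw \<Lambda> C2 H2" and bij1: "bij_betw \<Lambda> C1 H1"
    using \<Lambda>(2) inj_on_subset[OF \<Lambda>(2) C12] by (auto simp: bij_betw_def H1_def H2_def)
  have \<Psi>2_in: "\<Psi>2 x \<in> C2" if "x \<in> perm_module p ?J2 F" for x using \<Psi>2(1) that by (auto simp: bij_betw_def)
  have "perm_basis p B H2 ?J2 F (\<lambda>j. \<Lambda> (\<Psi>2 (frag_of (Inl (j, 0))))) (\<lambda>v. \<Lambda> (\<Psi>2 (frag_of (Inr v))))"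
  proof (rule H2.perm_basis_of_iso)
    show "bij_betw (\<lambda>x. \<Lambda> (\<Psi>2 x)) (perm_module p ?J2 F) H2"
      using bij_betw_trans[OF \<Psi>2(1) bij2] by (simp add: comp_def)
    show "additive_on (perm_module p ?J2 F) (\<lambda>x. \<Lambda> (\<Psi>2 x))" by (rule additive_on_comp[OF \<Lambda>(1) \<Psi>2(2) \<Psi>2_in])
    show "equivariant_on (perm_module p ?J2 F) B (perm_act p) (\<lambda>x. \<Lambda> (\<Psi>2 x))"
      by (rule equivariant_on_comp[OF B(2) \<Psi>2(3) \<Psi>2_in])
  qed
  moreover have "bij_betw (inv_into ?J2 codeJ) (codeJ ` ?J2) ?J2"
    using bij_betw_inv_into[of codeJ ?J2 "codeJ ` ?J2"] inj_on_subset[OF injJ subset_UNIV]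
    by (simp add: bij_betw_def)
  moreover have "bij_betw fst (F \<times> {0 :: nat}) F" by (auto simp: bij_betw_def inj_on_def)
  ultimately have pb2: "perm_basis p B H2 (codeJ ` ?J2) (F \<times> {0 :: nat})
      (\<lambda>j. \<Lambda> (\<Psi>2 (frag_of (Inl (inv_into ?J2 codeJ j, 0))))) (\<lambda>v. \<Lambda> (\<Psi>2 (frag_of (Inr (fst v)))))"
    (is "perm_basis p B H2 ?J ?K ?\<xi> ?\<eta>")
    by (rule perm_basis_reindex)
  have \<Omega>_in: "\<Omega> x \<in> C1" if "x \<in> perm_module p J V \<times> Seq P" for x
    using \<Omega>(1) that by (auto simp: bij_betw_def C1_def P_def)
  have \<Psi>1_in: "\<Psi>1 x \<in> perm_module p J V \<times> Seq P" if "x \<in> perm_module p ?J1 V" for x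
    using \<Psi>1(1) that unfolding bij_betw_def by blast
  have pb1: "perm_basis p B H1 ?J1 V (\<lambda>j. \<Lambda> (\<Omega> (\<Psi>1 (frag_of (Inl (j, 0)))))) (\<lambda>v. \<Lambda> (\<Omega> (\<Psi>1 (frag_of (Inr v)))))"
  proof (rule H1.perm_basis_of_iso)
    note \<Omega>' = \<Omega>[folded P_def, folded C1_def]
    show "bij_betw (\<lambda>x. \<Lambda> (\<Omega> (\<Psi>1 x))) (perm_module p ?J1 V) H1"
      using bij_betw_trans[OF bij_betw_trans[OF \<Psi>1(1) \<Omega>'(1)] bij1] by (simp add: comp_def)
    show "additive_on (perm_module p ?J1 V) (\<lambda>x. \<Lambda> (\<Omega> (\<Psi>1 x)))"
      by (rule additive_on_comp[OF additive_on_subset[OF \<Lambda>(1) C12]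
            additive_on_comp[OF \<Omega>'(2) \<Psi>1(2) \<Psi>1_in] \<Omega>_in[OF \<Psi>1_in]])
    have "equivariant_on C1 B ?A \<Lambda>" using B(2) C12 by (auto simp: equivariant_on_def)
    then show "equivariant_on (perm_module p ?J1 V) B (perm_act p) (\<lambda>x. \<Lambda> (\<Omega> (\<Psi>1 x)))"
      by (rule equivariant_on_comp[OF _ equivariant_on_comp[OF \<Omega>'(3) \<Psi>1(3) \<Psi>1_in] \<Omega>_in[OF \<Psi>1_in]])
  qed

  define g where "g y = h (fst (inv_into C2 \<Lambda> y))" for y
  have g: "g (\<Lambda> x) = h (fst x)" if "x \<in> C2" for x
    using inv_into_f_f[OF \<Lambda>(2) that] by (simp add: g_def)
  have g_in: "g y \<in> carrier M" if "y \<in> H2" for y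
    using that by (auto simp: H2_def g C2_def h_in)
  have g_add: "g (x + y) = g x \<oplus>\<^bsub>M\<^esub> g y" if xy: "x \<in> H2" "y \<in> H2" for x y
  proof -
    obtain x' y' where *: "x' \<in> C2" "y' \<in> C2" "x = \<Lambda> x'" "y = \<Lambda> y'" using xy unfolding H2_def by blast
    then have "g (x + y) = h (fst x' + fst y')"
      using g[OF subgrp_add[OF C2.subgrp *(1,2)]] by (simp add: additive_on_add[OF \<Lambda>(1)])
    then show ?thesis using * by (auto simp: g h_add C2_def)
  qed
  have g_B: "g (B y) = a (g y)" if y: "y \<in> H2" for y
  proof -
    obtain x where x: "x \<in> C2" "y = \<Lambda> x" using y unfolding H2_def by blast
    have "fst x \<in> L" "fst (?A x) = perm_act p (fst x)" using x(1) by (auto simp: C2_def seq_act_def)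
    moreover have "B y = \<Lambda> (?A x)" using equivariant_onD[OF B(2) x(1)] x(2) by simp
    ultimately show ?thesis using x g[OF C2.closed[OF x(1)]] by (simp add: g h_act)
  qed
  have g_pow: "g ((B ^^ i) y) = frag_of (\<alpha> [^]\<^bsub>G\<^esub> i) \<odot>\<^bsub>M\<^esub> g y" if y: "y \<in> H2" for y and i :: nat
  proof (induction i)
    case 0 then show ?case using one g_in[OF y] by simp
  next
    case (Suc i)
    then show ?case
      using g_B[OF H2.pow_closed[OF y]] a_pow[OF g_in[OF y], of i] by (simp del: nat_pow_Suc)
  qed
  have g_zero: "g 0 = \<zero>\<^bsub>M\<^esub>"
    using g_add[of 0 0] g_in[of 0] by (simp add: subgrp_zero[OF H2.subgrp])
  have g_act: "g (act B r y) = r \<odot>\<^bsub>M\<^esub> g y" if r: "r \<in> carrier (group_ring G)" and y: "y \<in> H2" for r y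
  proof -
    have act_in: "act B s y \<in> H2" for s by (rule act_closed[OF H2.cyc_module_axioms y])
    have "r \<in> carrier (group_ring G) \<and> g (act B r y) = r \<odot>\<^bsub>M\<^esub> g y"
    proof (rule frag_induction[of r "carrier G"])
      show "Poly_Mapping.keys r \<subseteq> carrier G" using r by (simp add: carrier_group_ring fsupp_def)
      have "ring.zero (group_ring G) = 0" by (simp add: group_ring_def)
      then show "0 \<in> carrier (group_ring G) \<and> g (act B 0 y) = 0 \<odot>\<^bsub>M\<^esub> g y"
        using M.smult_l_null[OF g_in[OF y]] M.R.zero_closed g_zero by (simp add: act_def)
    next
      fix x assume x: "x \<in> carrier G"
      then obtain i :: nat where "x = \<alpha> [^]\<^bsub>G\<^esub> i" using carrier_pow by blast
      then show "frag_of x \<in> carrier (group_ring G) \<and> g (act B (frag_of x) y) = frag_of x \<odot>\<^bsub>M\<^esub> g y"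
        using x by (simp add: frag_in act_gen_pow[OF H2.cyc_module_axioms y] g_pow[OF y])
    next
      fix s t
      assume s: "s \<in> carrier (group_ring G) \<and> g (act B s y) = s \<odot>\<^bsub>M\<^esub> g y"
        and t: "t \<in> carrier (group_ring G) \<and> g (act B t y) = t \<odot>\<^bsub>M\<^esub> g y"
      have st: "s - t \<in> carrier (group_ring G)"
        using s t by (simp add: carrier_group_ring subgrp_diff[OF subgrp_fsupp])
      have "g (act B s y) = g (act B (s - t) y) \<oplus>\<^bsub>M\<^esub> g (act B t y)"
        using g_add[OF act_in act_in, of "s - t" t] by (simp add: act_add_left[symmetric])
      moreover have "s \<odot>\<^bsub>M\<^esub> g y = (s - t) \<odot>\<^bsub>M\<^esub> g y \<oplus>\<^bsub>M\<^esub> t \<odot>\<^bsub>M\<^esub> g y"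
        using M.smult_l_distr[OF st conjunct1[OF t] g_in[OF y]] by (simp add: add_group_ring)
      ultimately have "g (act B (s - t) y) \<oplus>\<^bsub>M\<^esub> t \<odot>\<^bsub>M\<^esub> g y = (s - t) \<odot>\<^bsub>M\<^esub> g y \<oplus>\<^bsub>M\<^esub> t \<odot>\<^bsub>M\<^esub> g y"
        using s t by simp
      then show "s - t \<in> carrier (group_ring G) \<and> g (act B (s - t) y) = (s - t) \<odot>\<^bsub>M\<^esub> g y"
        using st t g_in[OF act_in] g_in[OF y] by (simp add: M.add.r_cancel)
    qed
    then show ?thesis by simp
  qed
  have H1_kernel: "H1 = {y \<in> H2. g y = \<zero>\<^bsub>M\<^esub>}"
    by (auto simp: H1_def H2_def g C1_def C2_def N_def intro!: imageI)
  have g_\<xi>: "g (\<Lambda> (\<Psi>2 (frag_of (Inl (Inl m, 0))))) = m" if m: "m \<in> carrier M" for m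
  proof -
    have "(frag_of (Inl (m, 0)), 0) \<in> C2"
      using h_Inl[OF m] subgrp_zero[OF subgrp_Seq[OF P.subgrp]] by (simp add: C2_def)
    then show ?thesis using h_Inl[OF m] by (simp add: \<Psi>2(4) g)
  qed
  have gen_in2: "Inl m \<in> ?J2" if "m \<in> carrier M" for m using that by auto
  have g_onto: "\<exists>j\<in>?J. ?\<xi> j \<in> H2 \<and> g (?\<xi> j) = m" if m: "m \<in> carrier M" for m
    using perm_basis_in(1)[OF H2.cyc_module_axioms pb2, of "codeJ (Inl m)"] g_\<xi>[OF m] gen_in2[OF m]
      inv_into_f_f[OF inj_on_subset[OF injJ subset_UNIV] gen_in2[OF m]]
    by (intro bexI[of _ "codeJ (Inl m)"]) auto

  have exact: "module_short_exact (group_ring G) (op_module B H1) (op_module B H2) M (\<lambda>x. x) g"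
    unfolding module_short_exact_def
  proof (intro conjI)
    show "(\<lambda>x. x) \<in> module_hom (group_ring G) (op_module B H1) (op_module B H2)"
      using H12 by (auto simp: module_hom_def hom_def)
    show "g \<in> module_hom (group_ring G) (op_module B H2) M"
      using g_in g_add g_act by (auto simp: module_hom_def hom_def)
    show "(\<lambda>x. x) ` carrier (op_module B H1) = kernel (add_monoid (op_module B H2)) (add_monoid M) g"
      using H1_kernel by (simp add: kernel_def)
    show "g ` carrier (op_module B H2) = carrier M"
      using g_in g_onto by (auto simp: image_iff) metis
  qed simp
  have basis: "\<exists>(J :: ('m \<times> nat) set) (K :: ('m \<times> nat) set) \<xi> \<eta>.
      (\<forall>j\<in>J. free_generator (group_ring G) (op_module B H2) (\<xi> j)) \<and>
      (\<forall>k\<in>K. \<eta> k \<in> carrier (op_module B H2) \<and> inj (\<lambda>n::int. [n] \<cdot>\<^bsub>op_module B H2\<^esub> \<eta> k) \<and>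
         trivial_module \<alpha> (op_module B H2\<lparr>carrier := int_multiples (op_module B H2) (\<eta> k)\<rparr>)) \<and>
      internal_direct_sum (group_ring G) (op_module B H2) (J <+> K)
        (case_sum (\<lambda>j. cyclic_submodule (group_ring G) (op_module B H2) (\<xi> j))
          (\<lambda>k. int_multiples (op_module B H2) (\<eta> k))) \<and>
      (\<forall>m\<in>carrier M.
         (\<exists>j\<in>J. \<exists>i::nat. m = g (frag_of (\<alpha> [^]\<^bsub>G\<^esub> i) \<odot>\<^bsub>op_module B H2\<^esub> \<xi> j)) \<or>
         (\<exists>k\<in>K. m = g (\<eta> k)))"
  proof (rule exI[of _ ?J], rule exI[of _ ?K], rule exI[of _ ?\<xi>], rule exI[of _ ?\<eta>], intro conjI ballI)
    show "free_generator (group_ring G) (op_module B H2) (?\<xi> j)" if "j \<in> ?J" for j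
      by (rule free_generator_op_module[OF H2.cyc_module_axioms pb2 that])
    show "?\<eta> k \<in> carrier (op_module B H2)" if "k \<in> ?K" for k
      using perm_basis_in(2)[OF H2.cyc_module_axioms pb2 that] by simp
    show "inj (\<lambda>n::int. [n] \<cdot>\<^bsub>op_module B H2\<^esub> ?\<eta> k)" if "k \<in> ?K" for k
      by (rule trivial_generator_op_module(1)[OF H2.cyc_module_axioms pb2 that])
    show "trivial_module \<alpha> (op_module B H2\<lparr>carrier := int_multiples (op_module B H2) (?\<eta> k)\<rparr>)" if "k \<in> ?K" for k
      using trivial_generator_op_module(3)[OF H2.cyc_module_axioms pb2 that] by simp
    show "internal_direct_sum (group_ring G) (op_module B H2) (?J <+> ?K)
       (case_sum (\<lambda>j. cyclic_submodule (group_ring G) (op_module B H2) (?\<xi> j)) (\<lambda>k. int_multiples (op_module B H2) (?\<eta> k)))"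
      by (rule direct_sum_op_module[OF H2.cyc_module_axioms pb2])
    show "(\<exists>j\<in>?J. \<exists>i::nat. m = g (frag_of (\<alpha> [^]\<^bsub>G\<^esub> i) \<odot>\<^bsub>op_module B H2\<^esub> ?\<xi> j)) \<or> (\<exists>k\<in>?K. m = g (?\<eta> k))"
      if m: "m \<in> carrier M" for m
    proof -
      obtain j where j: "j \<in> ?J" "?\<xi> j \<in> H2" "g (?\<xi> j) = m" using g_onto[OF m] by blast
      have "act B (frag_of (\<alpha> [^]\<^bsub>G\<^esub> (0::nat))) (?\<xi> j) = ?\<xi> j"
        using act_gen_pow[OF H2.cyc_module_axioms j(2), of 0] by simp
      then have "m = g (frag_of (\<alpha> [^]\<^bsub>G\<^esub> (0::nat)) \<odot>\<^bsub>op_module B H2\<^esub> ?\<xi> j)" using j(3) by simp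
      then show ?thesis using j(1) by blast
    qed
  qed
  show ?thesis
  proof (rule exI[of _ "op_module B H1"], rule exI[of _ "op_module B H2"], rule exI[of _ "\<lambda>x. x"],
      rule exI[of _ g], intro conjI)
    show "module (group_ring G) (op_module B H1)" "module (group_ring G) (op_module B H2)"
      by (rule module_op_module[OF H1.cyc_module_axioms], rule module_op_module[OF H2.cyc_module_axioms])
    show "free_abelian (add_monoid (op_module B H1))" "free_abelian (add_monoid (op_module B H2))"
      by (rule free_abelian_op_module[OF perm_basis_zbasis[OF H1.cyc_module_axioms pb1]],
          rule free_abelian_op_module[OF perm_basis_zbasis[OF H2.cyc_module_axioms pb2]])
    show "free_plus_trivial G \<alpha> (op_module B H1)" "free_plus_trivial G \<alpha> (op_module B H2)"
      by (rule free_plus_trivial_op_module[OF H1.cyc_module_axioms pb1],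
          rule free_plus_trivial_op_module[OF H2.cyc_module_axioms pb2])
  qed (fact exact basis)+
qed

end
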